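(* Let $q$ be a prime power, $n\ge 2$, and $m\le q^{n-1}$. Every $(n-1,m)$-Hom-Furstenberg algebra $R=\mathbb{F}_q[x_1,\dots,x_n]/I$ satisfies $$\dim_{\mathbb{F}_q} R\ge C_{n,n-1}\,m^{n/(n-1)}\quad\text{with } C_{n,n-1}\ge 1/16,$$ i.e. $\dim_{\mathbb{F}_q}R\ge m^{n/(n-1)}/16$.
   Context: For an ideal $I\subseteq\mathbb{F}_q[x_1,\dots,x_n]$, $R=\mathbb{F}_q[x_1,\dots,x_n]/I$; $\dim_{\mathbb{F}_q}R$ is its vector space dimension, assumed finite. For an affine subspace $W$ let $\mathbf{I}(W)$ be the ideal of polynomials vanishing on $W$ and $R\sqcap W:=\mathbb{F}_q[x_1,\dots,x_n]/(I+\mathbf{I}(W))$; $W$ is $(R,m)$-rich if $\dim(R\sqcap W)\ge m$. $R$ (with $I$ homogeneous, $R$ finite-dimensional) is $(k,m)$-Hom-Furstenberg if every $k$-dimensional linear subspace of $\mathbb{F}_q^n$ is $(R,m)$-rich. *)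

theory Defs
  imports
    "HOL-Analysis.Analysis"
    "HOL-Library.Poly_Mapping"
    "HOL-Algebra.Embedded_Algebras"
    "HOL-Algebra.QuotRing"
    "HOL-Algebra.Algebraic_Closure_Type"
begin

text \<open>
  A monomial is an exponent vector \<open>'n \<Rightarrow>\<^sub>0 nat\<close>. For a finite type \<open>'n\<close> and a field \<open>'a\<close>,
  \<open>('n, 'a) mpoly\<close> is the polynomial ring over \<open>'a\<close> in \<open>CARD('n)\<close> variables, with the convolution
  product from \<^theory>\<open>HOL-Library.Poly_Mapping\<close>.
\<close>

type_synonym ('n, 'a) mpoly = "('n \<Rightarrow>\<^sub>0 nat) \<Rightarrow>\<^sub>0 'a"

abbreviation mpoly_ring :: "('n::finite, 'a::field) mpoly ring" where
  "mpoly_ring \<equiv> ring_of_type_algebra"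

definition const_mpoly :: "'a::field \<Rightarrow> ('n::finite, 'a) mpoly" where
  "const_mpoly c = Poly_Mapping.single 0 c"

definition mpoly_eval :: "('n::finite, 'a::field) mpoly \<Rightarrow> 'a ^ 'n \<Rightarrow> 'a" where
  "mpoly_eval p x =
     (\<Sum>e\<in>Poly_Mapping.keys p. Poly_Mapping.lookup p e * (\<Prod>i\<in>UNIV. (x $ i) ^ Poly_Mapping.lookup e i))"

definition mon_degree :: "('n::finite \<Rightarrow>\<^sub>0 nat) \<Rightarrow> nat" where
  "mon_degree e = (\<Sum>i\<in>UNIV. Poly_Mapping.lookup e i)"

definition homogeneous_mpoly :: "('n::finite, 'a::field) mpoly \<Rightarrow> bool" where
  "homogeneous_mpoly p \<longleftrightarrow> (\<exists>d. \<forall>e\<in>Poly_Mapping.keys p. mon_degree e = d)"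

definition homogeneous_ideal :: "('n::finite, 'a::field) mpoly set \<Rightarrow> bool" where
  "homogeneous_ideal I \<longleftrightarrow> (\<exists>S. (\<forall>p\<in>S. homogeneous_mpoly p) \<and> I = Idl\<^bsub>mpoly_ring\<^esub> S)"

text \<open>
  The quotient algebra is \<open>mpoly_ring Quot I\<close>; its ground field is the set of residue classes of
  constant polynomials.
\<close>

definition quot_scalars :: "('n::finite, 'a::field) mpoly set \<Rightarrow> ('n, 'a) mpoly set set" where
  "quot_scalars I = range (\<lambda>c. I +>\<^bsub>mpoly_ring\<^esub> const_mpoly c)"

definition quot_finite_dim :: "('n::finite, 'a::field) mpoly set \<Rightarrow> bool" where
  "quot_finite_dim I \<longleftrightarrow>
     ring.finite_dimension (mpoly_ring Quot I) (quot_scalars I) (carrier (mpoly_ring Quot I))"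

definition quot_dim :: "('n::finite, 'a::field) mpoly set \<Rightarrow> nat" where
  "quot_dim I = ring.dim (mpoly_ring Quot I) (quot_scalars I) (carrier (mpoly_ring Quot I))"

text \<open>
  An affine subspace \<open>W\<close> of \<open>\<bbbF>\<^sub>q\<^sup>n\<close> is regarded as a subvariety of affine \<open>n\<close>-space, as usual when
  \<open>R \<sqinter> W\<close> is read as an intersection of schemes. So \<open>\<^bold>I(W)\<close> consists of the polynomials that vanish
  at all points of \<open>W\<close> over the algebraic closure, i.e. on the affine hull of \<open>W\<close> there, and not only
  at the finitely many \<open>\<bbbF>\<^sub>q\<close>-rational points. Vanishing at the rational points alone would put every
  \<open>x\<^sub>i\<^sup>q - x\<^sub>i\<close> into \<open>\<^bold>I(W)\<close>; for homogeneous \<open>I\<close> of finite codimension and linear \<open>W\<close>, all of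
  \<open>x\<^sub>1, \<dots>, x\<^sub>n\<close> would then lie in \<open>I + \<^bold>I(W)\<close>, forcing \<open>dim (R \<sqinter> W) \<le> 1\<close>.
  The sum over \<open>W\<close> is finite since the field is.
\<close>

definition geometric_points :: "('a::{field,finite} ^ 'n::finite) set \<Rightarrow> ('a alg_closure ^ 'n) set" where
  "geometric_points W = {\<Sum>w\<in>W. c w *s (\<chi> i. to_ac (w $ i)) | c. (\<Sum>w\<in>W. c w) = 1}"

definition vanishing_ideal :: "('a::{field,finite} ^ 'n::finite) set \<Rightarrow> ('n, 'a) mpoly set" where
  "vanishing_ideal W = {p. \<forall>x\<in>geometric_points W. mpoly_eval (Poly_Mapping.map to_ac p) x = 0}"

definition rich :: "('n::finite, 'a::{field,finite}) mpoly set \<Rightarrow> nat \<Rightarrow> ('a ^ 'n) set \<Rightarrow> bool" where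
  "rich I m W \<longleftrightarrow> m \<le> quot_dim (I <+>\<^bsub>mpoly_ring\<^esub> vanishing_ideal W)"

definition hom_furstenberg :: "nat \<Rightarrow> nat \<Rightarrow> ('n::finite, 'a::{field,finite}) mpoly set \<Rightarrow> bool" where
  "hom_furstenberg k m I \<longleftrightarrow>
     ideal I mpoly_ring \<and> homogeneous_ideal I \<and> quot_finite_dim I \<and>
     (\<forall>W. vec.subspace W \<and> vec.dim W = k \<longrightarrow> rich I m W)"

end

theory Submission
  imports Defs "Jordan_Normal_Form.Determinant"
begin

text \<open>
  Let \<open>K\<close> be the algebraic closure of \<open>\<bbbF>\<^sub>q\<close>, \<open>D = dim R\<close> and \<open>N = n - 1\<close>. Richness of the hyperplane \<open>\<ell> = 0\<close> says
  that multiplication by the linear form \<open>\<ell>\<close> on \<open>R\<close> has corank at least \<open>m\<close>.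

  Suppose that some linear form over \<open>K\<close> has corank less than \<open>15 m / 16\<close> on \<open>R \<otimes> K\<close>. A suitable minor is then a
  nonzero polynomial of degree at most \<open>D\<close> in the coefficients of the form, and it vanishes to order more than
  \<open>m / 16\<close> at every \<open>\<bbbF>\<^sub>q\<close>-rational form. By the Schwartz--Zippel lemma with multiplicities,
  \<open>D \<ge> q m / 16 \<ge> m ^ (1 + 1 / N) / 16\<close>.

  Otherwise every linear form over \<open>K\<close> has corank at least \<open>15 m / 16\<close>. Choose \<open>\<ell>\<close> such that \<open>\<ell> ^ j\<close> has maximal rank,
  where \<open>j\<close> is about \<open>15 m ^ (1 / N) / 64\<close>. Perturbing \<open>\<ell>\<close> to \<open>\<ell> + t x\<^sub>i\<close> shows that \<open>\<ell> ^ j f = 0\<close> implies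
  \<open>x\<^sub>i ^ j f \<in> \<ell> R\<close>. Let \<open>\<Sigma>\<close> be the set of standard monomials of \<open>R / \<ell> R\<close>, which has at least \<open>15 m / 16\<close>
  elements in \<open>N\<close> variables, and let \<open>\<Sigma>'\<close> consist of those \<open>u \<in> \<Sigma>\<close> for which some \<open>x\<^sub>i ^ j u\<close> is standard as well. Then
  the elements \<open>u \<in> \<Sigma>\<close> and \<open>\<ell> ^ i u\<close> with \<open>1 \<le> i \<le> j\<close> and \<open>u \<in> \<Sigma>'\<close> are linearly independent, so \<open>D \<ge> |\<Sigma>| + j |\<Sigma>'|\<close>;
  and a double count gives \<open>|\<Sigma>| \<le> (2 N choose N) j ^ N + 2 N / (N + 1) |\<Sigma>'|\<close>.
\<close>

hide_const (open) up_ring.coeff up_ring.monom Coset.order module.smult Polynomials.degree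

section \<open>Schwartz--Zippel with multiplicities\<close>

text \<open>
  Polynomial functions of total degree at most \<open>d\<close> in \<open>n\<close> variables with coefficients in \<open>K\<close>. Their arguments range
  over \<open>K[t]\<close>, so that they can be restricted to lines \<open>a + t v\<close>.
\<close>

fun polyfun :: "nat \<Rightarrow> nat \<Rightarrow> ('k::field poly list \<Rightarrow> 'k poly) \<Rightarrow> bool" where
  "polyfun 0 d f \<longleftrightarrow> (\<exists>c. f [] = [:c:])"
| "polyfun (Suc n) d f \<longleftrightarrow> (\<exists>g. (\<forall>i\<le>d. polyfun n (d - i) (g i)) \<and>
     (\<forall>x xs. length xs = n \<longrightarrow> f (x # xs) = (\<Sum>i\<le>d. x ^ i * g i xs)))"

lemma polyfun_const: "polyfun n d (\<lambda>_. [:c:])"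
proof (induction n arbitrary: d c)
  case (Suc n)
  have "(\<Sum>i\<le>d. x ^ i * (if i = 0 then [:c:] else [:0:])) = [:c:]" for x :: "'a poly"
    by (subst sum.remove[of _ 0]) auto
  then show ?case
    using Suc[of _ c] Suc[of _ 0]
    by (auto intro!: exI[of _ "\<lambda>i _. if i = 0 then [:c:] else [:0:]"])
qed auto

lemma polyfun_add: "polyfun n d f \<Longrightarrow> polyfun n d g \<Longrightarrow> polyfun n d (\<lambda>xs. f xs + g xs)"
proof (induction n arbitrary: d f g)
  case 0
  then show ?case by (auto intro: exI[of _ "_ + _"])
next
  case (Suc n)
  from Suc.prems obtain f' g'
    where f': "\<And>i. i \<le> d \<Longrightarrow> polyfun n (d - i) (f' i)"
        "\<And>x xs. length xs = n \<Longrightarrow> f (x # xs) = (\<Sum>i\<le>d. x ^ i * f' i xs)"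
      and g': "\<And>i. i \<le> d \<Longrightarrow> polyfun n (d - i) (g' i)"
        "\<And>x xs. length xs = n \<Longrightarrow> g (x # xs) = (\<Sum>i\<le>d. x ^ i * g' i xs)"
    by auto
  show ?case
    using f' g' Suc.IH
    by (auto intro!: exI[of _ "\<lambda>i xs. f' i xs + g' i xs"] simp: sum.distrib algebra_simps)
qed

lemma polyfun_smult: "polyfun n d f \<Longrightarrow> polyfun n d (\<lambda>xs. [:c:] * f xs)"
proof (induction n arbitrary: d f)
  case 0
  then show ?case by auto
next
  case (Suc n)
  from Suc.prems obtain f'
    where f': "\<And>i. i \<le> d \<Longrightarrow> polyfun n (d - i) (f' i)"
        "\<And>x xs. length xs = n \<Longrightarrow> f (x # xs) = (\<Sum>i\<le>d. x ^ i * f' i xs)"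
    by auto
  show ?case
    unfolding polyfun.simps
    using f'(1) Suc.IH
    by (intro exI[of _ "\<lambda>i xs. [:c:] * f' i xs"] conjI allI impI)
      (simp_all only: f'(2) sum_distrib_left mult.left_commute)
qed

lemma polyfun_sum:
  "finite A \<Longrightarrow> (\<And>k. k \<in> A \<Longrightarrow> polyfun n d (f k)) \<Longrightarrow> polyfun n d (\<lambda>xs. \<Sum>k\<in>A. f k xs)"
proof (induction A rule: finite_induct)
  case empty
  then show ?case using polyfun_const[of n d 0] by simp
qed (auto intro: polyfun_add)

lemma polyfun_Suc_degree: "polyfun n d f \<Longrightarrow> polyfun n (Suc d) f"
proof (induction n arbitrary: d f)
  case (Suc n)
  from Suc.prems obtain f'
    where f': "\<And>i. i \<le> d \<Longrightarrow> polyfun n (d - i) (f' i)"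
        "\<And>x xs. length xs = n \<Longrightarrow> f (x # xs) = (\<Sum>i\<le>d. x ^ i * f' i xs)"
    by auto
  define h where "h i = (if i \<le> d then f' i else (\<lambda>_. 0))" for i
  have "polyfun n (Suc d - i) (h i)" for i
    using f'(1)[of i] Suc.IH[of "d - i" "f' i"] polyfun_const[of n "Suc d - i" 0]
    by (auto simp: h_def Suc_diff_le)
  moreover have "f (x # xs) = (\<Sum>i\<le>Suc d. x ^ i * h i xs)" if "length xs = n" for x xs
    using f'(2)[OF that] by (simp add: h_def)
  ultimately show ?case by auto
qed auto

lemma polyfun_mult_var:
  "k < n \<Longrightarrow> polyfun n d f \<Longrightarrow> polyfun n (Suc d) (\<lambda>xs. xs ! k * f xs)"
proof (induction n arbitrary: d f k)
  case (Suc n)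
  from Suc.prems obtain f'
    where f': "\<And>i. i \<le> d \<Longrightarrow> polyfun n (d - i) (f' i)"
        "\<And>x xs. length xs = n \<Longrightarrow> f (x # xs) = (\<Sum>i\<le>d. x ^ i * f' i xs)"
    by auto
  show ?case
  proof (cases k)
    case 0
    define h where "h i = (case i of 0 \<Rightarrow> (\<lambda>_. 0) | Suc i' \<Rightarrow> f' i')" for i
    have "polyfun n (Suc d - i) (h i)" if "i \<le> Suc d" for i
      using that f'(1)[of "i - 1"] polyfun_const[of n "Suc d - i" 0]
      by (auto simp: h_def split: nat.split)
    moreover have "x * f (x # xs) = (\<Sum>i\<le>Suc d. x ^ i * h i xs)" if "length xs = n" for x xs
    proof -
      have "(\<Sum>i\<le>Suc d. x ^ i * h i xs) = (\<Sum>i\<le>d. x ^ Suc i * h (Suc i) xs)"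
        by (subst sum.atMost_Suc_shift) (simp add: h_def)
      then show ?thesis
        using f'(2)[OF that] by (simp add: h_def sum_distrib_left mult.assoc)
    qed
    ultimately show ?thesis using 0 by auto
  next
    case (Suc k')
    define h where "h i = (if i \<le> d then (\<lambda>xs. xs ! k' * f' i xs) else (\<lambda>_. 0))" for i
    have "polyfun n (Suc d - i) (h i)" for i
      using f'(1)[of i] Suc.IH[of k' "d - i" "f' i"] Suc Suc.prems(1) polyfun_const[of n "Suc d - i" 0]
      by (auto simp: h_def Suc_diff_le)
    moreover have "xs ! k' * f (x # xs) = (\<Sum>i\<le>Suc d. x ^ i * h i xs)" if "length xs = n" for x xs
      using f'(2)[OF that] by (simp add: h_def sum_distrib_left algebra_simps)
    ultimately show ?thesis using Suc by auto
  qed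
qed auto

text \<open>Such products are the terms in the Leibniz expansion of a determinant with affine
  entries; each factor raises the degree bound by one.\<close>

lemma polyfun_prod_affine:
  assumes "finite A"
  shows "polyfun n (card A) (\<lambda>xs. \<Prod>r\<in>A. [:c r:] + (\<Sum>k<n. [:b r k:] * xs ! k))"
  using assms
proof (induction A rule: finite_induct)
  case empty
  then show ?case using polyfun_const[of n 0 1] by (simp add: one_pCons)
next
  case (insert r A)
  let ?F = "\<lambda>xs. \<Prod>r\<in>A. [:c r:] + (\<Sum>k<n. [:b r k:] * xs ! k)"
  have "polyfun n (Suc (card A)) (\<lambda>xs. [:c r:] * ?F xs + (\<Sum>k<n. [:b r k:] * (xs ! k * ?F xs)))"
    by (intro polyfun_add polyfun_sum polyfun_smult polyfun_Suc_degree polyfun_mult_var insert.IH) auto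
  then show ?case
    using insert.hyps by (simp add: algebra_simps sum_distrib_left sum_distrib_right)
qed

lemma pcompose_power: "pcompose (p ^ i) r = pcompose p r ^ i"
  for p :: "'k::comm_ring_1 poly"
  by (induction i) (simp_all add: pcompose_mult pcompose_1)

text \<open>Substituting s t for t in (a + t)^i splits off the direction \<open>s\<close> as a
  factor \<open>s ^ k\<close>, so a coefficient taken along a line becomes a polynomial in the
  direction.\<close>

lemma coeff_linear_power_scale:
  fixes a s :: "'k::field"
  shows "coeff ([:a, s:] ^ i) k = s ^ k * coeff ([:a, 1:] ^ i) k"
proof -
  have "[:a, s:] ^ i = pcompose ([:a, 1:] ^ i) [:0, s:]"
    by (simp add: pcompose_power pcompose_pCons)
  then show ?thesis by (simp add: coeff_pcompose_linear)
qed

text \<open>The shift by \<open>a\<close> turns the full power of (t - a) in \<open>Q\<close> into a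
  power of t, while the remaining factor does not vanish at \<open>a\<close>; so the Taylor
  expansion at \<open>a\<close> starts exactly at the order of the root.\<close>

lemma coeff_taylor_order_nonzero:
  fixes Q :: "'k::field poly"
  assumes "Q \<noteq> 0"
  shows "coeff (pcompose Q [:a, 1:]) (order a Q) \<noteq> 0"
proof -
  obtain R where R: "Q = [:- a, 1:] ^ order a Q * R" "\<not> [:- a, 1:] dvd R"
    using order_decomp[OF assms] by blast
  have pw: "pcompose ([:- a, 1:] ^ k) [:a, 1:] = monom 1 k" for k
    by (simp add: pcompose_power pcompose_pCons monom_altdef)
  have "pcompose Q [:a, 1:] = monom 1 (order a Q) * pcompose R [:a, 1:]"
    by (subst R(1)) (simp add: pcompose_mult pw)
  then have "coeff (pcompose Q [:a, 1:]) (order a Q) = coeff (pcompose R [:a, 1:]) 0"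
    by (simp add: coeff_monom_mult)
  also have "\<dots> = poly R a" by (simp add: coeff_pcompose_0)
  also have "\<dots> \<noteq> 0" using R(2) by (simp add: poly_eq_0_iff_dvd)
  finally show ?thesis .
qed

text \<open>The orders at the points of \<open>S\<close> add up to at most \<open>degree Q\<close>,
  so some point has at most the average.\<close>

lemma exists_low_order_point:
  fixes Q :: "'k::field poly"
  assumes "Q \<noteq> 0" "finite S" "S \<noteq> {}"
  shows "\<exists>a\<in>S. order a Q * card S \<le> degree Q"
proof (rule ccontr)
  assume "\<not> ?thesis"
  then have *: "degree Q < order a Q * card S" if "a \<in> S" for a using that by auto
  have "degree Q * card S < (\<Sum>a\<in>S. order a Q * card S)"
    using sum_strict_mono[OF assms(2,3), of "\<lambda>_. degree Q"] * by (simp add: mult.commute)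
  then have "degree Q < (\<Sum>a\<in>S. order a Q)"
    by (simp flip: sum_distrib_right)
  also have "\<dots> = (\<Sum>a\<in>{a\<in>S. poly Q a = 0}. order a Q)"
    using assms by (intro sum.mono_neutral_right) (auto simp: order_root)
  also have "\<dots> \<le> (\<Sum>a | poly Q a = 0. order a Q)"
    using assms by (intro sum_mono2) (auto simp: poly_roots_finite)
  also have "\<dots> \<le> degree Q" by (rule sum_order_le_degree[OF assms(1)])
  finally show False by simp
qed

lemma infinite_field_nonroot:
  assumes "infinite (UNIV :: 'k::field set)" "(p :: 'k poly) \<noteq> 0"
  obtains s where "poly p s \<noteq> 0"
  using assms poly_roots_finite[of p] by (metis (mono_tags, lifting) ex_new_if_finite mem_Collect_eq)

text \<open>A nonzero coefficient of t^k along the line as + t vs bounds the order of vanishing of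
  \<open>f\<close> at the point \<open>as\<close> by \<open>k\<close>. In the induction, the leading
  coefficient in the first variable, of degree at most \<open>d - e\<close>, supplies the remaining
  coordinates, and a point of low order of a univariate polynomial of degree \<open>e\<close>
  supplies the first one.\<close>

theorem multiplicity_schwartz_zippel:
  fixes f :: "'k::field poly list \<Rightarrow> 'k poly"
  assumes inf: "infinite (UNIV :: 'k set)" and S: "finite S" "S \<noteq> {}"
  shows "polyfun n d f \<Longrightarrow> length xs = n \<Longrightarrow> f xs \<noteq> 0 \<Longrightarrow>
    \<exists>as vs k. length as = n \<and> length vs = n \<and> set as \<subseteq> S \<and>
      coeff (f (map2 (\<lambda>a v. [:a, v:]) as vs)) k \<noteq> 0 \<and> k * card S \<le> d"
proof (induction n arbitrary: d f xs)
  case 0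
  then obtain c where "f [] = [:c:]" "c \<noteq> 0" by auto
  then show ?case by (auto intro!: exI[of _ 0])
next
  case (Suc n)
  from Suc.prems(1) obtain g
    where g: "\<And>i. i \<le> d \<Longrightarrow> polyfun n (d - i) (g i)"
        "\<And>x xs. length xs = n \<Longrightarrow> f (x # xs) = (\<Sum>i\<le>d. x ^ i * g i xs)"
    by auto
  \<comment> \<open>Powers of the first variable whose coefficient is not identically zero; the
    largest one, \<open>e\<close>, is the degree of \<open>f\<close> in that variable.\<close>
  define E where "E = {i. i \<le> d \<and> (\<exists>xs. length xs = n \<and> g i xs \<noteq> 0)}"
  obtain x xs' where xs: "xs = x # xs'" "length xs' = n" using Suc.prems(2) by (cases xs) auto
  have "\<exists>i\<le>d. g i xs' \<noteq> 0"
  proof (rule ccontr)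
    assume "\<not> ?thesis"
    then have "f xs = 0" unfolding xs(1) g(2)[OF xs(2)] by (intro sum.neutral) auto
    with Suc.prems(3) show False ..
  qed
  with xs(2) have "E \<noteq> {}" by (auto simp: E_def)
  moreover have "finite E" by (simp add: E_def)
  ultimately have "Max E \<in> E" and mx: "\<And>i. i \<in> E \<Longrightarrow> i \<le> Max E" by auto
  define e where "e = Max E"
  obtain ys where ys: "length ys = n" "g e ys \<noteq> 0" and ed: "e \<le> d"
    using \<open>Max E \<in> E\<close> by (auto simp: E_def e_def)
  have zero: "g i zs = 0" if "i \<le> d" "e < i" "length zs = n" for i zs
  proof (rule ccontr)
    assume "g i zs \<noteq> 0"
    then have "i \<in> E" using that by (auto simp: E_def)
    then show False using mx[of i] that(2) by (simp add: e_def)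
  qed
  obtain as vs k where IH: "length as = n" "length vs = n" "set as \<subseteq> S"
    "coeff (g e (map2 (\<lambda>a v. [:a, v:]) as vs)) k \<noteq> 0" "k * card S \<le> d - e"
    using Suc.IH[OF g(1)[OF ed] ys] by blast
  define zs where "zs = map2 (\<lambda>a v. [:a, v:]) as vs"
  have lz: "length zs = n" by (simp add: zs_def IH)
  \<comment> \<open>Along the line found for the leading coefficient, the coefficients of t^k of all
    \<open>g i\<close> form one polynomial in the first variable. Its coefficient at
    \<open>e\<close> is nonzero by induction.\<close>
  define Q where "Q = (\<Sum>i\<le>e. monom (coeff (g i zs) k) i)"
  have cQ: "coeff Q i = (if i \<le> e then coeff (g i zs) k else 0)" for i
    by (simp add: Q_def coeff_sum)
  have "degree Q = e"
    using IH(4) by (intro antisym degree_le le_degree) (auto simp: cQ zs_def)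
  have "Q \<noteq> 0" using IH(4) cQ[of e] by (auto simp: zs_def)
  obtain a where a: "a \<in> S" "order a Q * card S \<le> e"
    using exists_low_order_point[OF \<open>Q \<noteq> 0\<close> S] \<open>degree Q = e\<close> by auto
  define \<mu> where "\<mu> = order a Q"
  \<comment> \<open>The coefficient of t^(k + \<mu>) on the prolonged line, as a polynomial in the
    still free direction \<open>s\<close> of the first coordinate. Its coefficient at s^\<mu> is the
    first nonzero Taylor coefficient of \<open>Q\<close> at \<open>a\<close>, so some
    \<open>s\<close> is not a root.\<close>
  define H where "H = (\<Sum>j\<le>k + \<mu>. monom (\<Sum>i\<le>e. coeff ([:a, 1:] ^ i) j * coeff (g i zs) (k + \<mu> - j)) j)"
  have fe: "f (y # zs) = (\<Sum>i\<le>e. y ^ i * g i zs)" for y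
    unfolding g(2)[OF lz] using ed zero[OF _ _ lz] by (intro sum.mono_neutral_right) auto
  have poly_H: "coeff (f ([:a, s:] # zs)) (k + \<mu>) = poly H s" for s
  proof -
    have "coeff (f ([:a, s:] # zs)) (k + \<mu>) =
        (\<Sum>i\<le>e. \<Sum>j\<le>k + \<mu>. s ^ j * (coeff ([:a, 1:] ^ i) j * coeff (g i zs) (k + \<mu> - j)))"
      by (simp add: fe coeff_sum coeff_mult coeff_linear_power_scale[of a s] mult.assoc)
    also have "\<dots> = (\<Sum>j\<le>k + \<mu>. s ^ j * (\<Sum>i\<le>e. coeff ([:a, 1:] ^ i) j * coeff (g i zs) (k + \<mu> - j)))"
      by (subst sum.swap) (simp add: sum_distrib_left)
    also have "\<dots> = poly H s"
      by (simp add: H_def poly_sum poly_monom mult.commute)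
    finally show ?thesis .
  qed
  have "coeff H \<mu> = (\<Sum>i\<le>e. coeff ([:a, 1:] ^ i) \<mu> * coeff (g i zs) k)"
    by (simp add: H_def coeff_sum)
  also have "\<dots> = coeff (pcompose Q [:a, 1:]) \<mu>"
  proof -
    have pm: "pcompose (monom c i) [:a, 1:] = smult c ([:a, 1:] ^ i)" for c i
      by (induction i) (auto simp: monom_0 monom_Suc pcompose_pCons algebra_simps)
    show ?thesis by (simp add: Q_def pcompose_sum pm coeff_sum mult.commute)
  qed
  also have "\<dots> \<noteq> 0" using coeff_taylor_order_nonzero[OF \<open>Q \<noteq> 0\<close>] by (simp add: \<mu>_def)
  finally have "H \<noteq> 0" by auto
  then obtain s where "poly H s \<noteq> 0" using infinite_field_nonroot[OF inf] by blast
  then have "coeff (f (map2 (\<lambda>a v. [:a, v:]) (a # as) (s # vs))) (k + \<mu>) \<noteq> 0"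
    using poly_H by (simp add: zs_def)
  moreover have "(k + \<mu>) * card S \<le> d"
    using IH(5) a(2) ed by (simp add: \<mu>_def algebra_simps)
  ultimately show ?case
    using IH(1-3) a(1) by (intro exI[of _ "a # as"] exI[of _ "s # vs"] exI[of _ "k + \<mu>"]) auto
qed

section \<open>Counting exponent vectors\<close>

definition monomials_in :: "'i set \<Rightarrow> ('i \<Rightarrow> nat) set" where
  "monomials_in A = {u. \<forall>i. i \<notin> A \<longrightarrow> u i = 0}"

text \<open>Division by \<open>j\<close> splits \<open>u\<close> into quotients and remainders. With
  N = |A| there are (N + d choose N) quotient vectors of sum at most \<open>d\<close> and j^N
  remainder vectors; the induction over \<open>A\<close> adds up the binomials by the hockey-stick
  identity.\<close>

lemma card_floor_degree_le:
  fixes A :: "'i set"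
  assumes "finite A" "j \<ge> 1"
  shows "finite {u \<in> monomials_in A. (\<Sum>i\<in>A. u i div j) \<le> d} \<and>
    card {u \<in> monomials_in A. (\<Sum>i\<in>A. u i div j) \<le> d} \<le> (card A + d choose card A) * j ^ card A"
  using assms(1)
proof (induction A arbitrary: d rule: finite_induct)
  case empty
  have "{u \<in> monomials_in {}. (\<Sum>i\<in>{}. u i div j) \<le> d} = {\<lambda>_::'i. 0}"
    by (auto simp: monomials_in_def)
  then show ?case by simp
next
  case (insert a A)
  define T where "T A d = {u \<in> monomials_in A. (\<Sum>i\<in>A. u i div j) \<le> d}" for A :: "'i set" and d
  define P where "P = {..d} \<times> {..<j}"
  have sub: "T (insert a A) d \<subseteq> (\<Union>(b, r)\<in>P. (\<lambda>u. u(a := b * j + r)) ` T A (d - b))"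
  proof
    fix u assume u: "u \<in> T (insert a A) d"
    define w where "w = u(a := 0)"
    have "(\<Sum>i\<in>A. w i div j) = (\<Sum>i\<in>A. u i div j)"
      using insert.hyps by (intro sum.cong) (auto simp: w_def)
    then have "w \<in> T A (d - u a div j)" "u a div j \<le> d"
      using u insert.hyps by (auto simp: T_def monomials_in_def w_def)
    moreover have "u = w(a := (u a div j) * j + u a mod j)"
      by (auto simp: w_def fun_eq_iff)
    moreover have "u a mod j < j" using assms(2) by simp
    ultimately show "u \<in> (\<Union>(b, r)\<in>P. (\<lambda>u. u(a := b * j + r)) ` T A (d - b))"
      unfolding P_def by blast
  qed
  have fin: "finite (T A d')" and le: "card (T A d') \<le> (card A + d' choose card A) * j ^ card A" for d'
    using insert.IH[of d'] by (simp_all add: T_def)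
  have finP: "finite P" by (simp add: P_def)
  have "finite (\<Union>(b, r)\<in>P. (\<lambda>u. u(a := b * j + r)) ` T A (d - b))"
    using finP fin by auto
  then have "finite (T (insert a A) d)" and
    "card (T (insert a A) d) \<le> card (\<Union>(b, r)\<in>P. (\<lambda>u. u(a := b * j + r)) ` T A (d - b))"
    using sub by (auto intro: finite_subset card_mono)
  note this(2)
  also have "card (\<Union>(b, r)\<in>P. (\<lambda>u. u(a := b * j + r)) ` T A (d - b))
      \<le> (\<Sum>(b, r)\<in>P. card ((\<lambda>u. u(a := b * j + r)) ` T A (d - b)))"
    using card_UN_le[OF finP, of "\<lambda>(b, r). (\<lambda>u. u(a := b * j + r)) ` T A (d - b)"]
    by (simp add: case_prod_unfold)
  also have "\<dots> \<le> (\<Sum>(b, r)\<in>P. (card A + (d - b) choose card A) * j ^ card A)"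
    using le card_image_le[OF fin] by (intro sum_mono) (auto intro: order_trans)
  also have "\<dots> = j * j ^ card A * (\<Sum>b\<le>d. (card A + (d - b) choose card A))"
    by (simp add: P_def sum.cartesian_product[symmetric] sum_distrib_left mult_ac)
  also have "(\<Sum>b\<le>d. (card A + (d - b) choose card A)) = (\<Sum>b\<le>d. (card A + b choose card A))"
    by (rule sum.reindex_bij_witness[of _ "\<lambda>b. d - b" "\<lambda>b. d - b"]) auto
  also have "\<dots> = (card A + d + 1 choose (card A + 1))" by (rule choose_rising_sum)
  finally show ?case
    using \<open>finite (T (insert a A) d)\<close> insert.hyps by (simp add: T_def mult_ac)
qed

text \<open>
  Double counting of the pairs of \<open>u\<close> and \<open>w = u - j e\<^sub>i\<close>, weighted by
  \<open>\<lfloor>u\<^sub>i / j\<rfloor> / (\<Sum>\<^sub>i \<lfloor>u\<^sub>i / j\<rfloor>)\<close>: the weights at \<open>u\<close> add up to 1, those at \<open>w\<close> to at most \<open>2 N / (N + 1)\<close>.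
\<close>

lemma card_downset_le_shift:
  fixes A :: "'i set" and \<Sigma> :: "('i \<Rightarrow> nat) set"
  defines "N \<equiv> card A"
  assumes A: "finite A" "A \<noteq> {}" and j: "j \<ge> 1" and fin: "finite \<Sigma>" and sub: "\<Sigma> \<subseteq> monomials_in A"
    and down: "\<And>u i. u \<in> \<Sigma> \<Longrightarrow> i \<in> A \<Longrightarrow> j \<le> u i \<Longrightarrow> u(i := u i - j) \<in> \<Sigma>"
  shows "real (card \<Sigma>) \<le> real ((2 * N choose N) * j ^ N) +
    2 * N / (N + 1) * card {u \<in> \<Sigma>. \<exists>i\<in>A. u(i := u i + j) \<in> \<Sigma>}"
proof -
  define deg where "deg u = (\<Sum>i\<in>A. u i div j)" for u :: "'i \<Rightarrow> nat"
  define \<Sigma>' where "\<Sigma>' = {u \<in> \<Sigma>. \<exists>i\<in>A. u(i := u i + j) \<in> \<Sigma>}"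
  define Lo where "Lo = {u \<in> \<Sigma>. deg u \<le> N}"
  define Hi where "Hi = {u \<in> \<Sigma>. N < deg u}"
  have N: "N \<ge> 1" using A by (simp add: N_def Suc_leI card_gt_0_iff)
  have finite: "finite \<Sigma>'" "finite Hi" using fin by (auto simp: \<Sigma>'_def Hi_def)
  have "card \<Sigma> = card Lo + card Hi"
    using fin by (subst card_Un_disjoint[symmetric]) (auto simp: Lo_def Hi_def intro: arg_cong[where f = card])
  moreover have "card Lo \<le> (2 * N choose N) * j ^ N"
  proof -
    have *: "finite {u \<in> monomials_in A. deg u \<le> N}"
      "card {u \<in> monomials_in A. deg u \<le> N} \<le> (2 * N choose N) * j ^ N"
      using card_floor_degree_le[OF A(1) j, of N] by (auto simp: deg_def N_def mult_2)
    have "card Lo \<le> card {u \<in> monomials_in A. deg u \<le> N}"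
      using sub by (intro card_mono *) (auto simp: Lo_def)
    then show ?thesis using *(2) by simp
  qed
  moreover have "real (card Hi) \<le> 2 * N / (N + 1) * card \<Sigma>'"
  proof -
    define E where "E = {(u, i). u \<in> Hi \<and> i \<in> A \<and> j \<le> u i}"
    \<comment> \<open>\<open>N \<le> deg w\<close> is what remains of \<open>N < deg u\<close>,
      since the shift lowers \<open>deg\<close> by exactly one.\<close>
    define E' where "E' = {(w, i). w \<in> \<Sigma>' \<and> i \<in> A \<and> N \<le> deg w}"
    define f where "f = (\<lambda>(u :: 'i \<Rightarrow> nat, i). (u(i := u i - j), i))"
    have finE: "finite E" "finite E'"
      using finite A(1) by (auto simp: E_def E'_def intro: finite_subset[of _ "Hi \<times> A"] finite_subset[of _ "\<Sigma>' \<times> A"])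
    have deg_upd: "deg u = Suc (deg (u(i := u i - j)))" "u i div j = Suc ((u i - j) div j)"
      if "i \<in> A" "j \<le> u i" for u i
    proof -
      show *: "u i div j = Suc ((u i - j) div j)" using that j by (simp add: le_div_geq)
      show "deg u = Suc (deg (u(i := u i - j)))"
        unfolding deg_def using A(1) that * by (simp add: sum.remove[of A i])
    qed
    have inj: "inj_on f E"
    proof (rule inj_onI)
      fix p p' assume a: "p \<in> E" "p' \<in> E" "f p = f p'"
      obtain u i u' i' where p: "p = (u, i)" "p' = (u', i')" by (cases p; cases p')
      have "i = i'" and eq: "u(i := u i - j) = u'(i := u' i - j)" using a(3) p by (auto simp: f_def)
      have "u k = u' k" for k
        using fun_cong[OF eq, of k] fun_cong[OF eq, of i] a(1,2) p \<open>i = i'\<close> by (cases "k = i") (auto simp: E_def)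
      then show "p = p'" using p \<open>i = i'\<close> by auto
    qed
    have im: "f ` E \<subseteq> E'"
    proof (clarsimp simp: f_def E_def E'_def)
      fix u i assume h: "u \<in> Hi" "i \<in> A" "j \<le> u i"
      have "(u(i := u i - j))(i := (u(i := u i - j)) i + j) = u" using h by auto
      then show "u(i := u i - j) \<in> \<Sigma>' \<and> N \<le> deg (u(i := u i - j))"
        using h down[of u i] deg_upd(1)[of i u] by (auto simp: \<Sigma>'_def Hi_def)
    qed
    have "real (card Hi) = (\<Sum>u\<in>Hi. \<Sum>i\<in>A. (u i div j) / deg u)"
    proof -
      have "(\<Sum>i\<in>A. (u i div j) / deg u) = 1" if "u \<in> Hi" for u
        using that by (simp add: deg_def Hi_def flip: sum_divide_distrib of_nat_sum)
      then show ?thesis by simp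
    qed
    also have "\<dots> = (\<Sum>(u, i)\<in>Hi \<times> A. (u i div j) / deg u)"
      by (simp add: sum.cartesian_product)
    \<comment> \<open>A pair outside \<open>E\<close> has \<open>u i < j\<close> and hence weight
      zero.\<close>
    also have "\<dots> = (\<Sum>(u, i)\<in>E. (u i div j) / deg u)"
      using finite A(1) by (intro sum.mono_neutral_right) (auto simp: E_def div_greater_zero_iff)
    also have "\<dots> = (\<Sum>p\<in>E. (case f p of (w, i) \<Rightarrow> (w i div j + 1) / (deg w + 1)))"
      using deg_upd by (intro sum.cong) (auto simp: f_def E_def algebra_simps)
    also have "\<dots> = (\<Sum>(w, i)\<in>f ` E. (w i div j + 1) / (deg w + 1))"
      by (simp add: sum.reindex[OF inj])
    also have "\<dots> \<le> (\<Sum>(w, i)\<in>E'. (w i div j + 1) / (deg w + 1))"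
      by (intro sum_mono2 finE im) auto
    also have "E' = {w \<in> \<Sigma>'. N \<le> deg w} \<times> A" by (auto simp: E'_def)
    also have "(\<Sum>(w, i)\<in>{w \<in> \<Sigma>'. N \<le> deg w} \<times> A. (w i div j + 1) / (deg w + 1))
        = (\<Sum>w | w \<in> \<Sigma>' \<and> N \<le> deg w. (deg w + N) / (deg w + 1))"
    proof -
      have "(\<Sum>i\<in>A. real (w i div j + 1) / real (deg w + 1)) = (deg w + N) / (deg w + 1)" for w
        by (simp add: N_def sum.distrib deg_def flip: sum_divide_distrib)
      then show ?thesis by (simp add: sum.cartesian_product[symmetric])
    qed
    also have "\<dots> \<le> (\<Sum>w | w \<in> \<Sigma>' \<and> N \<le> deg w. 2 * N / (N + 1))"
    proof (rule sum_mono)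
      fix w assume "w \<in> {w \<in> \<Sigma>'. N \<le> deg w}"
      \<comment> \<open>The quotient (d + N) / (d + 1) does not increase with d, so d = N is the
        extreme case; cleared of denominators the claim reads N (N - 1) \<le> d (N - 1).\<close>
      then have "N * (N - 1) \<le> deg w * (N - 1)" by (intro mult_right_mono) auto
      then have "real N * (real N - 1) \<le> deg w * (real N - 1)"
        using N by (metis of_nat_1 of_nat_diff of_nat_le_iff of_nat_mult)
      then show "real (deg w + N) / real (deg w + 1) \<le> real (2 * N) / real (N + 1)"
        by (simp add: divide_simps algebra_simps)
    qed
    also have "\<dots> \<le> (\<Sum>w\<in>\<Sigma>'. 2 * N / (N + 1))"
      using finite by (intro sum_mono2) auto
    finally show ?thesis by (simp add: mult.commute)
  qed
  ultimately have "real (card \<Sigma>) \<le> real ((2 * N choose N) * j ^ N) + 2 * N / (N + 1) * card \<Sigma>'"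
    by linarith
  then show ?thesis by (simp add: \<Sigma>'_def add.commute)
qed

section \<open>Pencils of commuting operators\<close>

text \<open>
  A copy of \<^locale>\<open>vector_space\<close>: definitions in the original would be shadowed by those inherited through its
  global interpretation for real vector spaces.
\<close>

locale linear_space = vector_space scale
  for scale :: "'a::field \<Rightarrow> 'b::ab_group_add \<Rightarrow> 'b"
begin

interpretation self: vector_space_pair scale scale
  by unfold_locales

interpretation dual: vector_space_pair scale "(*) :: 'a \<Rightarrow> 'a \<Rightarrow> 'a"
  by unfold_locales (auto simp: algebra_simps)

text \<open>Indexed families rather than sets: the vectors will depend on a parameter and may
  coincide for some of its values.\<close>

definition indep_family :: "'i set \<Rightarrow> ('i \<Rightarrow> 'b) \<Rightarrow> bool" where
  "indep_family A p \<longleftrightarrow> (\<forall>c. (\<Sum>i\<in>A. scale (c i) (p i)) = 0 \<longrightarrow> (\<forall>i\<in>A. c i = 0))"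

lemma indep_familyD:
  "indep_family A p \<Longrightarrow> (\<Sum>i\<in>A. scale (c i) (p i)) = 0 \<Longrightarrow> i \<in> A \<Longrightarrow> c i = 0"
  by (auto simp: indep_family_def)

lemma indep_family_inj_on:
  assumes "finite A" "indep_family A p"
  shows "inj_on p A"
proof (rule inj_onI, rule ccontr)
  fix x y assume xy: "x \<in> A" "y \<in> A" "p x = p y" "x \<noteq> y"
  define c where "c i = (if i = x then 1 else if i = y then - 1 else 0 :: 'a)" for i
  have "(\<Sum>i\<in>A. scale (c i) (p i)) = (\<Sum>i\<in>{x, y}. scale (c i) (p i))"
    using assms(1) xy by (intro sum.mono_neutral_right) (auto simp: c_def)
  also have "\<dots> = 0" using xy by (simp add: c_def)
  finally show False using indep_familyD[OF assms(2) _ xy(1), of c] by (simp add: c_def)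
qed

lemma independent_image_family:
  assumes "finite A" "indep_family A p"
  shows "independent (p ` A)"
proof (rule independent_if_scalars_zero)
  show "finite (p ` A)" using assms(1) by simp
  fix f x assume "(\<Sum>x\<in>p ` A. scale (f x) x) = 0" and x: "x \<in> p ` A"
  then have "(\<Sum>i\<in>A. scale (f (p i)) (p i)) = 0"
    by (simp add: sum.reindex[OF indep_family_inj_on[OF assms]])
  then show "f x = 0" using indep_familyD[OF assms(2), of "\<lambda>i. f (p i)"] x by auto
qed

lemma indep_family_card_le:
  assumes "finite A" "indep_family A p" "p ` A \<subseteq> span T" "finite T"
  shows "card A \<le> card T"
  using independent_span_bound[OF assms(4) independent_image_family[OF assms(1,2)] assms(3)]
    card_image[OF indep_family_inj_on[OF assms(1,2)]] by simp

text \<open>A basis of \<open>span G\<close> stays independent after adding \<open>z\<close>, so the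
  value 0 on the basis and 1 at \<open>z\<close> can be prescribed.\<close>

lemma separating_functional:
  assumes "z \<notin> span G"
  obtains \<phi> where "Vector_Spaces.linear scale (*) \<phi>" "\<And>x. x \<in> span G \<Longrightarrow> \<phi> x = 0" "\<phi> z = 1"
proof -
  obtain B where B: "B \<subseteq> G" "independent B" "G \<subseteq> span B" by (rule maximal_independent_subset)
  have sB: "span B = span G" using B by (metis span_mono span_span subset_antisym)
  have "independent (insert z B)" using B(2) assms sB by (simp add: independent_insertI)
  from dual.linear_independent_extend[OF this, of "\<lambda>x. if x = z then 1 else 0"]
  obtain \<phi> where \<phi>: "Vector_Spaces.linear scale (*) \<phi>" "\<forall>x\<in>insert z B. \<phi> x = (if x = z then 1 else 0)" by blast
  have "z \<notin> B" using assms sB span_superset[of B] by auto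
  then have "\<phi> y = 0" if "y \<in> B" for y using \<phi>(2) that by auto
  then have "\<phi> x = 0" if "x \<in> span B" for x
    using dual.linear_eq_0_on_span[OF \<phi>(1) _ that] by blast
  then show thesis using that \<phi> sB by auto
qed

text \<open>Independence is an open condition. Functionals dual to the family at t = 0 turn the
  moving family into a square matrix of polynomials in t, whose determinant is 1 at t = 0 and so has
  only finitely many roots.\<close>

lemma indep_family_perturb:
  assumes "indep_family {..<r::nat} (\<lambda>b. w b 0)"
  shows "\<exists>E. finite E \<and> (\<forall>t. t \<notin> E \<longrightarrow> indep_family {..<r} (\<lambda>b. \<Sum>k\<le>d::nat. scale (t ^ k) (w b k)))"
proof -
  have fin: "finite {..<r}" by simp
  note inj = indep_family_inj_on[OF fin assms]
  have "\<exists>\<psi>. Vector_Spaces.linear scale (*) \<psi> \<and> (\<forall>b<r. \<psi> (w b 0) = (if b = s then 1 else 0))" if "s < r" for s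
  proof -
    from dual.linear_independent_extend[OF independent_image_family[OF fin assms], of "\<lambda>x. if x = w s 0 then 1 else 0"]
    obtain \<psi> where "Vector_Spaces.linear scale (*) \<psi>" "\<forall>x\<in>(\<lambda>b. w b 0) ` {..<r}. \<psi> x = (if x = w s 0 then 1 else 0)"
      by blast
    then show ?thesis using inj that by (intro exI[of _ \<psi>]) (auto simp: inj_on_def)
  qed
  then obtain \<psi> where \<psi>: "\<And>s. s < r \<Longrightarrow> Vector_Spaces.linear scale (*) (\<psi> s)"
    "\<And>s b. s < r \<Longrightarrow> b < r \<Longrightarrow> \<psi> s (w b 0) = (if b = s then 1 else 0)"
    by metis
  define M where "M = Matrix.mat r r (\<lambda>(s, b). \<Sum>k\<le>d. monom (\<psi> s (w b k)) k)"
  have M: "M \<in> carrier_mat r r" by (simp add: M_def)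
  define E where "E = {t. poly (Determinant.det M) t = 0}"
  have hom: "poly (Determinant.det M) t = Determinant.det (map_mat (\<lambda>p. poly p t) M)" for t
  proof -
    interpret comm_ring_hom "\<lambda>p. poly p t" by unfold_locales auto
    show ?thesis by simp
  qed
  have "map_mat (\<lambda>p. poly p 0) M = 1\<^sub>m r"
  proof (rule eq_matI)
    fix i j assume ij: "i < dim_row (1\<^sub>m r)" "j < dim_col (1\<^sub>m r)"
    have "poly (\<Sum>k\<le>d. monom (\<psi> i (w j k)) k) 0 = \<psi> i (w j 0)"
      by (simp add: poly_0_coeff_0 coeff_sum)
    then show "map_mat (\<lambda>p. poly p 0) M $$ (i, j) = 1\<^sub>m r $$ (i, j)"
      using ij \<psi>(2)[of i j] by (auto simp: M_def)
  qed (auto simp: M_def)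
  then have "Determinant.det M \<noteq> 0" using hom[of 0] by auto
  then have "finite E" by (simp add: E_def poly_roots_finite)
  moreover have "indep_family {..<r} (\<lambda>b. \<Sum>k\<le>d. scale (t ^ k) (w b k))" if t: "t \<notin> E" for t
    unfolding indep_family_def
  proof (intro allI impI)
    fix c assume c: "(\<Sum>b<r. scale (c b) (\<Sum>k\<le>d. scale (t ^ k) (w b k))) = 0"
    define v where "v = Matrix.vec r c"
    have "map_mat (\<lambda>p. poly p t) M *\<^sub>v v = 0\<^sub>v r"
    proof (rule eq_vecI)
      fix s assume s: "s < dim_vec (0\<^sub>v r)"
      then interpret Vector_Spaces.linear scale "(*)" "\<psi> s" using \<psi>(1) by auto
      have "0 = \<psi> s (\<Sum>b<r. scale (c b) (\<Sum>k\<le>d. scale (t ^ k) (w b k)))" by (simp add: c)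
      also have "\<dots> = (\<Sum>b<r. c b * (\<Sum>k\<le>d. t ^ k * \<psi> s (w b k)))"
        by (simp add: sum local.scale)
      also have "\<dots> = (map_mat (\<lambda>p. poly p t) M *\<^sub>v v) $ s"
        using s by (simp add: M_def v_def scalar_prod_def poly_sum poly_monom atLeast0LessThan mult.commute)
      finally show "(map_mat (\<lambda>p. poly p t) M *\<^sub>v v) $ s = 0\<^sub>v r $ s" using s by simp
    qed (simp add: M_def)
    moreover have "Determinant.det (map_mat (\<lambda>p. poly p t) M) \<noteq> 0" using t hom by (simp add: E_def)
    moreover have "map_mat (\<lambda>p. poly p t) M \<in> carrier_mat r r" "v \<in> carrier_vec r" using M by (auto simp: v_def)
    ultimately have "v = 0\<^sub>v r" using det_0_iff_vec_prod_zero by blast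
    then show "\<forall>i\<in>{..<r}. c i = 0" by (metis index_vec index_zero_vec(1) lessThan_iff v_def)
  qed
  ultimately show ?thesis by blast
qed

lemma linear_funpow:
  "Vector_Spaces.linear scale scale L \<Longrightarrow> Vector_Spaces.linear scale scale (L ^^ j)"
proof (induction j)
  case 0
  then show ?case by (simp add: Vector_Spaces.linear_iff vector_space_axioms id_def)
next
  case (Suc j)
  then show ?case
    using Vector_Spaces.linear_compose[of scale scale "L ^^ j" scale L] by (simp add: comp_def)
qed

text \<open>This is the binomial expansion of (L + t v)^j: every term except the one at t^j contains
  a factor \<open>L\<close>, which can be moved to the front because \<open>L\<close> and
  \<open>v\<close> commute.\<close>

lemma funpow_perturb_expansion:
  assumes L: "Vector_Spaces.linear scale scale L" and v: "Vector_Spaces.linear scale scale v"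
    and comm: "\<And>y. v (L y) = L (v y)"
  shows "\<exists>w. (\<forall>t. ((\<lambda>y. L y + scale t (v y)) ^^ j) u = (\<Sum>k\<le>j. scale (t ^ k) (w k))) \<and>
    w 0 = (L ^^ j) u \<and> w j = (v ^^ j) u \<and> (\<forall>k<j. w k \<in> range L)"
proof (induction j)
  case 0
  then show ?case by (auto intro: exI[of _ "\<lambda>_. u"])
next
  case (Suc j)
  interpret L: Vector_Spaces.linear scale scale L by fact
  interpret v: Vector_Spaces.linear scale scale v by fact
  from Suc obtain w where w: "\<And>t. ((\<lambda>y. L y + scale t (v y)) ^^ j) u = (\<Sum>k\<le>j. scale (t ^ k) (w k))"
    "w 0 = (L ^^ j) u" "w j = (v ^^ j) u" "\<And>k. k < j \<Longrightarrow> w k \<in> range L" by blast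
  \<comment> \<open>The Pascal recursion; the case distinctions are its two ends, with no
    contribution of \<open>L\<close> at k = j + 1 and none of \<open>v\<close> at k = 0.\<close>
  define w' where "w' k = (if k \<le> j then L (w k) else 0) + (if k = 0 then 0 else v (w (k - 1)))" for k
  have "((\<lambda>y. L y + scale t (v y)) ^^ Suc j) u = (\<Sum>k\<le>Suc j. scale (t ^ k) (w' k))" for t
  proof -
    have "((\<lambda>y. L y + scale t (v y)) ^^ Suc j) u
        = (\<Sum>k\<le>j. scale (t ^ k) (L (w k))) + (\<Sum>k\<le>j. scale (t ^ Suc k) (v (w k)))"
      by (simp add: w(1) L.sum L.scale v.sum v.scale scale_sum_right)
    also have "(\<Sum>k\<le>j. scale (t ^ k) (L (w k))) = (\<Sum>k\<le>Suc j. scale (t ^ k) (if k \<le> j then L (w k) else 0))"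
      by simp
    also have "(\<Sum>k\<le>j. scale (t ^ Suc k) (v (w k))) = (\<Sum>k\<le>Suc j. scale (t ^ k) (if k = 0 then 0 else v (w (k - 1))))"
      by (subst sum.atMost_Suc_shift) simp
    finally show ?thesis by (simp add: w'_def scale_right_distrib sum.distrib)
  qed
  moreover have "w' k \<in> range L" if kj: "k < Suc j" for k
  proof (cases k)
    case (Suc k')
    then obtain z where "w k' = L z" using w(4)[of k'] kj by auto
    then have "w' k = L (w k + v z)" using Suc kj by (simp add: w'_def comm L.add)
    then show ?thesis by simp
  qed (simp add: w'_def)
  ultimately show ?case
    using w by (intro exI[of _ w']) (auto simp: w'_def)
qed

text \<open>
  If \<open>L ^^ j\<close> has maximal rank in the pencil \<open>L + t v\<close>, then a kernel vector \<open>f\<close> of \<open>L ^^ j\<close> moves with \<open>t\<close>,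
  and the coefficient of \<open>t ^ j\<close> in \<open>(L + t v) ^^ j\<close> applied to the moving vector puts \<open>v ^^ j f\<close> into the range
  of \<open>L\<close>. Here the contrapositive is proved: a functional \<open>\<phi>\<close> separating \<open>v ^^ j f\<close> from the range of \<open>L\<close>
  yields one more independent vector in the range of \<open>(L + t v) ^^ j\<close>.
\<close>

lemma funpow_kernel_moves_into_range:
  assumes inf: "infinite (UNIV :: 'a set)"
    and L: "Vector_Spaces.linear scale scale L" and v: "Vector_Spaces.linear scale scale v"
    and comm: "\<And>y. v (L y) = L (v y)"
    and ind: "indep_family {..<r::nat} (\<lambda>b. (L ^^ j) (u b))"
    and E: "finite E" and max: "\<And>t u'. t \<notin> E \<Longrightarrow>
      \<not> indep_family {..<Suc r} (\<lambda>b. ((\<lambda>y. L y + scale t (v y)) ^^ j) (u' b))"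
    and f: "(L ^^ j) f = 0"
  shows "(v ^^ j) f \<in> range L"
proof (rule ccontr)
  assume notin: "(v ^^ j) f \<notin> range L"
  interpret L: Vector_Spaces.linear scale scale L by fact
  have "j \<noteq> 0" using notin f by (metis L.zero funpow_0 rangeI)
  define z where "z = (v ^^ j) f"
  have sr: "span (range L) = range L" by (simp add: L.subspace_image)
  obtain \<phi> where \<phi>: "Vector_Spaces.linear scale (*) \<phi>" "\<And>x. x \<in> range L \<Longrightarrow> \<phi> x = 0" "\<phi> z = 1"
    using separating_functional[of z "range L"] notin sr z_def by metis
  interpret \<phi>: Vector_Spaces.linear scale "(*)" \<phi> by fact
  \<comment> \<open>The independent vectors of the hypothesis, followed by \<open>f\<close>, whose
    image under \<open>L ^^ j\<close> is zero.\<close>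
  define u' where "u' b = (if b < r then u b else f)" for b
  have "\<forall>b. \<exists>w. (\<forall>t. ((\<lambda>y. L y + scale t (v y)) ^^ j) (u' b) = (\<Sum>k\<le>j. scale (t ^ k) (w k))) \<and>
    w 0 = (L ^^ j) (u' b) \<and> w j = (v ^^ j) (u' b) \<and> (\<forall>k<j. w k \<in> range L)"
    using funpow_perturb_expansion[OF L v comm] by blast
  then obtain w where w: "\<And>b t. ((\<lambda>y. L y + scale t (v y)) ^^ j) (u' b) = (\<Sum>k\<le>j. scale (t ^ k) (w b k))"
    "\<And>b. w b 0 = (L ^^ j) (u' b)" "\<And>b. w b j = (v ^^ j) (u' b)" "\<And>b k. k < j \<Longrightarrow> w b k \<in> range L"
    by metis
  define \<kappa> where "\<kappa> b = \<phi> (w b j)" for b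
  \<comment> \<open>The part \<kappa> z is moved from t^j to t^0. At t = 0 the vector belonging to
    \<open>f\<close> then becomes \<open>z\<close> instead of 0, which makes the whole family
    independent there.\<close>
  define w' where "w' b k = w b k + (if k = 0 then scale (\<kappa> b) z else 0) - (if k = j then scale (\<kappa> b) z else 0)" for b k
  have \<phi>A: "\<phi> (((\<lambda>y. L y + scale t (v y)) ^^ j) (u' b)) = t ^ j * \<kappa> b" for t b
  proof -
    have "\<phi> (((\<lambda>y. L y + scale t (v y)) ^^ j) (u' b)) = (\<Sum>k\<le>j. t ^ k * \<phi> (w b k))"
      by (simp add: w(1) \<phi>.sum \<phi>.scale)
    also have "\<dots> = (\<Sum>k\<in>{j}. t ^ k * \<phi> (w b k))"
      using \<phi>(2) w(4) by (intro sum.mono_neutral_right) auto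
    finally show ?thesis by (simp add: \<kappa>_def)
  qed
  have "indep_family {..<Suc r} (\<lambda>b. w' b 0)"
    unfolding indep_family_def
  proof (intro allI impI)
    fix c assume c: "(\<Sum>b<Suc r. scale (c b) (w' b 0)) = 0"
    define s where "s = (\<Sum>b<Suc r. c b * \<kappa> b)"
    have "(\<Sum>b<Suc r. scale (c b) (w' b 0)) = (\<Sum>b<Suc r. scale (c b) (w b 0)) + scale s z"
      using \<open>j \<noteq> 0\<close> by (simp add: w'_def s_def scale_right_distrib sum.distrib scale_sum_left scale_left_distrib)
    moreover have "(\<Sum>b<Suc r. scale (c b) (w b 0)) = (\<Sum>b<r. scale (c b) ((L ^^ j) (u b)))"
      by (simp add: w(2) u'_def f)
    ultimately have eq: "(\<Sum>b<r. scale (c b) ((L ^^ j) (u b))) + scale s z = 0" using c by simp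
    have "\<phi> ((L ^^ j) y) = 0" for y using \<phi>(2) \<open>j \<noteq> 0\<close> by (cases j) auto
    \<comment> \<open>\<open>\<phi>\<close> kills the range of \<open>L\<close> and is 1 at
      \<open>z\<close>, so the relation splits into its two summands.\<close>
    then have "s = 0" using arg_cong[OF eq, of \<phi>] by (simp add: \<phi>.add \<phi>.sum \<phi>.scale \<phi>(3))
    then have "\<forall>b<r. c b = 0" using eq indep_familyD[OF ind, of c] by simp
    moreover have "\<kappa> r = 1" using \<phi>(3) by (simp add: \<kappa>_def w(3) u'_def z_def)
    ultimately have "c r = 0" using \<open>s = 0\<close> by (simp add: s_def)
    with \<open>\<forall>b<r. c b = 0\<close> show "\<forall>b\<in>{..<Suc r}. c b = 0" by (auto simp: less_Suc_eq)
  qed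
  from indep_family_perturb[of "Suc r" w' j, OF this] obtain E' where E': "finite E'"
    "\<And>t. t \<notin> E' \<Longrightarrow> indep_family {..<Suc r} (\<lambda>b. \<Sum>k\<le>j. scale (t ^ k) (w' b k))" by blast
  obtain t where t: "t \<notin> insert 0 (E \<union> E')"
    using ex_new_if_finite[OF inf, of "insert 0 (E \<union> E')"] E(1) E'(1) by auto
  have w't: "(\<Sum>k\<le>j. scale (t ^ k) (w' b k)) =
      ((\<lambda>y. L y + scale t (v y)) ^^ j) (u' b) + scale (\<kappa> b) (z - scale (t ^ j) z)" for b
  proof -
    have "scale (t ^ k) (w' b k) = scale (t ^ k) (w b k) + (if k = 0 then scale (\<kappa> b) z else 0)
        - (if k = j then scale (t ^ j) (scale (\<kappa> b) z) else 0)" for k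
      by (auto simp: w'_def scale_right_distrib scale_right_diff_distrib)
    then show ?thesis
      by (simp add: w(1) sum.distrib sum_subtractf scale_right_diff_distrib mult.commute)
  qed
  have "indep_family {..<Suc r} (\<lambda>b. ((\<lambda>y. L y + scale t (v y)) ^^ j) (u' b))"
    unfolding indep_family_def
  proof (intro allI impI)
    fix c assume c: "(\<Sum>b<Suc r. scale (c b) (((\<lambda>y. L y + scale t (v y)) ^^ j) (u' b))) = 0"
    \<comment> \<open>Applying \<open>\<phi>\<close> to the relation gives \<Sum> c \<kappa> = 0,
      since t is nonzero. The multiples of \<open>z\<close> by which the two families differ then
      cancel, so the relation also holds for \<open>w'\<close>.\<close>
    have "\<phi> (\<Sum>b<Suc r. scale (c b) (((\<lambda>y. L y + scale t (v y)) ^^ j) (u' b))) = t ^ j * (\<Sum>b<Suc r. c b * \<kappa> b)"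
      unfolding \<phi>.sum \<phi>.scale \<phi>A sum_distrib_left by (rule sum.cong) (auto simp: mult.left_commute)
    then have "(\<Sum>b<Suc r. c b * \<kappa> b) = 0" using t unfolding c \<phi>.zero by auto
    then have "(\<Sum>b<Suc r. scale (c b) (\<Sum>k\<le>j. scale (t ^ k) (w' b k))) = 0"
      using c by (simp add: w't scale_right_distrib sum.distrib scale_sum_left[symmetric] del: sum.lessThan_Suc)
    then show "\<forall>b\<in>{..<Suc r}. c b = 0"
      using indep_familyD[OF E'(2)] t by blast
  qed
  then show False using max t by blast
qed

end

section \<open>Standard monomials\<close>

text \<open>The lexicographic order on exponent vectors, for some enumeration of the variables.\<close>

lemma exists_monomial_order:
  "\<exists>r :: (('n::finite \<Rightarrow> nat) \<times> ('n \<Rightarrow> nat)) set. wf r \<and> trans r \<and> total r \<and>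
     (\<forall>u w i j. (u, w) \<in> r \<longrightarrow> (u(i := u i + j), w(i := w i + j)) \<in> r)"
proof -
  obtain f :: "'n \<Rightarrow> nat" where f: "bij_betw f UNIV {..<CARD('n)}"
    using ex_bij_betw_finite_nat[of "UNIV :: 'n set"] by (auto simp: atLeast0LessThan)
  then have inj: "inj f" and ran: "f i < CARD('n)" for i by (auto simp: bij_betw_def)
  define r where "r = {(u, w). \<exists>i. u i < (w i :: nat) \<and> (\<forall>k. f k < f i \<longrightarrow> u k = w k)}"
  \<comment> \<open>Listing the exponents along the enumeration embeds \<open>r\<close> into the
    lexicographic order on lists of equal length, which is well-founded.\<close>
  define enc where "enc u = map (\<lambda>k. u (inv_into UNIV f k)) [0..<CARD('n)]" for u :: "'n \<Rightarrow> nat"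
  have "r \<subseteq> inv_image (lex less_than) enc"
  proof safe
    fix u w assume "(u, w) \<in> r"
    then obtain i where i: "u i < w i" "\<And>k. f k < f i \<Longrightarrow> u k = w k" by (auto simp: r_def)
    have len: "length (enc u) = CARD('n)" "length (enc w) = CARD('n)" by (simp_all add: enc_def)
    have nth: "enc v ! f i = v i" for v using ran[of i] inj by (simp add: enc_def)
    have take: "take (f i) (enc u) = take (f i) (enc w)"
    proof (rule nth_equalityI)
      fix k assume "k < length (take (f i) (enc u))"
      then have k: "k < f i" "k < CARD('n)" by (simp_all add: enc_def)
      then have "f (inv_into UNIV f k) = k" using f by (metis bij_betw_imp_surj_on f_inv_into_f lessThan_iff)
      then show "take (f i) (enc u) ! k = take (f i) (enc w) ! k"
        using k i(2)[of "inv_into UNIV f k"] by (simp add: enc_def)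
    qed (simp add: len)
    have "enc u = take (f i) (enc u) @ u i # drop (Suc (f i)) (enc u)"
      "enc w = take (f i) (enc u) @ w i # drop (Suc (f i)) (enc w)"
      using id_take_nth_drop[of "f i" "enc u"] id_take_nth_drop[of "f i" "enc w"] len ran[of i] nth take by simp_all
    then have "\<exists>xys x y xs' ys'. enc u = xys @ x # xs' \<and> enc w = xys @ y # ys' \<and> (x, y) \<in> less_than"
      using i(1) by (intro exI[of _ "take (f i) (enc u)"] exI[of _ "u i"] exI[of _ "w i"]
          exI[of _ "drop (Suc (f i)) (enc u)"] exI[of _ "drop (Suc (f i)) (enc w)"]) simp
    then show "(u, w) \<in> inv_image (lex less_than) enc"
      using len by (simp add: lex_conv)
  qed
  then have "wf r" by (meson wf_inv_image wf_lex wf_less_than wf_subset)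
  moreover have "trans r"
  proof (rule transI)
    fix u w v assume "(u, w) \<in> r" "(w, v) \<in> r"
    then obtain i k where ik: "u i < w i" "\<And>l. f l < f i \<Longrightarrow> u l = w l" "w k < v k" "\<And>l. f l < f k \<Longrightarrow> w l = v l"
      by (auto simp: r_def)
    consider "f i < f k" | "f k < f i" | "i = k" using inj by (metis injD nat_neq_iff)
    then show "(u, v) \<in> r"
    proof cases
      case 1
      then show ?thesis using ik by (auto simp: r_def intro!: exI[of _ i])
    next
      case 2
      then show ?thesis using ik by (auto simp: r_def intro!: exI[of _ k])
    next
      case 3
      then show ?thesis using ik by (auto simp: r_def intro!: exI[of _ i])
    qed
  qed
  moreover have "total r"
  proof (rule totalI)
    fix u w :: "'n \<Rightarrow> nat" assume "u \<noteq> w"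
    then obtain i where "u i \<noteq> w i" by auto
    then obtain i where i: "u i \<noteq> w i" "\<And>k. u k \<noteq> w k \<Longrightarrow> f i \<le> f k"
      using arg_min_natI[of "\<lambda>i. u i \<noteq> w i" _ f] arg_min_nat_le[of "\<lambda>i. u i \<noteq> w i" _ f] by metis
    have "u k = w k" if "f k < f i" for k using i(2)[of k] that by force
    then show "(u, w) \<in> r \<or> (w, u) \<in> r"
      using i(1) by (cases "u i < w i") (auto simp: r_def not_less intro!: exI[of _ i])
  qed
  moreover have "\<forall>u w i j. (u, w) \<in> r \<longrightarrow> (u(i := u i + j), w(i := w i + j)) \<in> r"
  proof (intro allI impI)
    fix u w i j assume "(u, w) \<in> r"
    then obtain l where "u l < w l" "\<forall>k. f k < f l \<longrightarrow> u k = w k" by (auto simp: r_def)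
    then show "(u(i := u i + j), w(i := w i + j)) \<in> r" by (auto simp: r_def intro!: exI[of _ l])
  qed
  ultimately have "wf r \<and> trans r \<and> total r \<and>
    (\<forall>u w i j. (u, w) \<in> r \<longrightarrow> (u(i := u i + j), w(i := w i + j)) \<in> r)"
    by (intro conjI)
  then show ?thesis by (rule exI[where x = r])
qed

text \<open>\<open>span T\<close> models the finite-dimensional algebra R \<otimes> K,
  \<open>\<xi> i\<close> the multiplication by the i-th variable and \<open>b u\<close> the class of
  the monomial with exponent vector \<open>u\<close>. The operators act on the whole type but take
  values in \<open>span T\<close>, so that ordinary functions and their iterates can be
  used.\<close>

locale commuting_system = linear_space scale
  for scale :: "'a::field \<Rightarrow> 'b::ab_group_add \<Rightarrow> 'b" +
  fixes \<xi> :: "'n::finite \<Rightarrow> 'b \<Rightarrow> 'b" and b :: "('n \<Rightarrow> nat) \<Rightarrow> 'b" and T :: "'b set"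
  assumes lin: "Vector_Spaces.linear scale scale (\<xi> i)"
    and comm: "\<xi> i (\<xi> k y) = \<xi> k (\<xi> i y)"
    and X_b: "\<xi> i (b u) = b (u(i := Suc (u i)))"
    and finite_T: "finite T"
    and X_in: "\<xi> i y \<in> span T"
    and span_b: "span (range b) = span T"
begin

definition lform :: "('n \<Rightarrow> 'a) \<Rightarrow> 'b \<Rightarrow> 'b" where
  "lform a y = (\<Sum>i\<in>UNIV. scale (a i) (\<xi> i y))"

lemma linear_lform: "Vector_Spaces.linear scale scale (lform a)"
proof -
  have "\<xi> i (x + y) = \<xi> i x + \<xi> i y" "\<xi> i (scale c x) = scale c (\<xi> i x)" for i x y c
    using lin[of i] by (auto simp: Vector_Spaces.linear_iff)
  then show ?thesis
    unfolding Vector_Spaces.linear_iff lform_def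
    by (auto simp: vector_space_axioms scale_right_distrib sum.distrib scale_sum_right mult.commute)
qed

lemma X_lform: "\<xi> i (lform a y) = lform a (\<xi> i y)"
proof -
  interpret Vector_Spaces.linear scale scale "\<xi> i" by (rule lin)
  show ?thesis unfolding lform_def by (simp add: sum local.scale comm)
qed

lemma lform_in: "lform a y \<in> span T"
  unfolding lform_def by (intro span_sum span_scale X_in)

lemma b_in: "b u \<in> span T"
  using span_base[of "b u" "range b"] span_b by simp

lemma funpow_X_b: "(\<xi> i ^^ j) (b u) = b (u(i := u i + j))"
proof (induction j)
  case (Suc j)
  have "(\<xi> i ^^ Suc j) (b u) = \<xi> i (b (u(i := u i + j)))" unfolding funpow.simps comp_apply Suc.IH ..
  also have "\<dots> = b (u(i := u i + Suc j))" by (subst X_b) (simp add: fun_upd_def if_distrib cong: if_cong)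
  finally show ?case .
qed simp

text \<open>The pencil through \<open>lform a\<close> in direction \<open>\<xi> s\<close> consists
  of linear forms again; hence a rank that is maximal among linear forms is maximal in the
  pencil.\<close>

lemma lform_upd: "lform (a(s := a s + t)) y = lform a y + scale t (\<xi> s y)"
proof -
  have "lform (a(s := a s + t)) y = (\<Sum>i\<in>UNIV. scale (a i) (\<xi> i y) + (if i = s then scale t (\<xi> s y) else 0))"
    unfolding lform_def by (intro sum.cong) (auto simp: scale_left_distrib)
  then show ?thesis by (simp add: lform_def sum.distrib)
qed

text \<open>\<open>c0\<close> counts the standard monomials modulo a suitable form,
  \<open>c1\<close> those that stay standard after adding \<open>j\<close> to some exponent. By
  \<open>rich\<close>, the range of every form has codimension at least \<open>M\<close> in
  \<open>span T\<close>.\<close>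

lemma standard_monomial_bound:
  assumes inf: "infinite (UNIV :: 'a set)" and n: "CARD('n) \<ge> 2" and j: "j \<ge> 1"
    and rich: "\<And>a C. finite C \<Longrightarrow> C \<subseteq> span T \<Longrightarrow> span T \<subseteq> span (range (lform a) \<union> C) \<Longrightarrow> M \<le> real (card C)"
  defines "N \<equiv> CARD('n) - 1"
  shows "\<exists>c0 c1 :: nat. M \<le> c0 \<and> c0 + j * c1 \<le> card T \<and>
    real c0 \<le> real ((2 * N choose N) * j ^ N) + 2 * N / (N + 1) * c1"
proof -

  \<comment> \<open>A linear form whose j-th power has maximal rank\<close>
  define good where "good \<rho> \<longleftrightarrow> (\<exists>a u. (\<exists>i. a i \<noteq> 0) \<and> indep_family {..<\<rho>} (\<lambda>\<beta>. (lform a ^^ j) (u \<beta>)))" for \<rho> :: nat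
  have "good 0" by (auto simp: good_def indep_family_def intro!: exI[of _ "\<lambda>_. 1"])
  have good_le: "\<rho> \<le> card T" if \<rho>: "good \<rho>" for \<rho>
  proof -
    obtain a u where ind: "indep_family {..<\<rho>} (\<lambda>\<beta>. (lform a ^^ j) (u \<beta>))" using \<rho> by (auto simp: good_def)
    have "(lform a ^^ j) y \<in> span T" for y using lform_in j by (cases j) auto
    then have "(\<lambda>\<beta>. (lform a ^^ j) (u \<beta>)) ` {..<\<rho>} \<subseteq> span T" by blast
    from indep_family_card_le[OF _ ind this finite_T] show ?thesis by simp
  qed
  obtain \<rho> where \<rho>: "good \<rho>" and not_good: "\<not> good (Suc \<rho>)"
  proof -
    have fin: "finite {\<rho>. good \<rho>}" by (rule finite_subset[of _ "{..card T}"]) (auto dest: good_le)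
    have "Max {\<rho>. good \<rho>} \<in> {\<rho>. good \<rho>}" using Max_in[OF fin] \<open>good 0\<close> by blast
    moreover have "\<not> good (Suc (Max {\<rho>. good \<rho>}))"
      using Max_ge[OF fin, of "Suc (Max {\<rho>. good \<rho>})"] by auto
    ultimately show thesis using that by blast
  qed
  \<comment> \<open>\<open>good\<close> only admits nonzero forms; the variable \<open>k\<close>
    with nonzero coefficient is the one to be eliminated modulo the form.\<close>
  obtain a u0 k where k: "a k \<noteq> 0" and u0: "indep_family {..<\<rho>} (\<lambda>\<beta>. (lform a ^^ j) (u0 \<beta>))"
    using \<rho> by (auto simp: good_def)
  define L where "L = lform a"
  interpret L: Vector_Spaces.linear scale scale L unfolding L_def by (rule linear_lform)
  interpret Lp: Vector_Spaces.linear scale scale "L ^^ i" for i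
    using linear_funpow[OF linear_lform] by (simp add: L_def)
  interpret Xp: Vector_Spaces.linear scale scale "\<xi> s ^^ i" for s i
    using linear_funpow[OF lin] .
  have kernel: "(\<xi> s ^^ j) f \<in> range L" if f: "(L ^^ j) f = 0" for s f
  proof -
    \<comment> \<open>At t = - a s the coefficient at \<open>s\<close> vanishes and the perturbed
      form might be zero; for all other t it is nonzero and the maximality of \<open>\<rho>\<close>
      applies.\<close>
    have "\<not> indep_family {..<Suc \<rho>} (\<lambda>\<beta>. ((\<lambda>y. lform a y + scale t (\<xi> s y)) ^^ j) (u' \<beta>))" if "t \<notin> {- a s}" for t u'
    proof
      assume *: "indep_family {..<Suc \<rho>} (\<lambda>\<beta>. ((\<lambda>y. lform a y + scale t (\<xi> s y)) ^^ j) (u' \<beta>))"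
      have "(\<lambda>y. lform a y + scale t (\<xi> s y)) = lform (a(s := a s + t))" by (auto simp: lform_upd)
      moreover have "(a(s := a s + t)) s \<noteq> 0" using that by (simp add: add_eq_0_iff)
      ultimately have "good (Suc \<rho>)" using * unfolding good_def by metis
      with not_good show False by simp
    qed
    from funpow_kernel_moves_into_range[where E = "{- a s}", OF inf linear_lform lin X_lform u0 _ this f[unfolded L_def]]
    show ?thesis by (simp add: L_def)
  qed

  \<comment> \<open>Standard monomials modulo the range of the form\<close>
  define A where "A = UNIV - {k}"
  have cA: "card A = N" by (simp add: A_def N_def card_Diff_singleton)
  have "finite A" "A \<noteq> {}" using n cA by (auto simp: N_def)
  obtain r :: "(('n \<Rightarrow> nat) \<times> ('n \<Rightarrow> nat)) set" where r': "wf r" "trans r" "total r"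
    "\<forall>u w i j. (u, w) \<in> r \<longrightarrow> (u(i := u i + j), w(i := w i + j)) \<in> r"
    using exists_monomial_order by (elim exE conjE)
  note r = r'(1-3) r'(4)[rule_format]
  define below where "below u = {w \<in> monomials_in A. (w, u) \<in> r}" for u
  \<comment> \<open>Standard monomials in the sense of Groebner bases: those that do not reduce to
    smaller ones modulo the range of \<open>L\<close>.\<close>
  define \<Sigma> where "\<Sigma> = {u \<in> monomials_in A. b u \<notin> span (range L \<union> b ` below u)}"
  define \<Sigma>' where "\<Sigma>' = {u \<in> \<Sigma>. \<exists>i\<in>A. u(i := u i + j) \<in> \<Sigma>}"
  \<comment> \<open>Both parts of \<open>G\<close> are carried into the range of \<open>L\<close> by
    every \<open>\<xi> i ^^ j\<close>, the second one by the choice of the form.\<close>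
  define G where "G = range L \<union> {f. (L ^^ j) f = 0}"

  have range_L: "span (range L) = range L" by (simp add: L.subspace_image)

  \<comment> \<open>Multiplication by \<open>\<xi> i ^^ j\<close> carries a linear dependence below \<open>u\<close> to one below \<open>u + j e\<^sub>i\<close>.\<close>
  have shift: "b (u(i := u i + j)) \<in> span (range L \<union> b ` below (u(i := u i + j)))"
    if H: "b u \<in> span (H \<union> b ` below u)" and im: "(\<xi> i ^^ j) ` H \<subseteq> range L" and i: "i \<in> A" for u i H
  proof -
    have "(\<xi> i ^^ j) (b u) \<in> span ((\<xi> i ^^ j) ` (H \<union> b ` below u))"
      using H by (simp add: Xp.span_image)
    moreover have "(\<xi> i ^^ j) ` (H \<union> b ` below u) \<subseteq> range L \<union> b ` below (u(i := u i + j))"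
    proof -
      have "(\<xi> i ^^ j) (b w) \<in> b ` below (u(i := u i + j))" if "w \<in> below u" for w
      proof -
        have "w(i := w i + j) \<in> below (u(i := u i + j))"
          using that i r(4)[of w u i j] by (simp add: below_def monomials_in_def)
        then show ?thesis unfolding funpow_X_b by (rule imageI)
      qed
      then show ?thesis using im by blast
    qed
    ultimately have "(\<xi> i ^^ j) (b u) \<in> span (range L \<union> b ` below (u(i := u i + j)))"
      using span_mono by blast
    then show ?thesis unfolding funpow_X_b .
  qed
  have XL: "(\<xi> i ^^ j) ` range L \<subseteq> range L" for i j
  proof (induction j)
    case (Suc j)
    have "\<xi> i (L y) \<in> range L" for y by (simp add: L_def X_lform)
    then have "\<xi> i ` range L \<subseteq> range L" by blast
    with Suc show ?case by (simp add: image_comp[symmetric]) blast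
  qed simp
  have XG: "(\<xi> i ^^ j) ` G \<subseteq> range L" for i
    unfolding G_def image_Un using XL[of j i] kernel[of _ i] by blast

  \<comment> \<open>Otherwise the largest monomial with nonzero coefficient would reduce to smaller
    ones modulo \<open>H\<close>.\<close>
  have triangular: "c u = 0"
    if F: "finite F" "F \<subseteq> monomials_in A" "\<And>u. u \<in> F \<Longrightarrow> b u \<notin> span (H \<union> b ` below u)"
      and c: "(\<Sum>u\<in>F. scale (c u) (b u)) \<in> span H" and "u \<in> F" for F H c u
  proof (rule ccontr)
    assume "c u \<noteq> 0"
    define F' where "F' = {u \<in> F. c u \<noteq> 0}"
    have F': "finite F'" "F' \<noteq> {}" using F \<open>c u \<noteq> 0\<close> \<open>u \<in> F\<close> by (auto simp: F'_def)
    have "\<exists>z\<in>F'. \<forall>w\<in>F'. w \<noteq> z \<longrightarrow> (w, z) \<in> r"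
      using F'
    proof (induction F' rule: finite_ne_induct)
      case (insert x F)
      then obtain z where z: "z \<in> F" "\<forall>w\<in>F. w \<noteq> z \<longrightarrow> (w, z) \<in> r" by blast
      show ?case
      proof (cases "(x, z) \<in> r")
        case True
        then show ?thesis using z by auto
      next
        case False
        then have "(z, x) \<in> r" using r(3) z insert.hyps by (metis UNIV_I total_on_def)
        then have "(w, x) \<in> r" if "w \<in> F" for w using z that r(2) by (cases "w = z") (auto dest: transD)
        then show ?thesis by auto
      qed
    qed auto
    then obtain z where z: "z \<in> F'" "\<And>w. w \<in> F' \<Longrightarrow> w \<noteq> z \<Longrightarrow> (w, z) \<in> r" by blast
    have zF: "z \<in> F" "c z \<noteq> 0" using z by (auto simp: F'_def)
    let ?S = "span (H \<union> b ` below z)"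
    have "(\<Sum>u\<in>F. scale (c u) (b u)) = (\<Sum>u\<in>F'. scale (c u) (b u))"
      using F by (intro sum.mono_neutral_right) (auto simp: F'_def)
    also have "\<dots> = scale (c z) (b z) + (\<Sum>u\<in>F' - {z}. scale (c u) (b u))"
      using F'(1) z(1) by (simp add: sum.remove)
    finally have eq: "scale (c z) (b z) = (\<Sum>u\<in>F. scale (c u) (b u)) - (\<Sum>u\<in>F' - {z}. scale (c u) (b u))"
      by simp
    have "(\<Sum>u\<in>F. scale (c u) (b u)) \<in> ?S" using c span_mono[of H "H \<union> b ` below z"] by blast
    moreover have "(\<Sum>u\<in>F' - {z}. scale (c u) (b u)) \<in> ?S"
    proof (intro span_sum span_scale span_base UnI2 imageI)
      fix w assume "w \<in> F' - {z}"
      then show "w \<in> below z" using z(2)[of w] F(2) by (auto simp: below_def F'_def)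
    qed
    ultimately have "scale (c z) (b z) \<in> ?S" unfolding eq by (rule span_diff)
    then have "scale (inverse (c z)) (scale (c z) (b z)) \<in> ?S" by (rule span_scale)
    then show False using F(3)[OF zF(1)] zF(2) by simp
  qed

  have \<Sigma>_mon: "\<Sigma> \<subseteq> monomials_in A" "\<Sigma>' \<subseteq> \<Sigma>" by (auto simp: \<Sigma>_def \<Sigma>'_def)
  \<comment> \<open>If \<open>u\<close> reduced to smaller monomials modulo \<open>G\<close>, then
    by \<open>shift\<close> each u + j e_i with \<open>i\<close> in \<open>A\<close> would reduce
    modulo the range of \<open>L\<close>, against the choice of \<open>\<Sigma>'\<close>.\<close>
  have \<Sigma>'_std: "b u \<notin> span (G \<union> b ` below u)" if "u \<in> \<Sigma>'" for u
    using that shift[OF _ XG] by (auto simp: \<Sigma>'_def \<Sigma>_def)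
  have fin_le: "card F \<le> card T" if F: "finite F" "F \<subseteq> \<Sigma>" for F
  proof -
    have "indep_family F b"
      unfolding indep_family_def
    proof (intro allI impI ballI)
      fix c u assume c: "(\<Sum>u\<in>F. scale (c u) (b u)) = 0" and "u \<in> F"
      then show "c u = 0"
        using triangular[of F "range L" c u] F \<Sigma>_mon span_zero by (auto simp: \<Sigma>_def)
    qed
    from indep_family_card_le[OF F(1) this _ finite_T] b_in show ?thesis by auto
  qed
  have fin: "finite \<Sigma>"
    using finite_if_finite_subsets_card_bdd[of \<Sigma> "card T"] fin_le by auto
  then have fin': "finite \<Sigma>'" using \<Sigma>_mon finite_subset by auto

  have "b u \<in> span (range L \<union> b ` \<Sigma>)" if "u \<in> monomials_in A" for u
    using r(1) that
  proof (induction u rule: wf_induct_rule)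
    case (less u)
    show ?case
    proof (cases "u \<in> \<Sigma>")
      case False
      then have "b u \<in> span (range L \<union> b ` below u)" using less.prems by (simp add: \<Sigma>_def)
      moreover have "range L \<union> b ` below u \<subseteq> span (range L \<union> b ` \<Sigma>)"
        using less.IH span_superset[of "range L \<union> b ` \<Sigma>"] by (auto simp: below_def)
      ultimately show ?thesis using span_minimal[OF _ subspace_span] by blast
    qed (auto intro: span_base)
  qed
  then have mon_span: "span (range L \<union> b ` monomials_in A) \<subseteq> span (range L \<union> b ` \<Sigma>)"
    by (intro span_minimal subspace_span) (auto intro: span_base)
  \<comment> \<open>Variables in \<open>A\<close> permute the monomials among themselves or enlarge
    them; the variable \<open>k\<close> is expressed by \<open>L\<close> and the others.\<close>
  have X_closed: "\<xi> i y \<in> span (range L \<union> b ` monomials_in A)" if y: "y \<in> span (range L \<union> b ` monomials_in A)" for i y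
  proof -
    let ?S = "span (range L \<union> b ` monomials_in A)"
    have A: "\<xi> i y \<in> ?S" if "i \<in> A" for i
    proof -
      interpret Xi: Vector_Spaces.linear scale scale "\<xi> i" by (rule lin)
      have "\<xi> i y \<in> span (\<xi> i ` (range L \<union> b ` monomials_in A))" using y by (simp add: Xi.span_image)
      moreover have "\<xi> i ` (range L \<union> b ` monomials_in A) \<subseteq> range L \<union> b ` monomials_in A"
        using that by (auto simp: X_b X_lform L_def monomials_in_def)
      ultimately show ?thesis using span_mono by blast
    qed
    show ?thesis
    proof (cases "i = k")
      case True
      have "L y = scale (a k) (\<xi> k y) + (\<Sum>i\<in>A. scale (a i) (\<xi> i y))"
        unfolding L_def lform_def A_def by (subst sum.remove[of _ k]) auto
      then have "\<xi> k y = scale (inverse (a k)) (L y - (\<Sum>i\<in>A. scale (a i) (\<xi> i y)))" using k by simp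
      also have "\<dots> \<in> ?S" by (intro span_scale span_diff span_sum A) (auto intro: span_base)
      finally show ?thesis using True by simp
    qed (use A in \<open>auto simp: A_def\<close>)
  qed
  have all_b: "b u \<in> span (range L \<union> b ` monomials_in A)" for u
  proof (induction "\<Sum>i\<in>UNIV. u i" arbitrary: u)
    case 0
    then have "u \<in> monomials_in A" by (simp add: monomials_in_def)
    then show ?case by (auto intro: span_base)
  next
    case (Suc s)
    then obtain i where i: "u i \<noteq> 0" by (metis nat.distinct(1) sum.neutral)
    define w where "w = u(i := u i - 1)"
    have "(\<Sum>i\<in>UNIV. u i) = u i + (\<Sum>i\<in>UNIV - {i}. u i)" "(\<Sum>i\<in>UNIV. w i) = w i + (\<Sum>i\<in>UNIV - {i}. u i)"
      by (simp_all add: sum.remove[of UNIV i] w_def)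
    then have "s = (\<Sum>i\<in>UNIV. w i)" using Suc.hyps(2) i by (simp add: w_def)
    then have "\<xi> i (b w) \<in> span (range L \<union> b ` monomials_in A)" using X_closed Suc.hyps(1) by blast
    moreover have "\<xi> i (b w) = b u" using i by (simp add: X_b w_def)
    ultimately show ?case by simp
  qed
  have "span T \<subseteq> span (range L \<union> b ` \<Sigma>)"
    unfolding span_b[symmetric] using all_b mon_span by (intro span_minimal subspace_span) auto
  then have "M \<le> real (card (b ` \<Sigma>))"
    using rich[of "b ` \<Sigma>" a] fin b_in by (auto simp: L_def)
  then have M: "M \<le> real (card \<Sigma>)" using card_image_le[OF fin, of b] by linarith

  \<comment> \<open>Independence of the powers of the form applied to standard monomials\<close>
  define S where "S i = (if i = 0 then \<Sigma> else \<Sigma>')" for i :: nat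
  have finS: "finite (S i)" for i using fin fin' by (simp add: S_def)
  have "indep_family (Sigma {..j} S) (\<lambda>(i, u). (L ^^ i) (b u))"
    unfolding indep_family_def
  proof (intro allI impI)
    fix c assume c: "(\<Sum>p\<in>Sigma {..j} S. scale (c p) (case p of (i, u) \<Rightarrow> (L ^^ i) (b u))) = 0"
    define y where "y i = (\<Sum>u\<in>S i. scale (c (i, u)) (b u))" for i
    have "(\<Sum>i\<le>j. (L ^^ i) (y i)) = (\<Sum>i\<le>j. \<Sum>u\<in>S i. scale (c (i, u)) ((L ^^ i) (b u)))"
      by (simp add: y_def Lp.sum Lp.scale)
    also have "\<dots> = 0" using c finS by (simp add: sum.Sigma case_prod_unfold)
    finally have sum0: "(\<Sum>i\<le>j. (L ^^ i) (y i)) = 0" .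
    have "\<forall>u\<in>S i. c (i, u) = 0" if "i \<le> j" for i
      using that
    proof (induction i rule: less_induct)
      case (less i)
      have y0: "y i' = 0" if "i' < i" for i' using less that by (simp add: y_def)
      \<comment> \<open>The coefficients are killed layer by layer, from the lowest power of
        \<open>L\<close> upwards. Once the layers below \<open>i\<close> are gone, the rest of the
        relation is \<open>L ^^ i\<close> applied to y_i + L z.\<close>
      define z where "z = (\<Sum>i'\<in>{Suc i..j}. (L ^^ (i' - Suc i)) (y i'))"
      have Lz: "(L ^^ Suc i) z = (\<Sum>i'\<in>{Suc i..j}. (L ^^ i') (y i'))"
        unfolding z_def Lp.sum
      proof (rule sum.cong)
        fix i' assume "i' \<in> {Suc i..j}"
        then have "Suc i + (i' - Suc i) = i'" by simp
        then show "(L ^^ Suc i) ((L ^^ (i' - Suc i)) (y i')) = (L ^^ i') (y i')"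
          by (metis comp_apply funpow_add)
      qed simp
      have "(\<Sum>i'\<le>j. (L ^^ i') (y i')) = (\<Sum>i'\<in>insert i {Suc i..j}. (L ^^ i') (y i'))"
      proof (intro sum.mono_neutral_right ballI)
        fix i' assume "i' \<in> {..j} - insert i {Suc i..j}"
        then have "i' < i" by auto
        then show "(L ^^ i') (y i') = 0" by (simp add: y0 Lp.zero)
      qed (use less.prems in auto)
      then have "(L ^^ i) (y i) + (L ^^ Suc i) z = 0" using sum0 Lz by simp
      then have Li: "(L ^^ i) (y i + L z) = 0" by (simp add: Lp.add funpow_swap1)
      show ?case
      proof (cases "i = 0")
        case True
        then have "y i + L z \<in> span (range L)" using Li by (simp add: span_zero)
        from span_diff[OF this span_base[of "L z" "range L"]] have "y i \<in> span (range L)" by simp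
        then have "(\<Sum>u\<in>\<Sigma>. scale (c (i, u)) (b u)) \<in> span (range L)" by (simp add: y_def S_def True)
        from triangular[OF fin \<Sigma>_mon(1) _ this] show ?thesis by (simp add: S_def True \<Sigma>_def)
      next
        case False
        \<comment> \<open>As i \<le> j, the vector y_i + L z is in the kernel of
          \<open>L ^^ j\<close>, so y_i lies in the span of \<open>G\<close>, modulo which the
          monomials of \<open>\<Sigma>'\<close> are still independent.\<close>
        have "(L ^^ j) (y i + L z) = (L ^^ (j - i)) ((L ^^ i) (y i + L z))"
          using less.prems by (metis comp_apply funpow_add le_add_diff_inverse2)
        then have "y i + L z \<in> G" using Li by (simp add: G_def Lp.zero)
        moreover have "L z \<in> G" by (simp add: G_def)
        ultimately have "(y i + L z) - L z \<in> span G" by (intro span_diff span_base)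
        then have "(\<Sum>u\<in>\<Sigma>'. scale (c (i, u)) (b u)) \<in> span G" using False by (simp add: y_def S_def)
        from triangular[OF fin' _ \<Sigma>'_std this] \<Sigma>_mon show ?thesis using False by (auto simp: S_def)
      qed
    qed
    then show "\<forall>p\<in>Sigma {..j} S. c p = 0" by auto
  qed
  moreover have "(L ^^ i) (b u) \<in> span T" for i u using lform_in b_in by (cases i) (auto simp: L_def)
  ultimately have "card (Sigma {..j} S) \<le> card T"
    using finS by (intro indep_family_card_le[OF _ _ _ finite_T]) auto
  moreover have "card (Sigma {..j} S) = card \<Sigma> + j * card \<Sigma>'"
  proof -
    have "card (Sigma {..j} S) = (\<Sum>i\<le>j. card (S i))" using finS by simp
    also have "\<dots> = card (S 0) + (\<Sum>i\<in>{..j} - {0}. card (S i))" by (rule sum.remove) auto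
    also have "(\<Sum>i\<in>{..j} - {0}. card (S i)) = (\<Sum>i\<in>{..j} - {0}. card \<Sigma>')" by (rule sum.cong) (auto simp: S_def)
    also have "S 0 = \<Sigma>" by (simp add: S_def)
    finally show ?thesis by simp
  qed
  moreover have "real (card \<Sigma>) \<le> real ((2 * N choose N) * j ^ N) + 2 * N / (N + 1) * card \<Sigma>'"
  proof -
    \<comment> \<open>Closure of \<open>\<Sigma>\<close> under lowering an exponent by
      \<open>j\<close> is the contrapositive of \<open>shift\<close>.\<close>
    have "u(i := u i - j) \<in> \<Sigma>" if u: "u \<in> \<Sigma>" "i \<in> A" "j \<le> u i" for u i
    proof (rule ccontr)
      define w where "w = u(i := u i - j)"
      assume "u(i := u i - j) \<notin> \<Sigma>"
      moreover have "w \<in> monomials_in A" using u by (simp add: \<Sigma>_def monomials_in_def w_def)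
      ultimately have "b w \<in> span (range L \<union> b ` below w)" by (simp add: \<Sigma>_def w_def)
      moreover have "w(i := w i + j) = u" using u(3) by (simp add: w_def)
      ultimately have "b u \<in> span (range L \<union> b ` below u)" using shift[OF _ XL u(2), of w] by simp
      then show False using u(1) by (simp add: \<Sigma>_def)
    qed
    from card_downset_le_shift[OF \<open>finite A\<close> \<open>A \<noteq> {}\<close> j fin \<Sigma>_mon(1) this]
    show ?thesis by (simp add: \<Sigma>'_def cA add.commute)
  qed
  ultimately have "M \<le> real (card \<Sigma>) \<and> card \<Sigma> + j * card \<Sigma>' \<le> card T \<and>
    real (card \<Sigma>) \<le> real ((2 * N choose N) * j ^ N) + 2 * real N / (real N + 1) * card \<Sigma>'"
    using M by (simp add: add.commute)
  then show ?thesis by (rule exI[where x = "card \<Sigma>", OF exI[where x = "card \<Sigma>'"]])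
qed

end

section \<open>Rank drops on the rational points\<close>

text \<open>By the Leibniz formula the determinant is a signed sum of products of \<open>D\<close>
  affine functions.\<close>

lemma det_polyfun:
  fixes c0 :: "nat \<Rightarrow> nat \<Rightarrow> 'k::field"
  shows "polyfun n D (\<lambda>xs. Determinant.det (Matrix.mat D D (\<lambda>(r, c). [:c0 r c:] + (\<Sum>k<n. [:b r c k:] * xs ! k))))"
proof -
  let ?e = "\<lambda>r c xs. [:c0 r c:] + (\<Sum>k<n. [:b r c k:] * xs ! k)"
  have "Determinant.det (Matrix.mat D D (\<lambda>(r, c). ?e r c xs)) =
      (\<Sum>p | p permutes {0..<D}. [:signof p:] * (\<Prod>r\<in>{0..<D}. ?e r (p r) xs))" for xs
  proof -
    have sg: "(signof p :: 'k poly) = [:signof p:]" for p :: "nat \<Rightarrow> nat"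
      by (simp add: sign_def one_pCons)
    have "(\<Prod>r = 0..<D. Matrix.mat D D (\<lambda>(r, c). ?e r c xs) $$ (r, p r)) = (\<Prod>r\<in>{0..<D}. ?e r (p r) xs)"
      if "p permutes {0..<D}" for p
      using permutes_in_image[OF that] by (intro prod.cong) auto
    then show ?thesis by (subst det_def'[of _ D]) (auto simp: sg intro!: sum.cong)
  qed
  moreover have "polyfun n D (\<lambda>xs. \<Sum>p | p permutes {0..<D}. [:signof p:] * (\<Prod>r\<in>{0..<D}. ?e r (p r) xs))"
    using polyfun_prod_affine[of "{0..<D}" n]
    by (intro polyfun_sum polyfun_smult finite_permutations) auto
  ultimately show ?thesis by presburger
qed

text \<open>
  Columns \<open>c\<close> with \<open>sel c = None\<close> are constant, the others are columns of the linear matrix \<open>\<Sum>\<^sub>i a\<^sub>i x\<^sub>i\<close>. After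
  multiplication by \<open>Z\<close>, the first \<open>m\<close> rows of the latter vanish at \<open>a\<close>, so \<open>det\<close> vanishes there to order
  at least \<open>m\<close> minus the number of constant columns.
\<close>

lemma rank_drop_bound:
  fixes x :: "'n::finite \<Rightarrow> nat \<Rightarrow> nat \<Rightarrow> 'k::field"
  assumes inf: "infinite (UNIV :: 'k set)" and S: "finite S" "S \<noteq> {}"
    and rational: "\<And>a. (\<And>i. a i \<in> S) \<Longrightarrow> \<exists>Z\<in>carrier_mat D D. Determinant.det Z \<noteq> 0 \<and>
      (\<forall>r<m. \<forall>c<D. (\<Sum>s<D. Z $$ (r, s) * (\<Sum>i\<in>UNIV. a i * x i s c)) = 0)"
    and m: "m \<le> D"
    and sel: "\<And>c s. c < D \<Longrightarrow> sel c = Some s \<Longrightarrow> s < D"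
    and none: "card {c. c < D \<and> sel c = None} \<le> k"
    and nz: "Determinant.det (Matrix.mat D D (\<lambda>(r, c).
      case sel c of Some s \<Rightarrow> (\<Sum>i\<in>UNIV. a0 i * x i r s) | None \<Rightarrow> v c r)) \<noteq> 0"
  shows "(m - k) * card S \<le> D"
proof -
  define n where "n = CARD('n)"
  \<comment> \<open>Polynomial functions take lists of arguments, so the variables are
    enumerated.\<close>
  obtain g :: "nat \<Rightarrow> 'n" where g: "bij_betw g {..<n} UNIV"
    using ex_bij_betw_nat_finite[of "UNIV :: 'n set"] by (auto simp: atLeast0LessThan n_def)
  have sum_g: "(\<Sum>i\<in>UNIV. h i) = (\<Sum>k<n. h (g k))" for h :: "'n \<Rightarrow> 'k"
    by (rule sum.reindex_bij_betw[OF g, symmetric])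
  define c0 where "c0 r c = (case sel c of Some s \<Rightarrow> 0 | None \<Rightarrow> v c r)" for r c
  define b where "b r c l = (case sel c of Some s \<Rightarrow> x (g l) r s | None \<Rightarrow> 0)" for r c l
  define A where "A xs = Matrix.mat D D (\<lambda>(r, c). [:c0 r c:] + (\<Sum>l<n. [:b r c l:] * xs ! l))" for xs
  define f where "f xs = Determinant.det (A xs)" for xs
  have pf: "polyfun n D f" unfolding f_def A_def by (rule det_polyfun)
  define xs0 where "xs0 = map (\<lambda>l. [:a0 (g l):]) [0..<n]"
  have "f xs0 \<noteq> 0"
  proof -
    interpret comm_ring_hom "\<lambda>c :: 'k. [:c:]" by unfold_locales (auto simp: one_pCons)
    let ?M = "Matrix.mat D D (\<lambda>(r, c). case sel c of Some s \<Rightarrow> (\<Sum>i\<in>UNIV. a0 i * x i r s) | None \<Rightarrow> v c r)"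
    have "A xs0 = map_mat (\<lambda>c. [:c:]) ?M"
    proof (rule eq_matI)
      fix r c assume rc: "r < dim_row (map_mat (\<lambda>c. [:c:]) ?M)" "c < dim_col (map_mat (\<lambda>c. [:c:]) ?M)"
      show "A xs0 $$ (r, c) = map_mat (\<lambda>c. [:c:]) ?M $$ (r, c)"
        using rc by (cases "sel c") (simp_all add: A_def c0_def b_def xs0_def sum_g hom_sum mult.commute)
    qed (simp_all add: A_def)
    then have "f xs0 = [:Determinant.det ?M:]" by (simp add: f_def)
    then show ?thesis using nz by simp
  qed
  then obtain as vs k0 where sz: "length as = n" "length vs = n" "set as \<subseteq> S"
    "coeff (f (map2 (\<lambda>a v. [:a, v:]) as vs)) k0 \<noteq> 0" "k0 * card S \<le> D"
    using multiplicity_schwartz_zippel[OF inf S pf, of xs0] by (auto simp: xs0_def)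
  define zs where "zs = map2 (\<lambda>a v. [:a, v:]) as vs"
  define a where "a i = as ! (the_inv_into {..<n} g i)" for i
  have ag: "a (g l) = as ! l" if "l < n" for l
    using g that by (simp add: a_def the_inv_into_f_f bij_betw_def)
  have "a i \<in> S" for i
  proof -
    have "the_inv_into {..<n} g i < n"
      using g the_inv_into_into[of g "{..<n}" i "{..<n}"] by (auto simp: bij_betw_def)
    then show ?thesis using sz by (auto simp: a_def)
  qed
  from rational[of a, OF this] obtain Z where Z: "Z \<in> carrier_mat D D" "Determinant.det Z \<noteq> 0"
    "\<forall>r<m. \<forall>c<D. (\<Sum>s<D. Z $$ (r, s) * (\<Sum>i\<in>UNIV. a i * x i s c)) = 0"
    by (elim bexE conjE)
  define Zp where "Zp = map_mat (\<lambda>c. [:c:]) Z"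
  have Zp: "Zp \<in> carrier_mat D D" and A: "A zs \<in> carrier_mat D D" using Z by (auto simp: Zp_def A_def)
  have det_Zp: "Determinant.det Zp = [:Determinant.det Z:]"
  proof -
    interpret comm_ring_hom "\<lambda>c :: 'k. [:c:]" by unfold_locales (auto simp: one_pCons)
    show ?thesis by (simp add: Zp_def)
  qed
  \<comment> \<open>The constant term in t is the entry of \<open>Z\<close> times the linear matrix
    at the rational point \<open>a\<close>, which vanishes in the first \<open>m\<close>
    rows.\<close>
  have entry: "monom 1 1 dvd (Zp * A zs) $$ (r, c)" if r: "r < m" and c: "c < D" "sel c \<noteq> None" for r c
  proof -
    obtain s where s: "sel c = Some s" "s < D" using c sel by auto
    have "coeff ((Zp * A zs) $$ (r, c)) 0 = (\<Sum>s'<D. Z $$ (r, s') * (\<Sum>l<n. x (g l) s' s * as ! l))"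
      using r m c s Z(1) sz(1,2)
      by (simp add: scalar_prod_def Zp_def A_def c0_def b_def zs_def coeff_sum atLeast0LessThan mult.commute)
    also have "\<dots> = (\<Sum>s'<D. Z $$ (r, s') * (\<Sum>i\<in>UNIV. a i * x i s' s))"
      by (simp add: sum_g ag mult.commute)
    finally have "coeff ((Zp * A zs) $$ (r, c)) 0 = 0" using Z(3) r s(2) by simp
    then show ?thesis by (simp add: monom_1_dvd_iff')
  qed
  have "monom 1 (m - k) dvd Determinant.det (Zp * A zs)"
    unfolding det_def'[OF mult_carrier_mat[OF Zp A]]
  proof (intro dvd_sum dvd_mult)
    fix p assume "p \<in> {p. p permutes {0..<D}}"
    then have p: "p permutes {0..<D}" by simp
    \<comment> \<open>Rows among the first \<open>m\<close> that \<open>p\<close> matches with a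
      linear column; each contributes a factor t to the Leibniz term. Since \<open>p\<close> is
      injective, at most \<open>k\<close> of the first \<open>m\<close> rows are lost to constant
      columns.\<close>
    define R where "R = {r. r < m \<and> sel (p r) \<noteq> None}"
    have pD: "p r < D" if "r < D" for r using permutes_in_image[OF p, of r] that by simp
    have "card {r. r < m \<and> sel (p r) = None} \<le> card {c. c < D \<and> sel c = None}"
      using m pD inj_on_subset[OF permutes_inj[OF p]] by (intro card_inj_on_le[of p]) auto
    moreover have "card R + card {r. r < m \<and> sel (p r) = None} = m"
    proof -
      have "card R + card {r. r < m \<and> sel (p r) = None} = card (R \<union> {r. r < m \<and> sel (p r) = None})"
        by (subst card_Un_disjoint) (auto simp: R_def)
      also have "R \<union> {r. r < m \<and> sel (p r) = None} = {..<m}" by (auto simp: R_def)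
      finally show ?thesis by simp
    qed
    ultimately have "m - k \<le> card R" using none by linarith
    then have "(monom 1 (m - k) :: 'k poly) dvd monom 1 (card R)" by (simp add: monom_1_dvd_iff')
    also have "(monom 1 (card R) :: 'k poly) = (\<Prod>r\<in>R. monom 1 1)" by (simp add: monom_power)
    also have "\<dots> dvd (\<Prod>r\<in>R. (Zp * A zs) $$ (r, p r))"
      using entry pD m by (intro prod_dvd_prod) (auto simp: R_def)
    also have "\<dots> dvd (\<Prod>r = 0..<D. (Zp * A zs) $$ (r, p r))"
      using m by (intro prod_dvd_prod_subset) (auto simp: R_def)
    finally show "monom 1 (m - k) dvd (\<Prod>r = 0..<D. (Zp * A zs) $$ (r, p r))" .
  qed
  then have "monom 1 (m - k) dvd smult (Determinant.det Z) (f zs)"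
    by (simp add: det_mult[OF Zp A] det_Zp f_def)
  then have "\<forall>l<m - k. coeff (f zs) l = 0" using Z(2) by (simp add: monom_1_dvd_iff')
  then have "m - k \<le> k0" using sz(4) by (auto simp: zs_def not_le[symmetric])
  then show ?thesis using sz(5) by (meson le_trans mult_le_mono1)
qed

section \<open>Numerical estimates\<close>

lemma central_binomial_Suc_le: "(2 * Suc N choose Suc N) \<le> 4 * (2 * N choose N)"
proof -
  have "(2 * Suc N choose Suc N) = (2 * N + 1 choose N) + (2 * N + 1 choose Suc N)" by simp
  also have "(2 * N + 1 choose Suc N) = (2 * N + 1 choose N)"
    using binomial_symmetric[of N "2 * N + 1"] by simp
  also have "(2 * N + 1 choose N) \<le> 2 * (2 * N choose N)"
  proof (cases N)
    case (Suc N')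
    then have "(2 * N + 1 choose N) = (2 * N choose N') + (2 * N choose N)" by simp
    then show ?thesis using binomial_maximum'[of N N'] by simp
  qed simp
  finally show ?thesis by simp
qed

lemma central_binomial_le: "N \<ge> 2 \<Longrightarrow> 8 * (2 * N choose N) \<le> 3 * 4 ^ N"
proof (induction N rule: dec_induct)
  case base
  have "(4 choose 2) = (6::nat)" by (simp add: numeral_eq_Suc)
  then show ?case by simp
next
  case (step N)
  then show ?case using central_binomial_Suc_le[of N] by simp
qed

text \<open>The ratio (2 N choose N) / 4^N is 3 / 8 at N = 2 and does not exceed this later, which
  leaves at least 5 / 8; the factor 2 N / (N + 1) is at most 2. For N = 1 the ratio is 1 / 2, but
  the factor is only 1.\<close>

lemma central_binomial_ratio:
  assumes "N \<ge> 1"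
  shows "5 / 16 * (2 * real N / (real N + 1)) \<le> 1 - real (2 * N choose N) / 4 ^ N"
proof (cases "N = 1")
  case True
  then show ?thesis by simp
next
  case False
  then have "8 * (2 * N choose N) \<le> 3 * 4 ^ N" using central_binomial_le[of N] assms by simp
  then have "real (8 * (2 * N choose N)) \<le> real (3 * 4 ^ N)" by (simp only: of_nat_le_iff)
  then have "real (2 * N choose N) / 4 ^ N \<le> 3 / 8" by (simp add: field_simps)
  moreover have "2 * real N / (real N + 1) \<le> 2" by (simp add: field_simps)
  ultimately show ?thesis by linarith
qed

lemma powr_inverse_le:
  assumes "m \<le> q ^ N" "N \<ge> 1"
  shows "real m powr (1 / real N) \<le> real q"
proof (cases "q = 0")
  case False
  have "real m powr (1 / real N) \<le> real (q ^ N) powr (1 / real N)"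
    using assms by (intro powr_mono2) (auto simp flip: of_nat_power)
  also have "\<dots> = real q"
    using False assms by (simp add: powr_realpow[symmetric] powr_powr)
  finally show ?thesis .
qed (use assms in \<open>auto simp: zero_power\<close>)

lemma powr_exponent_split:
  assumes "n = Suc N" "N \<ge> 1"
  shows "real m powr (real n / (real n - 1)) = real m * real m powr (1 / real N)"
proof -
  have "real n / (real n - 1) = 1 + 1 / real N" using assms by (simp add: field_simps)
  then show ?thesis by (simp add: powr_add)
qed

text \<open>The choice of \<open>j\<close> gives (4 j)^N \<le> (15 / 16)^N m \<le>
  \<open>c0\<close>, so the binomial term takes up at most the fraction (2 N choose N) / 4^N of
  \<open>c0\<close>. What is left forces \<open>c1\<close> to be at least 5 / 16 of
  \<open>c0\<close>.\<close>

lemma monomial_count_bound: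
  assumes N: "N \<ge> 1" and \<sigma>: "\<sigma> = real m powr (1 / real N)" and big: "\<sigma> > 16"
    and j: "j = nat \<lfloor>15 / 64 * \<sigma>\<rfloor>"
    and c0: "15 / 16 * real m \<le> real c0" and D: "c0 + j * c1 \<le> D"
    and c1: "real c0 \<le> real ((2 * N choose N) * j ^ N) + 2 * real N / (real N + 1) * real c1"
  shows "real m * \<sigma> / 16 \<le> real D"
proof -
  have m0: "real m > 0" using big \<sigma> by (cases "m = 0") auto
  have \<sigma>N: "\<sigma> ^ N = real m"
    using N m0 by (simp add: \<sigma> powr_realpow[symmetric] powr_powr)
  have jle: "real j \<le> 15 / 64 * \<sigma>" and jge: "15 / 64 * \<sigma> - 1 \<le> real j"
    using big by (auto simp: j, linarith+)
  have "(4 * real j) ^ N \<le> (15 / 16 * \<sigma>) ^ N" using jle by (intro power_mono) auto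
  also have "\<dots> = (15 / 16) ^ N * real m" unfolding power_mult_distrib \<sigma>N ..
  also have "(15 / 16 :: real) ^ N \<le> 15 / 16" using N power_decreasing[of 1 N "15 / 16 :: real"] by simp
  then have "(15 / 16) ^ N * real m \<le> 15 / 16 * real m" using m0 by (intro mult_right_mono) auto
  finally have jN: "4 ^ N * real j ^ N \<le> real c0" using c0 by (simp add: power_mult_distrib)
  have "real (2 * N choose N) * real j ^ N \<le> real (2 * N choose N) / 4 ^ N * real c0"
  proof -
    have "real (2 * N choose N) * real j ^ N = real (2 * N choose N) / 4 ^ N * (4 ^ N * real j ^ N)" by simp
    also have "\<dots> \<le> real (2 * N choose N) / 4 ^ N * real c0" using jN by (intro mult_left_mono) auto
    finally show ?thesis .
  qed
  then have hi: "(1 - real (2 * N choose N) / 4 ^ N) * real c0 \<le> 2 * real N / (real N + 1) * real c1"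
    using c1 by (simp add: algebra_simps)
  have "2 * real N / (real N + 1) * (5 / 16 * real c0) = 5 / 16 * (2 * real N / (real N + 1)) * real c0"
    by (simp only: mult_ac)
  also have "\<dots> \<le> (1 - real (2 * N choose N) / 4 ^ N) * real c0"
    using central_binomial_ratio[OF N] by (intro mult_right_mono) auto
  also note hi
  finally have "2 * real N / (real N + 1) * (5 / 16 * real c0) \<le> 2 * real N / (real N + 1) * real c1" .
  then have c1': "5 / 16 * real c0 \<le> real c1" using N by (subst (asm) mult_le_cancel_left_pos) auto
  \<comment> \<open>15 / 16 * 75 / 1024 = 1125 / 16384 is slightly more than 1 / 16.\<close>
  have "real m * \<sigma> / 16 \<le> 15 / 16 * real m * (75 / 1024 * \<sigma>)"
    using m0 big by simp
  also have "\<dots> \<le> real c0 * (75 / 1024 * \<sigma>)" using c0 big by (intro mult_right_mono) auto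
  \<comment> \<open>75 / 1024 is 15 / 64 * 5 / 16. Rounding \<open>j\<close> down costs at most 5 /
    16, which the summand 1 from \<open>c0\<close> itself covers.\<close>
  also have "\<dots> \<le> real c0 * (1 + (15 / 64 * \<sigma> - 1) * (5 / 16))" by (intro mult_left_mono) (auto simp: field_simps)
  also have "\<dots> = real c0 + (15 / 64 * \<sigma> - 1) * (5 / 16 * real c0)" by (simp add: algebra_simps)
  also have "\<dots> \<le> real c0 + real j * real c1"
    using jge c1' by (intro add_left_mono mult_mono) auto
  also have "\<dots> \<le> real D" using D by (metis of_nat_add of_nat_le_iff of_nat_mult)
  finally show ?thesis .
qed

section \<open>The bound for commuting matrices\<close>

text \<open>The coordinate space \<open>K\<^sup>D\<close> is realised as the polynomials of degree less than \<open>D\<close>.\<close>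

definition poly_of_coords :: "nat \<Rightarrow> (nat \<Rightarrow> 'k::field) \<Rightarrow> 'k poly" where
  "poly_of_coords D y = (\<Sum>r<D. monom (y r) r)"

lemma coeff_poly_of_coords [simp]: "coeff (poly_of_coords D y) r = (if r < D then y r else 0)"
  by (simp add: poly_of_coords_def coeff_sum)

lemma linear_space_smult: "linear_space (smult :: 'k::field \<Rightarrow> 'k poly \<Rightarrow> 'k poly)"
  by unfold_locales (simp_all add: smult_add_right smult_add_left)

text \<open>
  \<open>S\<close> plays the role of the finite subfield, and \<open>b u\<close> is the class of the monomial \<open>x ^ u\<close>.
\<close>

theorem commuting_matrices_bound:
  fixes x :: "'n::finite \<Rightarrow> nat \<Rightarrow> nat \<Rightarrow> 'k::field" and b :: "('n \<Rightarrow> nat) \<Rightarrow> nat \<Rightarrow> 'k"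
  assumes inf: "infinite (UNIV :: 'k set)" and S: "finite S" "S \<noteq> {}"
    and comm: "\<And>i k r c. r < D \<Longrightarrow> c < D \<Longrightarrow> (\<Sum>s<D. x i r s * x k s c) = (\<Sum>s<D. x k r s * x i s c)"
    and x_b: "\<And>i u r. r < D \<Longrightarrow> (\<Sum>s<D. x i r s * b u s) = b (u(i := Suc (u i))) r"
    and gen: "\<And>s. s < D \<Longrightarrow> \<exists>F c. finite F \<and> (\<forall>r<D. (\<Sum>u\<in>F. c u * b u r) = (if r = s then 1 else 0))"
    and rational: "\<And>a. (\<And>i. a i \<in> S) \<Longrightarrow> \<exists>Z\<in>carrier_mat D D. Determinant.det Z \<noteq> 0 \<and>
      (\<forall>r<m. \<forall>c<D. (\<Sum>s<D. Z $$ (r, s) * (\<Sum>i\<in>UNIV. a i * x i s c)) = 0)"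
    and m: "m \<le> D" "m \<le> card S ^ (n - 1)" and n: "CARD('n) = n" "n \<ge> 2"
  shows "real m powr (real n / (real n - 1)) / 16 \<le> real D"
proof -
  define N where "N = n - 1"
  have N: "N \<ge> 1" "n = Suc N" using n by (auto simp: N_def)
  define \<sigma> where "\<sigma> = real m powr (1 / real N)"
  have goal: "real m powr (real n / (real n - 1)) = real m * \<sigma>"
    unfolding \<sigma>_def by (rule powr_exponent_split[OF N(2,1)])

  \<comment> \<open>The coordinate space as a commuting system\<close>
  interpret linear_space "smult :: 'k \<Rightarrow> 'k poly \<Rightarrow> 'k poly" by (rule linear_space_smult)
  define \<xi> where "\<xi> i y = poly_of_coords D (\<lambda>r. \<Sum>s<D. x i r s * coeff y s)" for i y
  define \<beta> where "\<beta> u = poly_of_coords D (b u)" for u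
  define T where "T = (\<lambda>r. monom (1 :: 'k) r) ` {..<D}"
  have "card T = D" unfolding T_def
    by (subst card_image) (auto simp: inj_on_def monom_eq_iff')
  have span_T: "y \<in> span T \<longleftrightarrow> (\<forall>r\<ge>D. coeff y r = 0)" for y
  proof
    show "\<forall>r\<ge>D. coeff y r = 0" if "y \<in> span T"
      using that by (induction rule: span_induct_alt) (auto simp: T_def)
  next
    assume y: "\<forall>r\<ge>D. coeff y r = 0"
    have "y = (\<Sum>r<D. smult (coeff y r) (monom 1 r))"
      by (rule poly_eqI) (use y in \<open>simp add: coeff_sum not_less mult_delta_right\<close>)
    also have "\<dots> \<in> span T" by (intro span_sum span_scale span_base) (auto simp: T_def)
    finally show "y \<in> span T" .
  qed
  interpret commuting_system smult \<xi> \<beta> T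
  proof (intro commuting_system.intro linear_space_smult commuting_system_axioms.intro)
    fix i k y u
    show "Vector_Spaces.linear smult smult (\<xi> i)"
      unfolding Vector_Spaces.linear_iff
      by (auto simp: vector_space_axioms poly_eq_iff \<xi>_def algebra_simps sum.distrib sum_distrib_left)
    have swap: "(\<Sum>s<D. x i r s * (\<Sum>t<D. x k s t * coeff y t)) = (\<Sum>t<D. (\<Sum>s<D. x i r s * x k s t) * coeff y t)" for i k r
    proof -
      have "(\<Sum>s<D. x i r s * (\<Sum>t<D. x k s t * coeff y t)) = (\<Sum>s<D. \<Sum>t<D. x i r s * x k s t * coeff y t)"
        by (simp add: sum_distrib_left mult.assoc)
      also have "\<dots> = (\<Sum>t<D. \<Sum>s<D. x i r s * x k s t * coeff y t)" by (rule sum.swap)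
      finally show ?thesis by (simp add: sum_distrib_right)
    qed
    show "\<xi> i (\<xi> k y) = \<xi> k (\<xi> i y)"
      by (rule poly_eqI) (simp add: \<xi>_def swap comm[of _ _ i k])
    show "\<xi> i (\<beta> u) = \<beta> (u(i := Suc (u i)))"
      by (rule poly_eqI) (simp add: \<xi>_def \<beta>_def x_b)
    show "finite T" by (simp add: T_def)
    show "\<xi> i y \<in> span T" by (simp add: span_T \<xi>_def)
    have "\<beta> u \<in> span T" for u by (simp add: span_T \<beta>_def)
    then have "span (range \<beta>) \<subseteq> span T" by (intro span_minimal subspace_span) auto
    moreover have "monom 1 s \<in> span (range \<beta>)" if s: "s < D" for s
    proof -
      obtain F c where F: "finite F" "\<forall>r<D. (\<Sum>u\<in>F. c u * b u r) = (if r = s then 1 else 0)"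
        using gen[OF s] by blast
      have "monom 1 s = (\<Sum>u\<in>F. smult (c u) (\<beta> u))"
      proof (rule poly_eqI)
        show "coeff (monom 1 s) r = coeff (\<Sum>u\<in>F. smult (c u) (\<beta> u)) r" for r
          using F s by (cases "r < D") (auto simp: coeff_sum \<beta>_def)
      qed
      also have "\<dots> \<in> span (range \<beta>)" by (intro span_sum span_scale span_base) auto
      finally show ?thesis .
    qed
    then have "span T \<subseteq> span (range \<beta>)" by (intro span_minimal subspace_span) (auto simp: T_def)
    ultimately show "span (range \<beta>) = span T" by auto
  qed
  have lform_coeff: "coeff (lform a y) r = (if r < D then \<Sum>s<D. (\<Sum>i\<in>UNIV. a i * x i r s) * coeff y s else 0)" for a y r
  proof -
    have "(\<Sum>i\<in>UNIV. a i * (\<Sum>s<D. x i r s * coeff y s)) = (\<Sum>s<D. \<Sum>i\<in>UNIV. a i * x i r s * coeff y s)"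
      by (subst sum.swap) (simp add: sum_distrib_left mult.assoc)
    then show ?thesis by (simp add: lform_def coeff_sum \<xi>_def sum_distrib_right)
  qed
  have lform_monom: "coeff (lform a (monom 1 s)) r = (if r < D then \<Sum>i\<in>UNIV. a i * x i r s else 0)"
    if "s < D" for a s r
    using that by (simp add: lform_coeff mult_delta_right)

  \<comment> \<open>Forms of small corank\<close>
  have rank_case: "(m - card C) * card S \<le> D"
    if C: "finite C" "C \<subseteq> span T" "span T \<subseteq> span (range (lform a) \<union> C)" for a C
  proof -
    define P where "P = (\<lambda>s. lform a (monom 1 s)) ` {..<D} \<union> C"
    have PT: "P \<subseteq> span T" using C lform_in by (auto simp: P_def)
    have "range (lform a) \<subseteq> span P"
    proof
      fix z assume "z \<in> range (lform a)"
      then obtain y where z: "z = lform a y" by auto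
      have "z = (\<Sum>s<D. smult (coeff y s) (lform a (monom 1 s)))"
        by (rule poly_eqI) (simp add: z coeff_sum lform_monom lform_coeff[of a y] mult.commute)
      also have "\<dots> \<in> span P" by (intro span_sum span_scale span_base) (auto simp: P_def)
      finally show "z \<in> span P" .
    qed
    moreover have "C \<subseteq> span P" by (auto simp: P_def intro: span_base)
    ultimately have "span (range (lform a) \<union> C) \<subseteq> span P" by (intro span_minimal subspace_span) auto
    with C(3) have TP: "span T \<subseteq> span P" by auto
    obtain B where B: "B \<subseteq> P" "independent B" "P \<subseteq> span B" by (rule maximal_independent_subset)
    have BT: "span T = span B"
    proof
      show "span T \<subseteq> span B" using TP span_minimal[OF B(3) subspace_span] by auto
      show "span B \<subseteq> span T" using B(1) PT by (intro span_minimal subspace_span) auto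
    qed
    have "independent T"
    proof (rule independent_if_scalars_zero)
      show "finite T" by (simp add: T_def)
      fix f z assume f: "(\<Sum>z\<in>T. smult (f z) z) = 0" and "z \<in> T"
      then obtain r where r: "r < D" "z = monom 1 r" by (auto simp: T_def)
      have "(\<Sum>z\<in>T. smult (f z) z) = (\<Sum>s<D. smult (f (monom 1 s)) (monom 1 s))"
        unfolding T_def by (subst sum.reindex) (auto simp: inj_on_def monom_eq_iff')
      then have "coeff (\<Sum>s<D. smult (f (monom 1 s)) (monom 1 s)) r = 0" using f by simp
      then show "f z = 0" using r by (simp add: coeff_sum mult_delta_right)
    qed
    then have cB: "card B = D"
      using dim_span_eq_card_independent[OF B(2)] dim_span_eq_card_independent[of T] BT \<open>card T = D\<close> by simp
    have finB: "finite B" using finite_subset[OF B(1)] C(1) by (simp add: P_def)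
    obtain h where h: "bij_betw h {..<D} B"
      using ex_bij_betw_nat_finite[OF finB] cB by (auto simp: atLeast0LessThan)
    \<comment> \<open>A basis vector from \<open>C\<close> becomes a constant column; any other one
      is a column of the matrix of the form, whose index is recorded.\<close>
    define sel where "sel c = (if h c \<in> C then None else Some (SOME s. s < D \<and> h c = lform a (monom 1 s)))" for c
    have sel_Some: "s < D \<and> h c = lform a (monom 1 s)" if "c < D" "sel c = Some s" for c s
    proof -
      have "h c \<in> P" using h that(1) B(1) by (auto simp: bij_betw_def)
      moreover have "h c \<notin> C" "s = (SOME s. s < D \<and> h c = lform a (monom 1 s))"
        using that(2) by (auto simp: sel_def split: if_splits)
      ultimately have "\<exists>s. s < D \<and> h c = lform a (monom 1 s)" by (auto simp: P_def)
      from someI_ex[OF this] show ?thesis using \<open>s = _\<close> by simp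
    qed
    have "card {c. c < D \<and> sel c = None} \<le> card C"
      using C(1) h by (intro card_inj_on_le[of h]) (auto simp: bij_betw_def sel_def inj_on_def split: if_splits)
    \<comment> \<open>The columns are the coordinates of the basis vectors \<open>h c\<close>; a
      kernel vector would be a linear relation among them.\<close>
    moreover have "Determinant.det (Matrix.mat D D (\<lambda>(r, c).
      case sel c of Some s \<Rightarrow> (\<Sum>i\<in>UNIV. a i * x i r s) | None \<Rightarrow> coeff (h c) r)) \<noteq> 0" (is "Determinant.det ?M \<noteq> 0")
    proof
      assume "Determinant.det ?M = 0"
      moreover have "?M \<in> carrier_mat D D" by simp
      ultimately obtain v where v: "v \<in> carrier_vec D" "v \<noteq> 0\<^sub>v D" "?M *\<^sub>v v = 0\<^sub>v D"
        using det_0_iff_vec_prod_zero[of ?M D] by blast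
      have entry: "?M $$ (r, c) = coeff (h c) r" if "r < D" "c < D" for r c
        using that sel_Some[OF that(2)] by (auto simp: lform_monom split: option.split)
      have "(\<Sum>c<D. smult (vec_index v c) (h c)) = 0"
      proof (rule poly_eqI)
        fix r
        have hT: "h c \<in> span T" if "c < D" for c using h that B(1) PT by (auto simp: bij_betw_def)
        show "coeff (\<Sum>c<D. smult (vec_index v c) (h c)) r = coeff 0 r"
        proof (cases "r < D")
          case True
          have "(?M *\<^sub>v v) $ r = (\<Sum>c<D. ?M $$ (r, c) * vec_index v c)"
            using True v(1) by (simp add: scalar_prod_def atLeast0LessThan)
          also have "\<dots> = (\<Sum>c<D. coeff (h c) r * vec_index v c)" using entry True by (intro sum.cong) auto
          finally show ?thesis using True by (simp add: v(3) coeff_sum mult.commute)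
        next
          case False
          then show ?thesis using hT span_T by (simp add: coeff_sum)
        qed
      qed
      moreover have "(\<Sum>c<D. smult (vec_index v c) (h c)) = (\<Sum>z\<in>B. smult (vec_index v (the_inv_into {..<D} h z)) z)"
        using sum.reindex_bij_betw[OF h, of "\<lambda>z. smult (vec_index v (the_inv_into {..<D} h z)) z"] h
        by (simp add: the_inv_into_f_f bij_betw_def)
      ultimately have "(\<Sum>z\<in>B. smult (vec_index v (the_inv_into {..<D} h z)) z) = 0" by simp
      note z = independentD[OF B(2) finB subset_refl this]
      have "vec_index v c = 0" if "c < D" for c
        using z[of "h c"] h that by (auto simp: the_inv_into_f_f bij_betw_def)
      then have "v = 0\<^sub>v D" using v(1) by (intro eq_vecI) auto
      with v(2) show False ..
    qed
    ultimately show ?thesis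
      using sel_Some by (intro rank_drop_bound[OF inf S rational m(1), of sel]) blast+
  qed

  \<comment> \<open>The case distinction on the minimal corank\<close>
  show ?thesis
  proof (cases "\<exists>a C. finite C \<and> C \<subseteq> span T \<and> span T \<subseteq> span (range (lform a) \<union> C) \<and> real (card C) < 15 / 16 * real m")
    case True
    then obtain a C where C: "finite C" "C \<subseteq> span T" "span T \<subseteq> span (range (lform a) \<union> C)" "real (card C) < 15 / 16 * real m"
      by blast
    \<comment> \<open>Fewer than 15 m / 16 constant columns leave a vanishing order above m / 16 at
      the rational forms, and \<open>\<sigma> \<le> card S\<close> since m is at most the N-th power
      of \<open>card S\<close>.\<close>
    have "real m * \<sigma> / 16 \<le> real m / 16 * real (card S)"
      using powr_inverse_le[of m "card S" N] m N by (simp add: \<sigma>_def mult_left_mono)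
    also have "\<dots> \<le> (real m - real (card C)) * real (card S)" using C(4) by (intro mult_right_mono) auto
    also have "\<dots> = real ((m - card C) * card S)" using C(4) by (simp add: of_nat_diff)
    also have "\<dots> \<le> real D" using rank_case[OF C(1-3)] by (simp only: of_nat_le_iff)
    finally show ?thesis by (simp add: goal)
  next
    case False
    show ?thesis
    proof (cases "\<sigma> > 16")
      case big: True
      define j where "j = nat \<lfloor>15 / 64 * \<sigma>\<rfloor>"
      have "j \<ge> 1" using big by (simp add: j_def le_nat_iff le_floor_iff)
      have rich: "15 / 16 * real m \<le> real (card C)"
        if "finite C" "C \<subseteq> span T" "span T \<subseteq> span (range (lform a) \<union> C)" for a C
        using False that by (meson not_le)
      have card_n: "CARD('n) - 1 = N" "CARD('n) \<ge> 2" using n by (simp_all add: N_def)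
      have "\<exists>c0 c1. 15 / 16 * real m \<le> real c0 \<and> c0 + j * c1 \<le> card T \<and>
          real c0 \<le> real ((2 * N choose N) * j ^ N) + 2 * real N / (real N + 1) * real c1"
        unfolding card_n(1)[symmetric] by (rule standard_monomial_bound[OF inf card_n(2) \<open>j \<ge> 1\<close> rich])
      then obtain c0 c1 where c: "15 / 16 * real m \<le> real c0" "c0 + j * c1 \<le> card T"
          "real c0 \<le> real ((2 * N choose N) * j ^ N) + 2 * real N / (real N + 1) * real c1"
        by (elim exE conjE)
      show ?thesis
        unfolding goal using monomial_count_bound[OF N(1) \<sigma>_def big j_def c(1) _ c(3)] c(2) \<open>card T = D\<close> by simp
    next
      case small: False
      \<comment> \<open>For \<open>\<sigma>\<close> at most 16 the claim already follows from
        \<open>m \<le> D\<close>.\<close>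
      then have "real m * \<sigma> \<le> real m * 16" by (intro mult_left_mono) auto
      then show ?thesis unfolding goal using m(1) by simp
    qed
  qed
qed

section \<open>Ideals of the polynomial ring\<close>

text \<open>Over a finite field, 1 plus the product of all X - a is a nonconstant polynomial without
  roots.\<close>

lemma infinite_alg_closed_field: "infinite (UNIV :: 'k::alg_closed_field set)"
proof
  assume fin: "finite (UNIV :: 'k set)"
  define p :: "'k poly" where "p = (\<Prod>a\<in>UNIV. [:- a, 1:]) + 1"
  have "degree (\<Prod>a\<in>UNIV. [:- a, 1 :: 'k:]) = CARD('k)"
    by (subst degree_prod_eq_sum_degree) auto
  moreover have "CARD('k) > 0" using fin by (simp add: card_gt_0_iff)
  ultimately have "degree p > 0"
    unfolding p_def by (subst degree_add_eq_left) auto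
  then obtain x where "poly p x = 0" using alg_closed_imp_poly_has_root by blast
  moreover have "poly (\<Prod>a\<in>UNIV. [:- a, 1:]) x = 0" using fin by (auto simp: poly_prod)
  ultimately show False by (simp add: p_def)
qed

lemma mpoly_ring_simps [simp]:
  "carrier mpoly_ring = UNIV" "p \<otimes>\<^bsub>mpoly_ring\<^esub> q = p * q" "p \<oplus>\<^bsub>mpoly_ring\<^esub> q = p + q"
  "\<one>\<^bsub>mpoly_ring\<^esub> = 1" "\<zero>\<^bsub>mpoly_ring\<^esub> = 0"
  by (simp_all add: ring_of_type_algebra_def)

text \<open>Replaces the record-based ring operations by those of the type class, in which all later
  computations take place.\<close>

lemma ideal_mpoly_iff:
  "ideal J (mpoly_ring :: ('n::finite, 'a::field) mpoly ring) \<longleftrightarrow>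
    0 \<in> J \<and> (\<forall>p\<in>J. \<forall>q\<in>J. p + q \<in> J) \<and> (\<forall>p\<in>J. \<forall>q. q * p \<in> J)"
proof
  assume "ideal J (mpoly_ring :: ('n, 'a) mpoly ring)"
  then interpret ideal J "mpoly_ring :: ('n, 'a) mpoly ring" .
  show "0 \<in> J \<and> (\<forall>p\<in>J. \<forall>q\<in>J. p + q \<in> J) \<and> (\<forall>p\<in>J. \<forall>q. q * p \<in> J)"
    using additive_subgroup.zero_closed[OF additive_subgroup_axioms]
      additive_subgroup.a_closed[OF additive_subgroup_axioms] I_l_closed by simp
next
  assume J: "0 \<in> J \<and> (\<forall>p\<in>J. \<forall>q\<in>J. p + q \<in> J) \<and> (\<forall>p\<in>J. \<forall>q. q * p \<in> J)"
  interpret ring "mpoly_ring :: ('n, 'a) mpoly ring" by (rule ring_from_type_algebra)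
  show "ideal J (mpoly_ring :: ('n, 'a) mpoly ring)"
  proof (rule idealI)
    show "ring (mpoly_ring :: ('n, 'a) mpoly ring)" by (rule ring_from_type_algebra)
    show "subgroup J (add_monoid mpoly_ring)"
    proof (rule add.subgroupI)
      fix p assume "p \<in> J"
      have "\<ominus>\<^bsub>mpoly_ring\<^esub> p = - 1 * p" by (rule minus_equality) simp_all
      then show "\<ominus>\<^bsub>mpoly_ring\<^esub> p \<in> J" using J \<open>p \<in> J\<close> by metis
    qed (use J in auto)
  qed (use J in \<open>auto simp: mult.commute\<close>)
qed

lemma ideal_mpoly_diff:
  assumes "ideal J (mpoly_ring :: ('n::finite, 'a::field) mpoly ring)" "p \<in> J" "q \<in> J"
  shows "p - q \<in> J"
proof -
  have "p + - 1 * q \<in> J" using assms unfolding ideal_mpoly_iff by blast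
  then show ?thesis by simp
qed

lemma sum_ideals_mpoly:
  assumes "ideal I (mpoly_ring :: ('n::finite, 'a::field) mpoly ring)" "ideal J (mpoly_ring :: ('n, 'a) mpoly ring)"
  shows "ideal (I <+>\<^bsub>mpoly_ring\<^esub> J) mpoly_ring" "I \<subseteq> I <+>\<^bsub>mpoly_ring\<^esub> J" "J \<subseteq> I <+>\<^bsub>mpoly_ring\<^esub> J"
proof -
  have mem: "p \<in> I <+>\<^bsub>mpoly_ring\<^esub> J \<longleftrightarrow> (\<exists>u\<in>I. \<exists>v\<in>J. p = u + v)" for p
    by (auto simp: set_add_def')
  show "ideal (I <+>\<^bsub>mpoly_ring\<^esub> J) mpoly_ring"
    unfolding ideal_mpoly_iff
  proof (intro conjI ballI allI)
    show "0 \<in> I <+>\<^bsub>mpoly_ring\<^esub> J"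
      using assms unfolding ideal_mpoly_iff mem by (intro bexI[of _ 0]) auto
  next
    fix p q assume "p \<in> I <+>\<^bsub>mpoly_ring\<^esub> J" "q \<in> I <+>\<^bsub>mpoly_ring\<^esub> J"
    then obtain u v u' v' where "u \<in> I" "v \<in> J" "u' \<in> I" "v' \<in> J" "p = u + v" "q = u' + v'"
      unfolding mem by blast
    moreover from this have "p + q = (u + u') + (v + v')" by (simp add: algebra_simps)
    ultimately show "p + q \<in> I <+>\<^bsub>mpoly_ring\<^esub> J"
      using assms unfolding ideal_mpoly_iff mem by metis
  next
    fix p q assume "p \<in> I <+>\<^bsub>mpoly_ring\<^esub> J"
    then obtain u v where "u \<in> I" "v \<in> J" "q * p = q * u + q * v" unfolding mem by (auto simp: algebra_simps)
    then show "q * p \<in> I <+>\<^bsub>mpoly_ring\<^esub> J"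
      using assms unfolding ideal_mpoly_iff mem by metis
  qed
  show "I \<subseteq> I <+>\<^bsub>mpoly_ring\<^esub> J"
  proof
    fix p assume "p \<in> I"
    moreover have "0 \<in> J" using assms by (simp add: ideal_mpoly_iff)
    ultimately show "p \<in> I <+>\<^bsub>mpoly_ring\<^esub> J" unfolding mem by (metis add.right_neutral)
  qed
  show "J \<subseteq> I <+>\<^bsub>mpoly_ring\<^esub> J"
  proof
    fix p assume "p \<in> J"
    moreover have "0 \<in> I" using assms by (simp add: ideal_mpoly_iff)
    ultimately show "p \<in> I <+>\<^bsub>mpoly_ring\<^esub> J" unfolding mem by (metis add.left_neutral)
  qed
qed

lemma mpoly_sum_singles:
  fixes p :: "'i \<Rightarrow>\<^sub>0 'a::comm_monoid_add"
  shows "p = (\<Sum>e\<in>Poly_Mapping.keys p. Poly_Mapping.single e (Poly_Mapping.lookup p e))"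
  by (rule poly_mapping_eqI) (auto simp: lookup_sum lookup_single when_def in_keys_iff)

section \<open>Evaluation over the algebraic closure\<close>

definition ac_eval :: "('n::finite, 'a::field) mpoly \<Rightarrow> 'a alg_closure ^ 'n \<Rightarrow> 'a alg_closure" where
  "ac_eval p y = mpoly_eval (Poly_Mapping.map to_ac p) y"

lemma ac_eval_altdef:
  "ac_eval p y = (\<Sum>e\<in>Poly_Mapping.keys p.
     to_ac (Poly_Mapping.lookup p e) * (\<Prod>i\<in>UNIV. (vec_nth y i) ^ Poly_Mapping.lookup e i))"
proof -
  have l: "Poly_Mapping.lookup (Poly_Mapping.map to_ac p) e = to_ac (Poly_Mapping.lookup p e)" for e
    by transfer (auto simp: when_def)
  have "Poly_Mapping.keys (Poly_Mapping.map to_ac p) = Poly_Mapping.keys p"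
    by (auto simp: in_keys_iff l)
  then show ?thesis by (simp add: ac_eval_def mpoly_eval_def l)
qed

lemma ac_eval_add: "ac_eval (p + q) y = ac_eval p y + ac_eval q y"
  unfolding ac_eval_altdef
  by (rule setsum_keys_plus_distrib[where f = "\<lambda>e c. to_ac c * (\<Prod>i\<in>UNIV. (vec_nth y i) ^ Poly_Mapping.lookup e i)"])
    (auto simp: algebra_simps)

lemma ac_eval_sum: "ac_eval (\<Sum>k\<in>A. f k) y = (\<Sum>k\<in>A. ac_eval (f k) y)"
proof (induction A rule: infinite_finite_induct)
qed (auto simp: ac_eval_add, auto simp: ac_eval_altdef)

lemma ac_eval_single:
  "ac_eval (Poly_Mapping.single e c) y = to_ac c * (\<Prod>i\<in>UNIV. (vec_nth y i) ^ Poly_Mapping.lookup e i)"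
  by (simp add: ac_eval_altdef)

lemma ac_eval_mult: "ac_eval (p * q) y = ac_eval p y * ac_eval q y"
proof -
  have single: "ac_eval (Poly_Mapping.single e c * Poly_Mapping.single e' c') y =
      ac_eval (Poly_Mapping.single e c) y * ac_eval (Poly_Mapping.single e' c') y" for e c e' c'
    by (simp add: mult_single ac_eval_single lookup_add power_add prod.distrib)
  have "p * q = (\<Sum>e\<in>Poly_Mapping.keys p. \<Sum>e'\<in>Poly_Mapping.keys q.
      Poly_Mapping.single e (Poly_Mapping.lookup p e) * Poly_Mapping.single e' (Poly_Mapping.lookup q e'))"
    by (subst mpoly_sum_singles[of p], subst mpoly_sum_singles[of q]) (simp add: sum_product)
  then have "ac_eval (p * q) y = (\<Sum>e\<in>Poly_Mapping.keys p. \<Sum>e'\<in>Poly_Mapping.keys q.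
      ac_eval (Poly_Mapping.single e (Poly_Mapping.lookup p e)) y * ac_eval (Poly_Mapping.single e' (Poly_Mapping.lookup q e')) y)"
    by (simp add: ac_eval_sum single)
  also have "\<dots> = (\<Sum>e\<in>Poly_Mapping.keys p. ac_eval (Poly_Mapping.single e (Poly_Mapping.lookup p e)) y)
      * (\<Sum>e'\<in>Poly_Mapping.keys q. ac_eval (Poly_Mapping.single e' (Poly_Mapping.lookup q e')) y)"
    by (simp add: sum_product)
  also have "\<dots> = ac_eval p y * ac_eval q y"
    by (simp flip: ac_eval_sum mpoly_sum_singles)
  finally show ?thesis .
qed

lemma vanishing_ideal_ideal: "ideal (vanishing_ideal W) mpoly_ring"
proof -
  have "vanishing_ideal W = {p. \<forall>y\<in>geometric_points W. ac_eval p y = 0}"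
    by (simp add: vanishing_ideal_def ac_eval_def)
  then show ?thesis
    unfolding ideal_mpoly_iff by (auto simp: ac_eval_add ac_eval_mult) (simp add: ac_eval_altdef)
qed

definition var_mpoly :: "'n::finite \<Rightarrow> ('n, 'a::field) mpoly" where
  "var_mpoly i = Poly_Mapping.single (Poly_Mapping.single i 1) 1"

definition linear_mpoly :: "('n::finite \<Rightarrow> 'a::field) \<Rightarrow> ('n, 'a) mpoly" where
  "linear_mpoly a = (\<Sum>i\<in>UNIV. const_mpoly (a i) * var_mpoly i)"

lemma ac_eval_linear: "ac_eval (linear_mpoly a) y = (\<Sum>i\<in>UNIV. to_ac (a i) * (vec_nth y i))"
proof -
  have "(\<Prod>k\<in>UNIV. (vec_nth y k) ^ Poly_Mapping.lookup (Poly_Mapping.single i (1 :: nat)) k) = vec_nth y i" for i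
  proof -
    have "(\<Prod>k\<in>UNIV. (vec_nth y k) ^ Poly_Mapping.lookup (Poly_Mapping.single i (1 :: nat)) k)
        = (\<Prod>k\<in>{i}. (vec_nth y k) ^ Poly_Mapping.lookup (Poly_Mapping.single i (1 :: nat)) k)"
      by (rule prod.mono_neutral_right) (auto simp: lookup_single when_def)
    then show ?thesis by simp
  qed
  then show ?thesis
    by (simp add: linear_mpoly_def const_mpoly_def var_mpoly_def ac_eval_sum ac_eval_mult ac_eval_single)
qed

text \<open>A linear form commutes with linear combinations, so it vanishes on all combinations over
  the closure of points at which it vanishes.\<close>

lemma linear_mpoly_vanishes:
  assumes "\<And>w. w \<in> W \<Longrightarrow> (\<Sum>i\<in>UNIV. a i * vec_nth w i) = 0"
  shows "linear_mpoly a \<in> vanishing_ideal W"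
proof -
  have "ac_eval (linear_mpoly a) y = 0" if geo: "y \<in> geometric_points W" for y
  proof -
    obtain c where y: "y = (\<Sum>w\<in>W. c w *s (\<chi> i. to_ac (vec_nth w i)))"
      using geo by (auto simp: geometric_points_def)
    have "ac_eval (linear_mpoly a) y = (\<Sum>i\<in>UNIV. \<Sum>w\<in>W. c w * to_ac (a i * vec_nth w i))"
      by (simp add: ac_eval_linear y sum_component sum_distrib_left mult_ac)
    also have "\<dots> = (\<Sum>w\<in>W. c w * to_ac (\<Sum>i\<in>UNIV. a i * vec_nth w i))"
      by (subst sum.swap) (simp add: to_ac_sum sum_distrib_left)
    also have "\<dots> = 0" using assms by simp
    finally show ?thesis .
  qed
  then show ?thesis by (simp add: vanishing_ideal_def ac_eval_def)
qed

lemma hyperplane_subspace_dim: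
  fixes a :: "'n::finite \<Rightarrow> 'a::field"
  assumes "a k \<noteq> 0"
  defines "W \<equiv> {w :: 'a ^ 'n. (\<Sum>i\<in>UNIV. a i * vec_nth w i) = 0}"
  shows "vec.subspace W" "vec.dim W = CARD('n) - 1"
proof -
  show sub: "vec.subspace W"
    by (auto simp: W_def vec.subspace_def algebra_simps sum.distrib simp flip: sum_distrib_left)
  define e :: "'a ^ 'n" where "e = axis k 1"
  have ae: "(\<Sum>i\<in>UNIV. a i * vec_nth e i) = a k" by (simp add: e_def axis_def mult_delta_right)
  have spW: "vec.span W = W" using sub by (rule vec.span_eq_iff[THEN iffD2])
  have "e \<notin> vec.span W" unfolding spW using ae assms(1) by (simp add: W_def)
  then have "vec.dim (insert e W) = vec.dim W + 1" by (simp add: vec.dim_insert)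
  moreover have "vec.span (insert e W) = UNIV"
  proof -
    have "y \<in> vec.span (insert e W)" for y
    proof -
      define t where "t = (\<Sum>i\<in>UNIV. a i * vec_nth y i) / a k"
      have "(\<Sum>i\<in>UNIV. a i * vec_nth (y - t *s e) i) = (\<Sum>i\<in>UNIV. a i * vec_nth y i) - t * (\<Sum>i\<in>UNIV. a i * vec_nth e i)"
        by (simp add: algebra_simps sum_subtractf sum_distrib_left)
      then have "y - t *s e \<in> W" using assms(1) by (simp add: W_def ae t_def)
      then have "(y - t *s e) + t *s e \<in> vec.span (insert e W)"
        by (intro vec.span_add vec.span_scale vec.span_base) auto
      then show ?thesis by simp
    qed
    then show ?thesis by auto
  qed
  then have "vec.dim (insert e W) = CARD('n)" using vec.dim_span[of "insert e W"] by (simp add: vec.dim_UNIV card_cart_basis)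
  ultimately show "vec.dim W = CARD('n) - 1" by simp
qed

section \<open>Coordinates on quotients\<close>

definition lincomb :: "nat \<Rightarrow> (nat \<Rightarrow> 'a::field) \<Rightarrow> (nat \<Rightarrow> ('n::finite, 'a) mpoly) \<Rightarrow> ('n, 'a) mpoly" where
  "lincomb n c p = (\<Sum>i<n. const_mpoly (c i) * p i)"

lemma const_mpoly_add: "const_mpoly (a + b) = const_mpoly a + const_mpoly b"
  by (simp add: const_mpoly_def single_add)

lemma const_mpoly_mult: "const_mpoly (a * b) = const_mpoly a * const_mpoly b"
  by (simp add: const_mpoly_def mult_single)

lemma const_mpoly_0 [simp]: "const_mpoly 0 = 0" and const_mpoly_1 [simp]: "const_mpoly 1 = 1"
  by (simp_all add: const_mpoly_def)

lemma lincomb_add: "lincomb n c p + lincomb n d p = lincomb n (\<lambda>i. c i + d i) p"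
  by (simp add: lincomb_def sum.distrib const_mpoly_add algebra_simps)

lemma lincomb_scale: "const_mpoly a * lincomb n c p = lincomb n (\<lambda>i. a * c i) p"
  by (simp add: lincomb_def sum_distrib_left const_mpoly_mult mult.assoc)

lemma lincomb_Suc: "lincomb (Suc n) c p = lincomb n c p + const_mpoly (c n) * p n"
  by (simp add: lincomb_def)

lemma lincomb_cong: "(\<And>i. i < n \<Longrightarrow> c i = d i \<and> p i = q i) \<Longrightarrow> lincomb n c p = lincomb n d q"
  by (auto simp: lincomb_def intro!: sum.cong)

definition indep_mod :: "('n::finite, 'a::field) mpoly set \<Rightarrow> nat \<Rightarrow> (nat \<Rightarrow> ('n, 'a) mpoly) \<Rightarrow> bool" where
  "indep_mod J n p \<longleftrightarrow> (\<forall>c. lincomb n c p \<in> J \<longrightarrow> (\<forall>i<n. c i = 0))"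

text \<open>Matches the inductive rule for \<open>dimension\<close>, which adds a vector outside the
  span of the earlier ones.\<close>

lemma indep_mod_Suc:
  assumes J: "ideal J (mpoly_ring :: ('n::finite, 'a::field) mpoly ring)"
  shows "indep_mod J (Suc n) p \<longleftrightarrow> indep_mod J n p \<and> (\<forall>c. p n - lincomb n c p \<notin> J)"
proof (intro iffI conjI allI)
  assume ind: "indep_mod J (Suc n) p"
  show "indep_mod J n p"
    unfolding indep_mod_def
  proof (intro allI impI)
    fix c i assume "lincomb n c p \<in> J" "i < n"
    moreover have "lincomb (Suc n) (c(n := 0)) p = lincomb n c p"
      unfolding lincomb_Suc by (auto intro: lincomb_cong)
    ultimately have "(c(n := 0)) i = 0" using ind unfolding indep_mod_def by (metis less_SucI)
    then show "c i = 0" using \<open>i < n\<close> by simp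
  qed
  show "p n - lincomb n c p \<notin> J" for c
  proof
    assume "p n - lincomb n c p \<in> J"
    moreover have "lincomb (Suc n) ((\<lambda>i. - 1 * c i)(n := 1)) p = p n - lincomb n c p"
    proof -
      have "lincomb n ((\<lambda>i. - 1 * c i)(n := 1)) p = lincomb n (\<lambda>i. - 1 * c i) p" by (rule lincomb_cong) auto
      also have "\<dots> = const_mpoly (- 1) * lincomb n c p" by (rule lincomb_scale[symmetric])
      also have "const_mpoly (- 1) = (- 1 :: ('n, 'a) mpoly)" by (simp add: const_mpoly_def single_uminus)
      finally have lc: "lincomb n ((\<lambda>i. - 1 * c i)(n := 1)) p = - 1 * lincomb n c p" .
      show ?thesis unfolding lincomb_Suc lc by simp
    qed
    ultimately have "((\<lambda>i. - 1 * c i)(n := 1)) n = 0" using ind unfolding indep_mod_def by (metis lessI)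
    then show False by simp
  qed
next
  assume h: "indep_mod J n p \<and> (\<forall>c. p n - lincomb n c p \<notin> J)"
  show "indep_mod J (Suc n) p"
    unfolding indep_mod_def
  proof (rule, rule)
    fix c assume c: "lincomb (Suc n) c p \<in> J"
    have "c n = 0"
    proof (rule ccontr)
      assume nz: "c n \<noteq> 0"
      have "const_mpoly (inverse (c n)) * lincomb (Suc n) c p \<in> J" using J c by (simp add: ideal_mpoly_iff)
      also have "const_mpoly (inverse (c n)) * lincomb (Suc n) c p
          = p n - lincomb n (\<lambda>i. - 1 * (inverse (c n) * c i)) p"
      proof -
        have "const_mpoly (inverse (c n)) * (const_mpoly (c n) * p n) = p n"
          using nz by (simp add: mult.assoc[symmetric] const_mpoly_mult[symmetric])
        moreover have "lincomb n (\<lambda>i. - 1 * (inverse (c n) * c i)) p = - (const_mpoly (inverse (c n)) * lincomb n c p)"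
          unfolding lincomb_scale[where a = "- 1", symmetric] lincomb_scale[where a = "inverse (c n)", symmetric]
          by (simp add: const_mpoly_def single_uminus)
        ultimately show ?thesis by (simp add: lincomb_Suc algebra_simps)
      qed
      finally show False using h by blast
    qed
    then have "lincomb n c p \<in> J" using c by (simp add: lincomb_Suc)
    then show "\<forall>i<Suc n. c i = 0" using h \<open>c n = 0\<close> by (auto simp: indep_mod_def less_Suc_eq)
  qed
qed

context
  fixes J :: "('n::finite, 'a::field) mpoly set"
  assumes J: "ideal J (mpoly_ring :: ('n, 'a) mpoly ring)"
begin

abbreviation coset :: "('n, 'a) mpoly \<Rightarrow> ('n, 'a) mpoly set" where
  "coset p \<equiv> J +>\<^bsub>mpoly_ring\<^esub> p"

abbreviation quot_ring :: "('n, 'a) mpoly set ring" where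
  "quot_ring \<equiv> mpoly_ring Quot J"

interpretation ideal J "mpoly_ring :: ('n, 'a) mpoly ring" by (rule J)
interpretation Q: ring quot_ring by (rule quotient_is_ring)

lemma coset_eq_iff: "coset p = coset q \<longleftrightarrow> p - q \<in> J"
proof
  assume "coset p = coset q"
  moreover have "p \<in> coset p"
    using J by (auto simp: a_r_coset_def' ideal_mpoly_iff intro!: bexI[of _ 0])
  ultimately obtain h where "h \<in> J" "p = h + q" by (auto simp: a_r_coset_def')
  then show "p - q \<in> J" by simp
next
  have sub: "coset p \<subseteq> coset q" if "p - q \<in> J" for p q
  proof
    fix z assume "z \<in> coset p"
    then obtain h where "h \<in> J" "z = h + p" by (auto simp: a_r_coset_def')
    then have "h + (p - q) \<in> J" "z = (h + (p - q)) + q" using that J by (auto simp: ideal_mpoly_iff)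
    then show "z \<in> coset q" unfolding a_r_coset_def' by (auto intro!: bexI[of _ "h + (p - q)"])
  qed
  assume "p - q \<in> J"
  moreover from this have "q - p \<in> J" using ideal_mpoly_diff[OF J, of 0 "p - q"] J by (simp add: ideal_mpoly_iff)
  ultimately show "coset p = coset q" using sub by blast
qed

lemma quot_ring_ops:
  "coset p \<otimes>\<^bsub>quot_ring\<^esub> coset q = coset (p * q)" "coset p \<oplus>\<^bsub>quot_ring\<^esub> coset q = coset (p + q)"
  "\<zero>\<^bsub>quot_ring\<^esub> = coset 0" "carrier quot_ring = range coset"
proof -
  show "coset p \<otimes>\<^bsub>quot_ring\<^esub> coset q = coset (p * q)"
    using rcoset_mult_add[of p q] by (simp add: FactRing_def)
  show "coset p \<oplus>\<^bsub>quot_ring\<^esub> coset q = coset (p + q)"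
    using a_rcos_sum[of p q] by (simp add: FactRing_def)
  show "\<zero>\<^bsub>quot_ring\<^esub> = coset 0" by (auto simp: FactRing_def a_r_coset_def')
  show "carrier quot_ring = range coset" by (auto simp: FactRing_def A_RCOSETS_def')
qed

lemma quot_line_extension:
  "Q.line_extension (quot_scalars J) (coset p) (coset ` G) = coset ` {const_mpoly c * p + g | c g. g \<in> G}"
proof -
  have "Q.line_extension (quot_scalars J) (coset p) (coset ` G) =
      {coset (const_mpoly c) \<otimes>\<^bsub>quot_ring\<^esub> coset p \<oplus>\<^bsub>quot_ring\<^esub> coset g | c g. g \<in> G}"
    unfolding Q.line_extension_def r_coset_def set_add_def' quot_scalars_def by auto
  then show ?thesis unfolding quot_ring_ops by auto
qed

lemma lincombs_Suc:
  "{const_mpoly c * p n + g | c g. g \<in> range (\<lambda>c. lincomb n c p)} = range (\<lambda>c. lincomb (Suc n) c p)"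
proof (intro equalityI subsetI)
  fix z assume "z \<in> {const_mpoly c * p n + g | c g. g \<in> range (\<lambda>c. lincomb n c p)}"
  then obtain c d where "z = const_mpoly c * p n + lincomb n d p" by auto
  moreover have "lincomb n (d(n := c)) p = lincomb n d p" by (rule lincomb_cong) auto
  ultimately have "z = lincomb (Suc n) (d(n := c)) p" by (simp add: lincomb_Suc)
  then show "z \<in> range (\<lambda>c. lincomb (Suc n) c p)" by blast
qed (auto simp: lincomb_Suc add.commute)

text \<open>Together with its converse below, this translates the dimension of the quotient ring
  over its residue classes of constants into statements about polynomials modulo
  \<open>J\<close>.\<close>

lemma dimension_imp_indep_mod:
  "Q.dimension n (quot_scalars J) E \<Longrightarrow> \<exists>p. indep_mod J n p \<and> E = coset ` range (\<lambda>c. lincomb n c p)"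
proof (induction n "quot_scalars J" E rule: Q.dimension.induct)
  case zero_dim
  then show ?case by (auto simp: indep_mod_def lincomb_def quot_ring_ops)
next
  case (Suc_dim v E n)
  then obtain p where p: "indep_mod J n p" "E = coset ` range (\<lambda>c. lincomb n c p)" by blast
  obtain f where f: "v = coset f" using Suc_dim.hyps(1) by (auto simp: quot_ring_ops)
  define p' where "p' = p(n := f)"
  have lc: "lincomb n c p' = lincomb n c p" for c by (rule lincomb_cong) (simp add: p'_def)
  have "p' n - lincomb n c p' \<notin> J" for c
    using Suc_dim.hyps(2) unfolding f p(2) coset_eq_iff[symmetric] lc by (auto simp: p'_def)
  moreover have "indep_mod J n p'" using p(1) by (simp add: indep_mod_def lc)
  ultimately have "indep_mod J (Suc n) p'" by (simp add: indep_mod_Suc[OF J])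
  moreover have "Q.line_extension (quot_scalars J) v E = coset ` range (\<lambda>c. lincomb (Suc n) c p')"
    unfolding lincombs_Suc[symmetric] quot_line_extension[symmetric] f p(2) lc by (simp add: p'_def)
  ultimately show ?case by blast
qed

lemma indep_mod_imp_dimension:
  "indep_mod J n p \<Longrightarrow> Q.dimension n (quot_scalars J) (coset ` range (\<lambda>c. lincomb n c p))"
proof (induction n)
  case 0
  have "coset ` range (\<lambda>c. lincomb 0 c p) = {\<zero>\<^bsub>quot_ring\<^esub>}" by (auto simp: lincomb_def quot_ring_ops)
  then show ?case by simp
next
  case (Suc n)
  then have ind: "indep_mod J n p" "\<And>c. p n - lincomb n c p \<notin> J" by (auto simp: indep_mod_Suc[OF J])
  have "coset (p n) \<notin> coset ` range (\<lambda>c. lincomb n c p)" using ind(2) by (auto simp: coset_eq_iff)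
  from Q.Suc_dim[OF _ this Suc.IH[OF ind(1)]] show ?case
    unfolding quot_line_extension lincombs_Suc by (simp add: quot_ring_ops)
qed

end

text \<open>A linear isomorphism from the quotient by \<open>J\<close> to the coordinate space of
  dimension \<open>D\<close>, presented as a linear map on polynomials with kernel \<open>J\<close>.
  The coordinate space is again modelled by the univariate polynomials of degree less than
  \<open>D\<close>.\<close>

definition quot_coords ::
  "('n::finite, 'a::field) mpoly set \<Rightarrow> nat \<Rightarrow> (('n, 'a) mpoly \<Rightarrow> 'a poly) \<Rightarrow> bool" where
  "quot_coords J D \<pi> \<longleftrightarrow> (\<forall>p q. \<pi> (p + q) = \<pi> p + \<pi> q) \<and> (\<forall>c p. \<pi> (const_mpoly c * p) = smult c (\<pi> p)) \<and>
     (\<forall>p. \<pi> p = 0 \<longleftrightarrow> p \<in> J) \<and> range \<pi> = {y. \<forall>r\<ge>D. coeff y r = 0}"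

lemma quot_coordsD:
  assumes "quot_coords J D \<pi>"
  shows "\<pi> (p + q) = \<pi> p + \<pi> q" "\<pi> (const_mpoly c * p) = smult c (\<pi> p)" "\<pi> p = 0 \<longleftrightarrow> p \<in> J"
    "range \<pi> = {y. \<forall>r\<ge>D. coeff y r = 0}" "r \<ge> D \<Longrightarrow> coeff (\<pi> p) r = 0"
proof -
  show *: "range \<pi> = {y. \<forall>r\<ge>D. coeff y r = 0}" using assms by (simp add: quot_coords_def)
  show "r \<ge> D \<Longrightarrow> coeff (\<pi> p) r = 0" using rangeI[of \<pi> p] unfolding * by simp
qed (use assms in \<open>simp_all add: quot_coords_def\<close>)

lemma quot_coords_diff:
  assumes "quot_coords J D \<pi>"
  shows "\<pi> (p - q) = \<pi> p - \<pi> q"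
  using quot_coordsD(1)[OF assms, of "p - q" q] by simp

lemma quot_coords_sum:
  assumes "quot_coords J D \<pi>"
  shows "\<pi> (\<Sum>i\<in>A. f i) = (\<Sum>i\<in>A. \<pi> (f i))"
proof -
  have "\<pi> 0 = 0" using quot_coords_diff[OF assms, of 0 0] by simp
  then show ?thesis
    by (induction A rule: infinite_finite_induct) (simp_all add: quot_coordsD(1)[OF assms])
qed

lemma quot_coords_lincomb:
  assumes "quot_coords J D \<pi>"
  shows "\<pi> (lincomb n c p) = (\<Sum>i<n. smult (c i) (\<pi> (p i)))"
  by (simp add: lincomb_def quot_coords_sum[OF assms] quot_coordsD(2)[OF assms])

lemma quot_coords_basis:
  assumes "quot_coords J D \<pi>"
  obtains p where "\<And>i. i < D \<Longrightarrow> \<pi> (p i) = monom 1 i"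
proof -
  have "\<exists>f. \<pi> f = monom 1 i" if "i < D" for i
  proof -
    have "monom 1 i \<in> range \<pi>" unfolding quot_coordsD(4)[OF assms] using that by simp
    then show ?thesis by auto
  qed
  then have "\<forall>i. \<exists>f. i < D \<longrightarrow> \<pi> f = monom 1 i" by blast
  then obtain p where "\<forall>i. i < D \<longrightarrow> \<pi> (p i) = monom 1 i" by (rule choice[THEN exE])
  then show thesis using that by blast
qed

lemma sum_monom_eq_poly: "(\<Sum>i<n. smult (c i) (monom 1 i)) = poly_of_coords n c"
  by (simp add: poly_of_coords_def smult_monom)

lemma quot_coords_indep_mod:
  assumes "quot_coords J D \<pi>" "\<And>i. i < D \<Longrightarrow> \<pi> (p i) = monom 1 i"
  shows "indep_mod J D p" "\<exists>c. f - lincomb D c p \<in> J"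
proof -
  have lc: "\<pi> (lincomb D c p) = poly_of_coords D c" for c
    by (simp add: quot_coords_lincomb[OF assms(1)] assms(2) sum_monom_eq_poly)
  show "indep_mod J D p"
    unfolding indep_mod_def
  proof (intro allI impI)
    fix c i assume "lincomb D c p \<in> J" "i < D"
    then have "poly_of_coords D c = 0" using quot_coordsD(3)[OF assms(1)] by (simp flip: lc)
    then show "c i = 0" using coeff_poly_of_coords[of D c i] \<open>i < D\<close> by simp
  qed
  have "\<pi> f = \<pi> (lincomb D (coeff (\<pi> f)) p)"
    using quot_coordsD(5)[OF assms(1)] by (auto simp: lc poly_eq_iff)
  then have "\<pi> (f - lincomb D (coeff (\<pi> f)) p) = 0" by (simp add: quot_coords_diff[OF assms(1)])
  then show "\<exists>c. f - lincomb D c p \<in> J" using quot_coordsD(3)[OF assms(1)] by blast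
qed

lemma indep_mod_quot_coords:
  assumes J: "ideal J (mpoly_ring :: ('n::finite, 'a::field) mpoly ring)"
    and ind: "indep_mod J D p" and span: "\<And>f. \<exists>c. f - lincomb D c p \<in> J"
  shows "\<exists>\<pi>. quot_coords J D \<pi>"
proof -
  define \<pi> where "\<pi> f = poly_of_coords D (SOME c. f - lincomb D c p \<in> J)" for f
  have \<pi>: "\<pi> f = poly_of_coords D c" if c: "f - lincomb D c p \<in> J" for f c
  proof -
    define d where "d = (SOME c. f - lincomb D c p \<in> J)"
    have d: "f - lincomb D d p \<in> J" unfolding d_def using span by (rule someI_ex)
    have "lincomb D (\<lambda>i. c i + - 1 * d i) p = lincomb D c p - lincomb D d p"
      unfolding lincomb_add[symmetric] lincomb_scale[symmetric]
      by (simp add: const_mpoly_def single_uminus)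
    also have "\<dots> = (f - lincomb D d p) - (f - lincomb D c p)" by simp
    also have "\<dots> \<in> J" by (rule ideal_mpoly_diff[OF J d c])
    finally have "\<forall>i<D. c i = d i" using ind by (auto simp: indep_mod_def)
    then show ?thesis by (auto simp: \<pi>_def d_def[symmetric] poly_of_coords_def intro!: sum.cong)
  qed
  have "quot_coords J D \<pi>"
    unfolding quot_coords_def
  proof (intro conjI allI)
    fix f g
    obtain c d where cd: "f - lincomb D c p \<in> J" "g - lincomb D d p \<in> J"
      using span[of f] span[of g] by blast
    have "(f + g) - lincomb D (\<lambda>i. c i + d i) p = (f - lincomb D c p) + (g - lincomb D d p)"
      by (simp flip: lincomb_add)
    also have "\<dots> \<in> J" using cd J unfolding ideal_mpoly_iff by blast
    finally have "(f + g) - lincomb D (\<lambda>i. c i + d i) p \<in> J" .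
    then show "\<pi> (f + g) = \<pi> f + \<pi> g" using cd by (simp add: \<pi> poly_eq_iff)
  next
    fix a f
    obtain c where c: "f - lincomb D c p \<in> J" using span[of f] by blast
    have "const_mpoly a * f - lincomb D (\<lambda>i. a * c i) p = const_mpoly a * (f - lincomb D c p)"
      by (simp add: algebra_simps flip: lincomb_scale)
    also have "\<dots> \<in> J" using c J unfolding ideal_mpoly_iff by blast
    finally have "const_mpoly a * f - lincomb D (\<lambda>i. a * c i) p \<in> J" .
    then show "\<pi> (const_mpoly a * f) = smult a (\<pi> f)" using c by (simp add: \<pi> poly_eq_iff)
  next
    fix f
    obtain c where c: "f - lincomb D c p \<in> J" using span[of f] by blast
    have lc0: "lincomb D (\<lambda>_. 0) p = 0" by (simp add: lincomb_def)
    show "\<pi> f = 0 \<longleftrightarrow> f \<in> J"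
    proof
      assume "\<pi> f = 0"
      then have "poly_of_coords D c = 0" using \<pi>[OF c] by simp
      then have "c i = 0" if "i < D" for i using coeff_poly_of_coords[of D c i] that by simp
      then have "lincomb D c p = 0" by (simp add: lincomb_def)
      then show "f \<in> J" using c by simp
    next
      assume "f \<in> J"
      then have "f - lincomb D (\<lambda>_. 0) p \<in> J" by (simp add: lc0)
      from \<pi>[OF this] show "\<pi> f = 0" by (simp add: poly_of_coords_def)
    qed
  next
    have "y = \<pi> (lincomb D (coeff y) p)" if "\<forall>r\<ge>D. coeff y r = 0" for y
    proof -
      have "lincomb D (coeff y) p - lincomb D (coeff y) p \<in> J" using J by (simp add: ideal_mpoly_iff)
      from \<pi>[OF this] show ?thesis using that by (simp add: poly_eq_iff)
    qed
    then show "range \<pi> = {y. \<forall>r\<ge>D. coeff y r = 0}" by (auto simp: \<pi>_def)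
  qed
  then show ?thesis by blast
qed

text \<open>Preimages of the basis under \<open>\<pi>'\<close> are independent modulo
  \<open>J\<close>, and \<open>\<pi>\<close> has the same kernel \<open>J\<close>, so their images
  under \<open>\<pi>\<close> are independent too.\<close>

lemma quot_coords_le:
  assumes "quot_coords J D \<pi>" "quot_coords J D' \<pi>'"
  shows "D' \<le> D"
proof -
  interpret linear_space "smult :: 'b \<Rightarrow> 'b poly \<Rightarrow> 'b poly" by (rule linear_space_smult)
  obtain p where p: "\<And>i. i < D' \<Longrightarrow> \<pi>' (p i) = monom 1 i" using quot_coords_basis[OF assms(2)] by blast
  note ind = quot_coords_indep_mod(1)[OF assms(2) p]
  define T where "T = (\<lambda>r. monom (1 :: 'b) r) ` {..<D}"
  have "indep_family {..<D'} (\<lambda>i. \<pi> (p i))"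
    unfolding indep_family_def
  proof (intro allI impI)
    fix c assume "(\<Sum>i<D'. smult (c i) (\<pi> (p i))) = 0"
    then have "\<pi> (lincomb D' c p) = 0" by (simp add: quot_coords_lincomb[OF assms(1)])
    then have "lincomb D' c p \<in> J" by (simp add: quot_coordsD(3)[OF assms(1)])
    then show "\<forall>i\<in>{..<D'}. c i = 0" using ind by (auto simp: indep_mod_def)
  qed
  moreover have "\<pi> f \<in> span T" for f
  proof -
    have "\<pi> f = poly_of_coords D (coeff (\<pi> f))"
      using quot_coordsD(5)[OF assms(1)] by (simp add: poly_eq_iff)
    also have "\<dots> = (\<Sum>r<D. smult (coeff (\<pi> f) r) (monom 1 r))" by (simp add: sum_monom_eq_poly)
    also have "\<dots> \<in> span T" by (intro span_sum span_scale span_base) (auto simp: T_def)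
    finally show ?thesis .
  qed
  ultimately have "card {..<D'} \<le> card T" by (intro indep_family_card_le) (auto simp: T_def)
  also have "card T \<le> D" using card_image_le[of "{..<D}" "\<lambda>r. monom (1 :: 'b) r"] by (simp add: T_def)
  finally show ?thesis by simp
qed

lemma quot_finite_dim_coords:
  assumes J: "ideal J (mpoly_ring :: ('n::finite, 'a::field) mpoly ring)" and fin: "quot_finite_dim J"
  shows "\<exists>D \<pi>. quot_coords J D \<pi>"
proof -
  interpret Q: ring "mpoly_ring Quot J" by (rule ideal.quotient_is_ring[OF J])
  obtain D where D: "Q.dimension D (quot_scalars J) (carrier (mpoly_ring Quot J))"
    using fin by (auto simp: quot_finite_dim_def Q.finite_dimension_def)
  obtain p where p: "indep_mod J D p" "range (\<lambda>f. J +>\<^bsub>mpoly_ring\<^esub> f) = (\<lambda>f. J +>\<^bsub>mpoly_ring\<^esub> f) ` range (\<lambda>c. lincomb D c p)"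
    using dimension_imp_indep_mod[OF J D] unfolding quot_ring_ops(4)[OF J] by blast
  have "\<exists>c. f - lincomb D c p \<in> J" for f
  proof -
    have "J +>\<^bsub>mpoly_ring\<^esub> f \<in> (\<lambda>f. J +>\<^bsub>mpoly_ring\<^esub> f) ` range (\<lambda>c. lincomb D c p)" using p(2) by blast
    then show ?thesis by (auto simp: coset_eq_iff[OF J])
  qed
  from indep_mod_quot_coords[OF J p(1) this] show ?thesis by blast
qed

text \<open>\<open>dim\<close> is a definite description, so uniqueness must be shown as well: any
  other dimension yields coordinates of the same quotient, and \<open>quot_coords_le\<close> applies
  in both directions.\<close>

lemma quot_coords_quot_dim:
  assumes J: "ideal J (mpoly_ring :: ('n::finite, 'a::field) mpoly ring)" and \<pi>: "quot_coords J D \<pi>"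
  shows "quot_dim J = D"
proof -
  interpret Q: ring "mpoly_ring Quot J" by (rule ideal.quotient_is_ring[OF J])
  have car: "carrier (mpoly_ring Quot J) = (\<lambda>f. J +>\<^bsub>mpoly_ring\<^esub> f) ` range (\<lambda>c. lincomb k c p)"
    if span: "\<And>f. \<exists>c. f - lincomb k c p \<in> J" for k p
  proof -
    have "J +>\<^bsub>mpoly_ring\<^esub> f \<in> (\<lambda>f. J +>\<^bsub>mpoly_ring\<^esub> f) ` range (\<lambda>c. lincomb k c p)" for f
    proof -
      obtain c where "f - lincomb k c p \<in> J" using span by blast
      then have "J +>\<^bsub>mpoly_ring\<^esub> f = J +>\<^bsub>mpoly_ring\<^esub> lincomb k c p" by (simp add: coset_eq_iff[OF J])
      then show ?thesis by blast
    qed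
    then show ?thesis unfolding quot_ring_ops(4)[OF J] by blast
  qed
  obtain p where p: "\<And>i. i < D \<Longrightarrow> \<pi> (p i) = monom 1 i" using quot_coords_basis[OF \<pi>] by blast
  note basis = quot_coords_indep_mod[OF \<pi> p]
  have "Q.dimension D (quot_scalars J) (carrier (mpoly_ring Quot J))"
    using indep_mod_imp_dimension[OF J basis(1)] car[OF basis(2)] by simp
  moreover have "k = D" if k: "Q.dimension k (quot_scalars J) (carrier (mpoly_ring Quot J))" for k
  proof -
    obtain p' where p': "indep_mod J k p'"
      "range (\<lambda>f. J +>\<^bsub>mpoly_ring\<^esub> f) = (\<lambda>f. J +>\<^bsub>mpoly_ring\<^esub> f) ` range (\<lambda>c. lincomb k c p')"
      using dimension_imp_indep_mod[OF J k] unfolding quot_ring_ops(4)[OF J] by blast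
    have "\<exists>c. f - lincomb k c p' \<in> J" for f
    proof -
      have "J +>\<^bsub>mpoly_ring\<^esub> f \<in> (\<lambda>f. J +>\<^bsub>mpoly_ring\<^esub> f) ` range (\<lambda>c. lincomb k c p')" using p'(2) by blast
      then show ?thesis by (auto simp: coset_eq_iff[OF J])
    qed
    from indep_mod_quot_coords[OF J p'(1) this] obtain \<pi>' where "quot_coords J k \<pi>'" by blast
    then show "k = D" using quot_coords_le[OF \<pi>] quot_coords_le[OF _ \<pi>] by (simp add: le_antisym)
  qed
  ultimately show ?thesis unfolding quot_dim_def Q.dim_def by (rule the_equality)
qed

text \<open>
  The rows of \<open>Z\<close> are the functionals dual to a basis of \<open>K\<^sup>D\<close> that starts with a basis of a complement of
  the image of \<open>J\<close>.
\<close>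

lemma quotient_adapted_matrix:
  assumes J: "ideal J (mpoly_ring :: ('n::finite, 'a::field) mpoly ring)" "I \<subseteq> J"
    and \<pi>: "quot_coords I D \<pi>"
  shows "quot_dim J \<le> D"
    "\<exists>Z\<in>carrier_mat D D. Determinant.det Z \<noteq> 0 \<and>
      (\<forall>r<quot_dim J. \<forall>f\<in>J. (\<Sum>s<D. Z $$ (r, s) * coeff (\<pi> f) s) = 0)"
proof -
  interpret linear_space "smult :: 'a \<Rightarrow> 'a poly \<Rightarrow> 'a poly" by (rule linear_space_smult)
  define T where "T = (\<lambda>r. monom (1 :: 'a) r) ` {..<D}"
  have finT: "finite T" and cardT: "card T = D"
    by (simp add: T_def) (simp add: T_def card_image inj_on_def monom_eq_iff')
  have expand: "y = (\<Sum>s<D. smult (coeff y s) (monom 1 s))" if "\<And>r. r \<ge> D \<Longrightarrow> coeff y r = 0" for y :: "'a poly"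
    unfolding sum_monom_eq_poly using that by (simp add: poly_eq_iff)
  have span_T: "span T = range \<pi>"
  proof
    have sub: "subspace (range \<pi>)" unfolding quot_coordsD(4)[OF \<pi>] subspace_def by simp
    have "T \<subseteq> range \<pi>" unfolding quot_coordsD(4)[OF \<pi>] by (auto simp: T_def)
    then show "span T \<subseteq> range \<pi>" using sub by (rule span_minimal)
    show "range \<pi> \<subseteq> span T"
    proof
      fix y assume "y \<in> range \<pi>"
      then have "y = (\<Sum>s<D. smult (coeff y s) (monom 1 s))"
        using quot_coordsD(5)[OF \<pi>] by (intro expand) auto
      also have "\<dots> \<in> span T" by (intro span_sum span_scale span_base) (auto simp: T_def)
      finally show "y \<in> span T" .
    qed
  qed
  have indT: "independent T"
  proof -
    have "indep_family {..<D} (\<lambda>r. monom (1 :: 'a) r)"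
      unfolding indep_family_def
    proof (intro allI impI ballI)
      fix c :: "nat \<Rightarrow> 'a" and i assume "(\<Sum>i<D. smult (c i) (monom 1 i)) = 0" "i \<in> {..<D}"
      then show "c i = 0" using coeff_poly_of_coords[of D c i] by (simp add: sum_monom_eq_poly)
    qed
    from independent_image_family[OF _ this] show ?thesis by (simp add: T_def)
  qed

  \<comment> \<open>A basis adapted to the image of the larger ideal\<close>
  define E where "E = \<pi> ` J"
  have J0: "0 \<in> J" and Jadd: "\<And>p q. p \<in> J \<Longrightarrow> q \<in> J \<Longrightarrow> p + q \<in> J" and Jmult: "\<And>p q. p \<in> J \<Longrightarrow> q * p \<in> J"
    using J(1) by (auto simp: ideal_mpoly_iff)
  have mem_J: "f \<in> J" if "\<pi> f \<in> E" for f
  proof -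
    obtain g where g: "g \<in> J" "\<pi> f = \<pi> g" using \<open>\<pi> f \<in> E\<close> by (auto simp: E_def)
    then have "\<pi> (f - g) = 0" by (simp add: quot_coords_diff[OF \<pi>])
    then have "f - g \<in> J" using quot_coordsD(3)[OF \<pi>] J(2) by auto
    from Jadd[OF this g(1)] show ?thesis by simp
  qed
  have subE: "subspace E"
    unfolding subspace_def
  proof (intro conjI ballI allI)
    show "0 \<in> E" using J0 quot_coords_diff[OF \<pi>, of 0 0] unfolding E_def by force
  next
    fix y z assume "y \<in> E" "z \<in> E"
    then obtain f g where "f \<in> J" "g \<in> J" "y = \<pi> f" "z = \<pi> g" by (auto simp: E_def)
    then have "y + z = \<pi> (f + g)" "f + g \<in> J" by (simp_all add: quot_coordsD(1)[OF \<pi>] Jadd)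
    then show "y + z \<in> E" by (simp add: E_def)
  next
    fix c y assume "y \<in> E"
    then obtain f where "f \<in> J" "y = \<pi> f" by (auto simp: E_def)
    then have "smult c y = \<pi> (const_mpoly c * f)" "const_mpoly c * f \<in> J"
      by (simp_all add: quot_coordsD(2)[OF \<pi>] Jmult)
    then show "smult c y \<in> E" by (simp add: E_def)
  qed
  obtain BE where BE: "BE \<subseteq> E" "independent BE" "E \<subseteq> span BE" by (rule maximal_independent_subset)
  have span_BE: "span BE = E" using BE(1,3) span_minimal[OF BE(1) subE] by blast
  have "BE \<subseteq> span T" using BE(1) unfolding span_T E_def by blast
  then obtain B where B: "BE \<subseteq> B" "B \<subseteq> span T" "independent B" "span T \<subseteq> span B"
    using maximal_independent_subset_extend[OF _ BE(2)] by blast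
  have span_B: "span B = span T" using B(2,4) span_minimal[OF B(2) subspace_span] by blast
  have finB: "finite B" using independent_span_bound[OF finT B(3,2)] by blast
  have cardB: "card B = D"
    using dim_span_eq_card_independent[OF B(3)] dim_span_eq_card_independent[OF indT] span_B cardT by simp
  define m where "m = card (B - BE)"
  \<comment> \<open>The basis vectors outside \<open>BE\<close> are listed first, so that the rows
    below \<open>m\<close> belong to the complement of the image of \<open>J\<close>.\<close>
  obtain xs ys where xs: "set xs = B - BE" "distinct xs" and ys: "set ys = BE" "distinct ys"
    using finite_distinct_list[of "B - BE"] finite_distinct_list[of BE] finB B(1) by (metis finite_Diff finite_subset)
  define h where "h r = (xs @ ys) ! r" for r
  have lxs: "length xs = m" using xs by (simp add: m_def distinct_card flip: xs(1))
  have dist: "distinct (xs @ ys)" "set (xs @ ys) = B" using xs ys B(1) by auto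
  have len: "length (xs @ ys) = D" using distinct_card[OF dist(1)] dist(2) cardB by simp
  have h: "bij_betw h {..<D} B"
    unfolding h_def using bij_betw_nth[OF dist(1), of "{..<D}" B] dist(2) len by simp
  have mD: "m \<le> D" using len lxs by simp
  have h_lo: "h r \<in> B - BE" if "r < m" for r
    using that lxs nth_mem[of r xs] unfolding h_def by (simp add: nth_append xs(1))
  have h_ex: "\<exists>r<m. b = h r" if "b \<in> B - BE" for b
  proof -
    have "b \<in> set xs" using that xs(1) by simp
    then obtain r where "r < length xs" "b = xs ! r" by (auto simp: in_set_conv_nth)
    then show ?thesis using lxs by (intro exI[of _ r]) (simp add: h_def nth_append)
  qed

  have rep_add: "representation B (y + z) b = representation B y b + representation B z b"
    if "y \<in> range \<pi>" "z \<in> range \<pi>" for y z b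
    using representation_add[OF B(3), of z y] that span_B span_T by simp
  have rep_scale: "representation B (smult c y) b = c * representation B y b" if "y \<in> range \<pi>" for c y b
    using representation_scale[OF B(3), of y c] that span_B span_T by simp
  have rep_sum: "representation B (\<Sum>i\<in>A. smult (c i) (v i)) b = (\<Sum>i\<in>A. c i * representation B (v i) b)"
    if "\<And>i. i \<in> A \<Longrightarrow> v i \<in> range \<pi>" for A :: "nat set" and c v b
  proof -
    have "smult (c i) (v i) \<in> span B" if "i \<in> A" for i
      using \<open>\<And>i. i \<in> A \<Longrightarrow> v i \<in> range \<pi>\<close>[OF that] span_scale span_B span_T by metis
    then have "representation B (\<Sum>i\<in>A. smult (c i) (v i)) = (\<lambda>b. \<Sum>i\<in>A. representation B (smult (c i) (v i)) b)"
      by (rule representation_sum[OF B(3)])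
    then show ?thesis using that by (simp add: rep_scale)
  qed
  have rep_J: "representation B (\<pi> f) b = 0" if "f \<in> J" "b \<notin> BE" for f b
  proof -
    have "\<pi> f \<in> span BE" using that(1) span_BE by (simp add: E_def)
    then have "representation B (\<pi> f) = representation BE (\<pi> f)"
      using representation_extend[OF B(3) _ B(1)] by blast
    then show ?thesis using representation_ne_zero[of BE "\<pi> f" b] that(2) by auto
  qed
  have rep_eq: "y = (\<Sum>b\<in>B. smult (representation B y b) b)" if "y \<in> range \<pi>" for y
    using sum_representation_eq[OF B(3), of y B] that span_B span_T finB by simp

  \<comment> \<open>Coordinates on the quotient by the larger ideal\<close>
  define \<pi>' where "\<pi>' f = poly_of_coords m (\<lambda>r. representation B (\<pi> f) (h r))" for f
  have "quot_coords J m \<pi>'"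
    unfolding quot_coords_def
  proof (intro conjI allI)
    show "\<pi>' (f + g) = \<pi>' f + \<pi>' g" for f g
      by (simp add: \<pi>'_def poly_eq_iff quot_coordsD(1)[OF \<pi>] rep_add[OF rangeI rangeI])
    show "\<pi>' (const_mpoly c * f) = smult c (\<pi>' f)" for c f
      by (simp add: \<pi>'_def poly_eq_iff quot_coordsD(2)[OF \<pi>] rep_scale[OF rangeI])
    show "\<pi>' f = 0 \<longleftrightarrow> f \<in> J" for f
    proof
      assume zero: "\<pi>' f = 0"
      have "representation B (\<pi> f) (h r) = coeff (\<pi>' f) r" if "r < m" for r
        using that by (simp add: \<pi>'_def)
      then have "representation B (\<pi> f) (h r) = 0" if "r < m" for r using that zero by simp
      then have 0: "representation B (\<pi> f) b = 0" if "b \<in> B - BE" for b using h_ex[OF that] by auto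
      have "\<pi> f = (\<Sum>b\<in>B. smult (representation B (\<pi> f) b) b)" by (rule rep_eq) simp
      also have "\<dots> = (\<Sum>b\<in>BE. smult (representation B (\<pi> f) b) b)"
        using finB B(1) 0 by (intro sum.mono_neutral_right) auto
      also have "\<dots> \<in> span BE" by (intro span_sum span_scale span_base)
      finally show "f \<in> J" unfolding span_BE by (rule mem_J)
    next
      assume "f \<in> J"
      then show "\<pi>' f = 0" using rep_J h_lo by (simp add: \<pi>'_def poly_eq_iff)
    qed
    have "y \<in> range \<pi>'" if y: "\<forall>r\<ge>m. coeff y r = 0" for y
    proof -
      have hr: "h r \<in> range \<pi>" if "r < m" for r using h_lo[OF that] B(2) span_T by auto
      define z where "z = (\<Sum>r<m. smult (coeff y r) (h r))"
      have "z \<in> span T" unfolding z_def using hr span_T by (intro span_sum span_scale) auto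
      then obtain f where f: "z = \<pi> f" using span_T by auto
      have "representation B z (h r) = coeff y r" if r: "r < m" for r
      proof -
        have "representation B z (h r) = (\<Sum>i<m. coeff y i * representation B (h i) (h r))"
          unfolding z_def using hr by (intro rep_sum) auto
        also have "\<dots> = (\<Sum>i<m. coeff y i * (if i = r then 1 else 0))"
        proof (rule sum.cong)
          fix i assume "i \<in> {..<m}"
          then have "h i \<in> B" "h r = h i \<longleftrightarrow> i = r" using h_lo h r mD by (auto simp: bij_betw_def inj_on_def)
          then show "coeff y i * representation B (h i) (h r) = coeff y i * (if i = r then 1 else 0)"
            by (simp add: representation_basis[OF B(3)])
        qed simp
        finally show ?thesis using r by (simp add: mult_delta_right)
      qed
      then have "y = \<pi>' f" using y by (simp add: \<pi>'_def poly_eq_iff flip: f)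
      then show ?thesis by simp
    qed
    then show "range \<pi>' = {y. \<forall>r\<ge>m. coeff y r = 0}" by (auto simp: \<pi>'_def)
  qed
  then have dim: "quot_dim J = m" by (rule quot_coords_quot_dim[OF J(1)])
  then show "quot_dim J \<le> D" using mD by simp

  \<comment> \<open>The matrix of the dual basis\<close>
  define Z where "Z = Matrix.mat D D (\<lambda>(r, s). representation B (monom 1 s) (h r))"
  have Z: "Z \<in> carrier_mat D D" by (simp add: Z_def)
  have monom_in: "monom 1 s \<in> range \<pi>" if "s < D" for s using that unfolding quot_coordsD(4)[OF \<pi>] by simp
  have Z_apply: "(\<Sum>s<D. Z $$ (r, s) * coeff y s) = representation B y (h r)" if "r < D" "y \<in> range \<pi>" for r y
  proof -
    have "representation B y (h r) = representation B (\<Sum>s<D. smult (coeff y s) (monom 1 s)) (h r)"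
      using expand[of y] that(2) quot_coordsD(5)[OF \<pi>] by auto
    also have "\<dots> = (\<Sum>s<D. coeff y s * representation B (monom 1 s) (h r))"
      using monom_in by (intro rep_sum) auto
    finally show ?thesis using that(1) by (simp add: Z_def mult.commute)
  qed
  have "Determinant.det Z \<noteq> 0"
  proof
    assume "Determinant.det Z = 0"
    then obtain v where v: "v \<in> carrier_vec D" "v \<noteq> 0\<^sub>v D" "Z *\<^sub>v v = 0\<^sub>v D"
      using det_0_iff_vec_prod_zero[OF Z] by blast
    define y where "y = poly_of_coords D (vec_index v)"
    have y: "y \<in> range \<pi>" unfolding quot_coordsD(4)[OF \<pi>] by (simp add: y_def)
    have "representation B y (h r) = 0" if r: "r < D" for r
    proof -
      have "(\<Sum>s<D. Z $$ (r, s) * coeff y s) = vec_index (Z *\<^sub>v v) r"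
        using r v(1) Z by (simp add: y_def scalar_prod_def atLeast0LessThan)
      then show ?thesis using Z_apply[OF r y] r by (simp add: v(3))
    qed
    then have "representation B y b = 0" if "b \<in> B" for b
      using h that by (auto simp: bij_betw_def)
    then have "y = 0" using rep_eq[OF y] by simp
    have "vec_index v s = coeff y s" if "s < D" for s using that by (simp add: y_def)
    then have "vec_index v s = 0" if "s < D" for s using that \<open>y = 0\<close> by simp
    then have "v = 0\<^sub>v D" using v(1) by (intro eq_vecI) auto
    with v(2) show False ..
  qed
  moreover have "(\<Sum>s<D. Z $$ (r, s) * coeff (\<pi> f) s) = 0" if "r < m" "f \<in> J" for r f
    using Z_apply[of r "\<pi> f"] rep_J[OF that(2)] h_lo[OF that(1)] that(1) mD by simp
  ultimately show "\<exists>Z\<in>carrier_mat D D. Determinant.det Z \<noteq> 0 \<and>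
      (\<forall>r<quot_dim J. \<forall>f\<in>J. (\<Sum>s<D. Z $$ (r, s) * coeff (\<pi> f) s) = 0)"
    unfolding dim using Z by blast
qed

text \<open>Replacing \<open>f\<close> by the combination of the \<open>p s\<close> with the same
  coordinates changes \<open>g * f\<close> only by an element of \<open>I\<close>. Multiplication by
  \<open>g\<close> is thus given by a matrix.\<close>

lemma quot_coords_mult:
  assumes I: "ideal I (mpoly_ring :: ('n::finite, 'a::field) mpoly ring)" and \<pi>: "quot_coords I D \<pi>"
    and p: "\<And>i. i < D \<Longrightarrow> \<pi> (p i) = monom 1 i"
  shows "\<pi> (g * f) = (\<Sum>s<D. smult (coeff (\<pi> f) s) (\<pi> (g * p s)))"
proof -
  define f' where "f' = lincomb D (coeff (\<pi> f)) p"
  have "\<pi> f' = poly_of_coords D (coeff (\<pi> f))"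
    by (simp add: f'_def quot_coords_lincomb[OF \<pi>] p sum_monom_eq_poly)
  also have "\<dots> = \<pi> f" using quot_coordsD(5)[OF \<pi>] by (simp add: poly_eq_iff)
  finally have "\<pi> (f - f') = 0" by (simp add: quot_coords_diff[OF \<pi>])
  then have "g * (f - f') \<in> I" using I quot_coordsD(3)[OF \<pi>] by (simp add: ideal_mpoly_iff)
  then have "\<pi> (g * f - g * f') = 0" using quot_coordsD(3)[OF \<pi>] by (simp add: right_diff_distrib)
  then have "\<pi> (g * f) = \<pi> (g * f')" by (simp add: quot_coords_diff[OF \<pi>])
  also have "g * f' = lincomb D (coeff (\<pi> f)) (\<lambda>s. g * p s)"
    by (simp add: f'_def lincomb_def sum_distrib_left mult.left_commute)
  finally show ?thesis by (simp add: quot_coords_lincomb[OF \<pi>])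
qed

text \<open>Indexed by plain functions, as in the counting of exponent vectors; on the finite type
  \<open>'n\<close> every function has finite support.\<close>

definition mon_mpoly :: "('n::finite \<Rightarrow> nat) \<Rightarrow> ('n, 'a::field) mpoly" where
  "mon_mpoly u = Poly_Mapping.single (Abs_poly_mapping u) 1"

lemma var_times_mon: "var_mpoly i * mon_mpoly u = mon_mpoly (u(i := Suc (u i)))"
proof -
  have "Poly_Mapping.single i 1 + Abs_poly_mapping u = Abs_poly_mapping (u(i := Suc (u i)))"
    by (rule poly_mapping_eqI) (simp add: lookup_add lookup_single when_def)
  then show ?thesis by (simp add: var_mpoly_def mon_mpoly_def mult_single)
qed

lemma mpoly_sum_mons:
  "p = (\<Sum>u\<in>Poly_Mapping.lookup ` Poly_Mapping.keys p.
     const_mpoly (Poly_Mapping.lookup p (Abs_poly_mapping u)) * mon_mpoly u)"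
proof -
  have inj: "inj_on Poly_Mapping.lookup (Poly_Mapping.keys p)"
    by (rule inj_onI) (simp add: lookup_inject)
  have "p = (\<Sum>e\<in>Poly_Mapping.keys p. Poly_Mapping.single e (Poly_Mapping.lookup p e))"
    by (rule mpoly_sum_singles)
  also have "\<dots> = (\<Sum>u\<in>Poly_Mapping.lookup ` Poly_Mapping.keys p.
      const_mpoly (Poly_Mapping.lookup p (Abs_poly_mapping u)) * mon_mpoly u)"
    by (simp add: sum.reindex[OF inj] lookup_inverse const_mpoly_def mon_mpoly_def mult_single)
  finally show ?thesis .
qed

theorem theorem3p5:
  fixes I :: "('n::finite, 'a::{field,finite}) mpoly set"
    and q n m :: nat
  assumes "CARD('a) = q"
    and "CARD('n) = n"
    and "n \<ge> 2"
    and "m \<le> q ^ (n - 1)"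
    and "hom_furstenberg (n - 1) m I"
  shows "real (quot_dim I) \<ge> real m powr (real n / (real n - 1)) / 16"
proof -
  have I: "ideal I (mpoly_ring :: ('n, 'a) mpoly ring)" and fin: "quot_finite_dim I"
    and rich: "\<And>W. vec.subspace W \<Longrightarrow> vec.dim W = n - 1 \<Longrightarrow> rich I m W"
    using assms(5) by (auto simp: hom_furstenberg_def)
  obtain D \<pi> where \<pi>: "quot_coords I D \<pi>" using quot_finite_dim_coords[OF I fin] by blast
  have dim: "quot_dim I = D" by (rule quot_coords_quot_dim[OF I \<pi>])
  obtain p where p: "\<And>i. i < D \<Longrightarrow> \<pi> (p i) = monom 1 i" using quot_coords_basis[OF \<pi>] by blast
  \<comment> \<open>The matrix of multiplication by the i-th variable in the coordinates
    \<open>\<pi>\<close>.\<close>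
  define y where "y i r c = coeff (\<pi> (var_mpoly i * p c)) r" for i r c
  have mult: "(\<Sum>s<D. y i r s * coeff (\<pi> f) s) = coeff (\<pi> (var_mpoly i * f)) r" for i r f
  proof -
    have "\<pi> (var_mpoly i * f) = (\<Sum>s<D. smult (coeff (\<pi> f) s) (\<pi> (var_mpoly i * p s)))"
      by (rule quot_coords_mult[OF I \<pi> p])
    then show ?thesis by (simp add: y_def coeff_sum mult.commute[of "coeff (\<pi> f) _"])
  qed

  have hyperplane: "\<exists>J. ideal J (mpoly_ring :: ('n, 'a) mpoly ring) \<and> I \<subseteq> J \<and> linear_mpoly a \<in> J \<and> m \<le> quot_dim J"
    if a: "a k \<noteq> 0" for a :: "'n \<Rightarrow> 'a" and k
  proof -
    define W where "W = {w :: 'a ^ 'n. (\<Sum>i\<in>UNIV. a i * vec_nth w i) = 0}"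
    \<comment> \<open>The ideal J is the sum of \<open>I\<close> and the vanishing ideal of the
      hyperplane, so richness is the bound on its quotient.\<close>
    have "m \<le> quot_dim (I <+>\<^bsub>mpoly_ring\<^esub> vanishing_ideal W)"
      using rich[of W] hyperplane_subspace_dim[of a k] a assms(2) by (simp add: W_def rich_def)
    moreover have "linear_mpoly a \<in> vanishing_ideal W" by (rule linear_mpoly_vanishes) (simp add: W_def)
    ultimately show ?thesis using sum_ideals_mpoly[OF I vanishing_ideal_ideal[of W]] by blast
  qed

  define S where "S = range (to_ac :: 'a \<Rightarrow> 'a alg_closure)"
  have cardS: "card S = q" unfolding S_def using assms(1) by (simp add: card_image inj_def)
  interpret ac: comm_ring_hom "to_ac :: 'a \<Rightarrow> 'a alg_closure" by unfold_locales auto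
  have "real m powr (real n / (real n - 1)) / 16 \<le> real D"
  proof (rule commuting_matrices_bound)
    show "infinite (UNIV :: 'a alg_closure set)" by (rule infinite_alg_closed_field)
    show "finite S" "S \<noteq> {}" by (auto simp: S_def)
    show "CARD('n) = n" "n \<ge> 2" by fact+
    show "m \<le> card S ^ (n - 1)" using assms(4) cardS by simp
    show "m \<le> D"
    proof -
      obtain J where "ideal J (mpoly_ring :: ('n, 'a) mpoly ring)" "I \<subseteq> J" "m \<le> quot_dim J"
        using hyperplane[of "\<lambda>_. 1"] by auto
      then show ?thesis using quotient_adapted_matrix(1)[OF _ _ \<pi>] by (meson le_trans)
    qed
  next
    fix i k r c assume "c < D"
    have "(\<Sum>s<D. y i r s * y k s c) = coeff (\<pi> (var_mpoly i * (var_mpoly k * p c))) r" for i k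
      using mult[of i r "var_mpoly k * p c"] by (simp add: y_def)
    then have "(\<Sum>s<D. y i r s * y k s c) = (\<Sum>s<D. y k r s * y i s c)" by (simp add: mult.left_commute)
    then show "(\<Sum>s<D. to_ac (y i r s) * to_ac (y k s c)) = (\<Sum>s<D. to_ac (y k r s) * to_ac (y i s c))"
      by (metis (no_types, lifting) to_ac_mult to_ac_sum sum.cong)
  next
    fix i u r
    show "(\<Sum>s<D. to_ac (y i r s) * to_ac (coeff (\<pi> (mon_mpoly u)) s)) = to_ac (coeff (\<pi> (mon_mpoly (u(i := Suc (u i))))) r)"
      by (simp add: mult[symmetric] to_ac_sum flip: var_times_mon)
  next
    fix s assume s: "s < D"
    define F where "F = Poly_Mapping.lookup ` Poly_Mapping.keys (p s)"
    define c where "c u = Poly_Mapping.lookup (p s) (Abs_poly_mapping u)" for u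
    have "p s = (\<Sum>u\<in>F. const_mpoly (c u) * mon_mpoly u)"
      unfolding F_def c_def by (rule mpoly_sum_mons)
    then have "\<pi> (p s) = \<pi> (\<Sum>u\<in>F. const_mpoly (c u) * mon_mpoly u)" by (rule arg_cong)
    then have "(\<Sum>u\<in>F. c u * coeff (\<pi> (mon_mpoly u)) r) = coeff (\<pi> (p s)) r" for r
      by (simp add: quot_coords_sum[OF \<pi>] quot_coordsD(2)[OF \<pi>] coeff_sum)
    then have "to_ac (\<Sum>u\<in>F. c u * coeff (\<pi> (mon_mpoly u)) r) = (if r = s then 1 else 0)" for r
      using s by (simp add: p)
    then have "\<forall>r<D. (\<Sum>u\<in>F. to_ac (c u) * to_ac (coeff (\<pi> (mon_mpoly u)) r)) = (if r = s then 1 else 0)"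
      by (simp add: to_ac_sum)
    moreover have "finite F" by (simp add: F_def)
    ultimately have "finite F \<and> (\<forall>r<D. (\<Sum>u\<in>F. to_ac (c u) * to_ac (coeff (\<pi> (mon_mpoly u)) r)) = (if r = s then 1 else 0))"
      by blast
    then show "\<exists>F c. finite F \<and> (\<forall>r<D. (\<Sum>u\<in>F. c u * to_ac (coeff (\<pi> (mon_mpoly u)) r)) = (if r = s then 1 else 0))"
      by (rule exI[where x = F, OF exI[where x = "\<lambda>u. to_ac (c u)"]])
  next
    fix a :: "'n \<Rightarrow> 'a alg_closure" assume "\<And>i. a i \<in> S"
    then have "\<forall>i. \<exists>c. a i = to_ac c" by (auto simp: S_def)
    then obtain a' where a': "\<And>i. a i = to_ac (a' i)" by metis
    show "\<exists>Z\<in>carrier_mat D D. Determinant.det Z \<noteq> 0 \<and>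
      (\<forall>r<m. \<forall>c<D. (\<Sum>s<D. Z $$ (r, s) * (\<Sum>i\<in>UNIV. a i * to_ac (y i s c))) = 0)"
    \<comment> \<open>The zero form defines no hyperplane, but its matrix is zero and the identity
      serves as \<open>Z\<close>.\<close>
    proof (cases "\<forall>i. a' i = 0")
      case True
      then show ?thesis by (intro bexI[of _ "1\<^sub>m D"]) (auto simp: a')
    next
      case False
      then obtain k where "a' k \<noteq> 0" by blast
      from hyperplane[of a' k, OF this] obtain J where J: "ideal J (mpoly_ring :: ('n, 'a) mpoly ring)" "I \<subseteq> J"
        "linear_mpoly a' \<in> J" "m \<le> quot_dim J" by blast
      obtain Z where Z: "Z \<in> carrier_mat D D" "Determinant.det Z \<noteq> 0"
        "\<And>r f. r < quot_dim J \<Longrightarrow> f \<in> J \<Longrightarrow> (\<Sum>s<D. Z $$ (r, s) * coeff (\<pi> f) s) = 0"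
        using quotient_adapted_matrix(2)[OF J(1,2) \<pi>] by blast
      have mD: "m \<le> D" using quotient_adapted_matrix(1)[OF J(1,2) \<pi>] J(4) by simp
      have "(\<Sum>s<D. map_mat to_ac Z $$ (r, s) * (\<Sum>i\<in>UNIV. a i * to_ac (y i s c))) = 0" if "r < m" "c < D" for r c
      proof -
        \<comment> \<open>Column \<open>c\<close> of the matrix of the form is the coordinate vector
          of its product with \<open>p c\<close>, which lies in \<open>J\<close> and is therefore
          annihilated by the first \<open>m\<close> rows of \<open>Z\<close>.\<close>
        have "coeff (\<pi> (p c * linear_mpoly a')) s = (\<Sum>i\<in>UNIV. a' i * y i s c)" for s
        proof -
          have "p c * linear_mpoly a' = (\<Sum>i\<in>UNIV. const_mpoly (a' i) * (var_mpoly i * p c))"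
            by (simp add: linear_mpoly_def sum_distrib_left mult_ac)
          then show ?thesis
            by (simp add: quot_coords_sum[OF \<pi>] quot_coordsD(2)[OF \<pi>] coeff_sum y_def)
        qed
        moreover have "p c * linear_mpoly a' \<in> J" using J(1,3) by (simp add: ideal_mpoly_iff)
        ultimately have "(\<Sum>s<D. Z $$ (r, s) * (\<Sum>i\<in>UNIV. a' i * y i s c)) = 0"
          using Z(3)[of r "p c * linear_mpoly a'"] that(1) J(4) by simp
        then have "to_ac (\<Sum>s<D. Z $$ (r, s) * (\<Sum>i\<in>UNIV. a' i * y i s c)) = 0" by simp
        then show ?thesis using Z(1) that(1) mD by (simp add: to_ac_sum a')
      qed
      moreover have "Determinant.det (map_mat to_ac Z) \<noteq> 0" using Z(2) by simp
      ultimately show ?thesis using Z(1) by (intro bexI[of _ "map_mat to_ac Z"]) auto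
    qed
  qed
  then show ?thesis by (simp add: dim)
qed

end
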